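(* Let $\overline{p}(n)$ be the number of overpartitions of $n$. For all integers $n\ge 2$, $$\frac{\sqrt[n]{\overline{p}(n)}}{\sqrt[n+1]{\overline{p}(n+1)}}\left(1+\frac{3\pi}{4n^{5/2}}\right)>\frac{\sqrt[n-1]{\overline{p}(n-1)}}{\sqrt[n]{\overline{p}(n)}}.$$
   Context: An overpartition of $n$ is a nonincreasing sequence of positive integers whose sum is $n$, in which the first occurrence of each number may be overlined; $\overline{p}(n)$ denotes the number of overpartitions of $n$, with $\overline{p}(0)=1$ (for example $\overline{p}(3)=8$). *)

theory Defs
  imports Complex_Main
begin

text \<open>
  An overpartition is the list of its parts in nonincreasing order, each part paired with a flag
  telling whether it is overlined.  Only the first occurrence of a number may be overlined, so a
  part that repeats an earlier one must carry the flag \<open>False\<close>.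
\<close>

definition overpartitions :: "nat \<Rightarrow> (nat \<times> bool) list set" where
  "overpartitions n =
    {xs. (\<forall>x\<in>set xs. 0 < fst x)
       \<and> sorted_wrt (\<ge>) (map fst xs)
       \<and> sum_list (map fst xs) = n
       \<and> (\<forall>i j. i < j \<and> j < length xs \<and> fst (xs ! i) = fst (xs ! j) \<longrightarrow> \<not> snd (xs ! j))}"

lemma finite_overpartitions: "finite (overpartitions n)"
proof (rule finite_subset)
  have len: "length xs \<le> sum_list (map fst xs)" if "\<forall>x\<in>set xs. 0 < fst x"
    for xs :: "(nat \<times> bool) list"
    using that by (induction xs) auto
  have "fst x \<le> sum_list (map fst xs)" if "x \<in> set xs" for x and xs :: "(nat \<times> bool) list"
    using that by (intro member_le_sum_list) auto
  then show "overpartitions n \<subseteq> {xs. set xs \<subseteq> {..n} \<times> UNIV \<and> length xs \<le> n}"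
    unfolding overpartitions_def using len by fastforce
  show "finite {xs. set xs \<subseteq> {..n} \<times> (UNIV :: bool set) \<and> length xs \<le> n}"
    by (rule finite_lists_length_le) simp
qed

definition pbar :: "nat \<Rightarrow> nat" where
  "pbar n = card (overpartitions n)"

lemma pbar_0: "pbar 0 = 1"
proof -
  have "xs = []" if "\<forall>x\<in>set xs. 0 < fst x" "\<forall>x\<in>set xs. fst x = 0" for xs :: "(nat \<times> bool) list"
    using that by (cases xs) auto
  then have "overpartitions 0 = {[]}"
    by (auto simp: overpartitions_def)
  then show ?thesis
    by (simp add: pbar_def)
qed

end

theory Submission
  imports Defs "HOL-Probability.Probability" "HOL-Complex_Analysis.Complex_Analysis"
    "HOL-Real_Asymp.Real_Asymp"
begin

text \<open>
  The generating function of overpartitions is the reciprocal of the theta series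
  \<open>1 + 2 * (\<Sum>s\<ge>1. (-1) ^ s * q ^ s\<^sup>2)\<close> (Gauss), and theta inversion describes it near \<open>q = 1\<close> up to
  exponentially small terms.  Cauchy's formula on a circle of radius \<open>exp (- pi / (4 * sqrt n))\<close>
  then gives \<open>pbar n = exp (pi * sqrt n) / (8 * n) * (1 - 1 / (pi * sqrt n))\<close> with an error of at
  most \<open>exp (pi * sqrt n / 2)\<close>.

  In logarithmic form the theorem bounds the second difference of \<open>ln (pbar n) / n\<close> from above.
  The term \<open>pi / sqrt n\<close> of \<open>ln (pbar n) / n\<close> contributes the \<open>3 * pi / (4 * n powr (5 / 2))\<close> of
  the statement up to \<open>O(n powr (- 7 / 2))\<close>, and \<open>- ln (8 * n) / n\<close> leaves room of order
  \<open>2 * ln n / n ^ 3\<close>, which absorbs every error once \<open>n \<ge> 197\<close>.  Smaller \<open>n\<close> are checked by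
  computing \<open>pbar\<close> and enclosing the logarithms in fixed-point arithmetic.
\<close>

section \<open>The generating function\<close>

text \<open>With \<open>x = sqrt n\<close> and \<open>q = exp (- pi * \<tau>)\<close>, the exponent
  \<open>pi / (4 * \<tau>) + pi * n * \<tau>\<close> has its saddle at
  \<open>t = 1 / (2 * x)\<close>, yet the path is the line \<open>Re \<tau> = t / 2\<close>, whence
  the radius. This line meets the circle of radius \<open>t\<close> about 0 at angles of 60 degrees.
  Between the two meeting points it can be exchanged for the arc through the saddle, where the
  exponent is real, and no connecting pieces have to be estimated. At the meeting points the
  exponent has dropped from \<open>pi * x\<close> to \<open>pi * x / 2\<close>. The rest of the line
  stays within the same order: there \<open>exp (pi * n * \<tau>)\<close> has modulus
  \<open>exp (pi * x / 4)\<close>, and the generating function is at most a constant times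
  \<open>exp (pi * x / 4)\<close>. Such precision is far more than enough:
  \<open>ln (pbar n)\<close> is needed only up to a small multiple of \<open>1 / n^2\<close>,
  because division by \<open>n\<close> turns this into order \<open>1 / n^3\<close>. The analytic
  estimates start at \<open>n = 196 = 14^2\<close>; since \<open>n - 1\<close> enters the second
  difference, the large case starts at 197.\<close>

lemma Cons_in_overpartitions_iff:
  "x # xs \<in> overpartitions n \<longleftrightarrow>
     0 < fst x \<and> fst x \<le> n \<and> xs \<in> overpartitions (n - fst x) \<and>
     (\<forall>y\<in>set xs. fst y \<le> fst x \<and> (fst y = fst x \<longrightarrow> \<not> snd y))"
proof -
  have "(\<forall>i j. i < j \<and> j < length (x # xs) \<and> fst ((x # xs) ! i) = fst ((x # xs) ! j) \<longrightarrow> \<not> snd ((x # xs) ! j))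
     \<longleftrightarrow> (\<forall>i j. i < j \<and> j < length xs \<and> fst (xs ! i) = fst (xs ! j) \<longrightarrow> \<not> snd (xs ! j)) \<and>
         (\<forall>y\<in>set xs. fst y = fst x \<longrightarrow> \<not> snd y)" (is "?L \<longleftrightarrow> ?R")
  proof
    assume L: ?L
    show ?R
    proof (intro conjI allI impI ballI)
      fix i j assume "i < j \<and> j < length xs \<and> fst (xs ! i) = fst (xs ! j)"
      then show "\<not> snd (xs ! j)" using L[rule_format, of "Suc i" "Suc j"] by simp
    next
      fix y assume "y \<in> set xs" "fst y = fst x"
      then obtain j where "j < length xs" "y = xs ! j" by (metis in_set_conv_nth)
      then show "\<not> snd y" using L[rule_format, of 0 "Suc j"] \<open>fst y = fst x\<close> by simp
    qed
  next
    assume R: ?R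
    show ?L
    proof (intro allI impI)
      fix i j assume *: "i < j \<and> j < length (x # xs) \<and> fst ((x # xs) ! i) = fst ((x # xs) ! j)"
      then obtain j' where j: "j = Suc j'" by (cases j) auto
      show "\<not> snd ((x # xs) ! j)"
      proof (cases i)
        case 0
        then show ?thesis using R * j by (metis Suc_less_eq length_Cons nth_Cons_0 nth_Cons_Suc nth_mem)
      next
        case (Suc i')
        then show ?thesis using R * j by (metis Suc_less_eq length_Cons nth_Cons_Suc)
      qed
    qed
  qed
  then show ?thesis
    unfolding overpartitions_def by auto
qed

section \<open>Recursion on the bound for the parts\<close>

definition bounded_overpartitions :: "nat \<Rightarrow> nat \<Rightarrow> (nat \<times> bool) list set" where
  "bounded_overpartitions k n = {xs \<in> overpartitions n. \<forall>x\<in>set xs. fst x \<le> k}"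

text \<open>Removing a leading part \<open>k\<close> leaves a list in which \<open>k\<close> may
  still occur but no longer overlined. This auxiliary family closes the recursion.\<close>

definition bounded_overpartitions' :: "nat \<Rightarrow> nat \<Rightarrow> (nat \<times> bool) list set" where
  "bounded_overpartitions' k n = {xs \<in> bounded_overpartitions k n. (k, True) \<notin> set xs}"

lemma finite_bounded_overpartitions [simp]:
  "finite (bounded_overpartitions k n)" "finite (bounded_overpartitions' k n)"
  unfolding bounded_overpartitions_def bounded_overpartitions'_def
  using finite_overpartitions by auto

lemma bounded_overpartitions_Suc:
  "bounded_overpartitions (Suc k) n = bounded_overpartitions k n \<union>
     (if Suc k \<le> n then (\<lambda>(b, xs). (Suc k, b) # xs) ` (UNIV \<times> bounded_overpartitions' (Suc k) (n - Suc k)) else {})"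
  (is "?A = ?B")
proof (intro set_eqI iffI)
  fix xs assume xs: "xs \<in> ?A"
  show "xs \<in> ?B"
  proof (cases "\<forall>x\<in>set xs. fst x \<le> k")
    case True
    then show ?thesis using xs by (auto simp: bounded_overpartitions_def)
  next
    case False
    then obtain x ys where xs': "xs = x # ys" by (cases xs) auto
    have x: "fst x = Suc k"
    proof -
      have "fst x \<le> Suc k" using xs unfolding xs' bounded_overpartitions_def by auto
      moreover have "\<not> fst x \<le> k"
      proof
        assume "fst x \<le> k"
        moreover have "\<forall>y\<in>set ys. fst y \<le> fst x"
          using xs unfolding xs' bounded_overpartitions_def by (auto simp: Cons_in_overpartitions_iff)
        ultimately show False using False unfolding xs' by fastforce
      qed
      ultimately show ?thesis by simp
    qed
    have "ys \<in> bounded_overpartitions' (Suc k) (n - Suc k)" "Suc k \<le> n"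
      using xs x unfolding xs' bounded_overpartitions_def bounded_overpartitions'_def
      by (auto simp: Cons_in_overpartitions_iff)
    then show ?thesis using x unfolding xs' by (cases x) auto
  qed
next
  fix xs assume xs: "xs \<in> ?B"
  then show "xs \<in> ?A"
    by (auto simp: bounded_overpartitions_def bounded_overpartitions'_def Cons_in_overpartitions_iff
        split: if_splits)
qed

lemma bounded_overpartitions'_Suc:
  "bounded_overpartitions' (Suc k) n = bounded_overpartitions k n \<union>
     (if Suc k \<le> n then Cons (Suc k, False) ` bounded_overpartitions' (Suc k) (n - Suc k) else {})"
proof -
  have "bounded_overpartitions' (Suc k) n = {xs \<in> bounded_overpartitions (Suc k) n. (Suc k, True) \<notin> set xs}"
    by (simp add: bounded_overpartitions'_def)
  also have "\<dots> = bounded_overpartitions k n \<union>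
     (if Suc k \<le> n then Cons (Suc k, False) ` bounded_overpartitions' (Suc k) (n - Suc k) else {})"
    unfolding bounded_overpartitions_Suc
    by (auto simp: bounded_overpartitions'_def image_iff) (auto simp: bounded_overpartitions_def)
  finally show ?thesis .
qed

lemma card_bounded_overpartitions_Suc:
  "card (bounded_overpartitions (Suc k) n) = card (bounded_overpartitions k n) +
     (if Suc k \<le> n then 2 * card (bounded_overpartitions' (Suc k) (n - Suc k)) else 0)"
proof (cases "Suc k \<le> n")
  case True
  have "inj_on (\<lambda>(b, xs). (Suc k, b) # xs) (UNIV \<times> bounded_overpartitions' (Suc k) (n - Suc k))"
    by (auto simp: inj_on_def)
  moreover have "bounded_overpartitions k n \<inter>
      (\<lambda>(b, xs). (Suc k, b) # xs) ` (UNIV \<times> bounded_overpartitions' (Suc k) (n - Suc k)) = {}"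
    by (auto simp: bounded_overpartitions_def)
  ultimately show ?thesis
    using True unfolding bounded_overpartitions_Suc
    by (simp add: card_Un_disjoint card_image card_cartesian_product)
qed (simp add: bounded_overpartitions_Suc)

lemma card_bounded_overpartitions'_Suc:
  "card (bounded_overpartitions' (Suc k) n) = card (bounded_overpartitions k n) +
     (if Suc k \<le> n then card (bounded_overpartitions' (Suc k) (n - Suc k)) else 0)"
proof (cases "Suc k \<le> n")
  case True
  have "bounded_overpartitions k n \<inter> Cons (Suc k, False) ` bounded_overpartitions' (Suc k) (n - Suc k) = {}"
    by (auto simp: bounded_overpartitions_def)
  then show ?thesis
    using True by (subst bounded_overpartitions'_Suc) (simp add: card_Un_disjoint card_image)
qed (subst bounded_overpartitions'_Suc, simp)

lemma bounded_overpartitions_0: "bounded_overpartitions 0 n = (if n = 0 then {[]} else {})"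
proof -
  have "xs = []" if "xs \<in> bounded_overpartitions 0 n" for xs
    using that by (cases xs) (auto simp: bounded_overpartitions_def overpartitions_def)
  moreover have "[] \<in> bounded_overpartitions 0 n \<longleftrightarrow> n = 0"
    by (auto simp: bounded_overpartitions_def overpartitions_def)
  ultimately show ?thesis by (cases "n = 0") fastforce+
qed

lemma card_bounded_overpartitions_le: "card (bounded_overpartitions k n) \<le> pbar n"
  unfolding pbar_def bounded_overpartitions_def
  by (intro card_mono finite_overpartitions) auto

lemma card_bounded_overpartitions_eq:
  assumes "n \<le> k"
  shows "card (bounded_overpartitions k n) = pbar n"
proof -
  have "fst x \<le> n" if "xs \<in> overpartitions n" "x \<in> set xs" for x xs
    using that member_le_sum_list[of "fst x" "map fst xs"] by (auto simp: overpartitions_def)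
  then have "bounded_overpartitions k n = overpartitions n"
    using assms by (fastforce simp: bounded_overpartitions_def)
  then show ?thesis by (simp add: pbar_def)
qed

section \<open>Power series, convergence and the product formula\<close>

definition pbar_bounded_fps :: "nat \<Rightarrow> complex fps" where
  "pbar_bounded_fps k = Abs_fps (\<lambda>n. of_nat (card (bounded_overpartitions k n)))"

definition pbar_fps :: "complex fps" where
  "pbar_fps = Abs_fps (\<lambda>n. of_nat (pbar n))"

text \<open>With \<open>U\<close> the series of the restricted family and \<open>Y\<close> the new
  power of \<open>fps_X\<close>, the two counting recursions read \<open>C' = C + 2 * Y * U\<close>
  and \<open>U = C + Y * U\<close>. Eliminating \<open>U\<close> gives the Euler factor
  \<open>(1 + Y) / (1 - Y)\<close>.\<close>

lemma pbar_bounded_fps_Suc: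
  "pbar_bounded_fps (Suc k) * (1 - fps_X ^ Suc k) = pbar_bounded_fps k * (1 + fps_X ^ Suc k)"
proof -
  define U :: "complex fps" where "U = Abs_fps (\<lambda>n. of_nat (card (bounded_overpartitions' (Suc k) n)))"
  have 1: "pbar_bounded_fps (Suc k) = pbar_bounded_fps k + 2 * (fps_X ^ Suc k * U)"
    by (rule fps_ext)
       (auto simp: pbar_bounded_fps_def U_def card_bounded_overpartitions_Suc fps_X_power_mult_nth numeral_fps_const
           simp del: power_Suc)
  have 2: "U = pbar_bounded_fps k + fps_X ^ Suc k * U"
  proof (rule fps_ext)
    fix n
    show "fps_nth U n = fps_nth (pbar_bounded_fps k + fps_X ^ Suc k * U) n"
      using card_bounded_overpartitions'_Suc[of k n]
      by (auto simp: pbar_bounded_fps_def U_def fps_X_power_mult_nth simp del: power_Suc)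
  qed
  show ?thesis
  proof -
    define Y :: "complex fps" where "Y = fps_X ^ Suc k"
    have C: "pbar_bounded_fps k = U - Y * U" using 2 by (simp add: Y_def algebra_simps)
    show ?thesis unfolding 1 Y_def [symmetric] C by (simp add: algebra_simps)
  qed
qed

text \<open>The elimination of \<open>U\<close> is repeated for truncated real sums, since a bound
  uniform in \<open>N\<close> is wanted before any convergence is known.\<close>

lemma sum_bounded_overpartitions_le:
  fixes r :: real
  assumes r: "0 \<le> r" "r < 1"
  shows "(\<Sum>n\<le>N. card (bounded_overpartitions k n) * r ^ n) \<le> (\<Prod>j=1..k. (1 + r ^ j) / (1 - r ^ j))"
proof (induction k)
  case 0
  have "(\<Sum>n\<le>N. card (bounded_overpartitions 0 n) * r ^ n) = (\<Sum>n\<le>N. if n = 0 then 1 else 0)"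
    by (intro sum.cong) (auto simp: bounded_overpartitions_0)
  then show ?case by simp
next
  case (Suc k)
  define C where "C = (\<Sum>n\<le>N. card (bounded_overpartitions k n) * r ^ n)"
  define U where "U = (\<Sum>n\<le>N. card (bounded_overpartitions' (Suc k) n) * r ^ n)"
  define V where "V = (\<Sum>n\<le>N. (if Suc k \<le> n then card (bounded_overpartitions' (Suc k) (n - Suc k)) else 0) * r ^ n)"
  have "V = (\<Sum>n\<in>{Suc k..N}. card (bounded_overpartitions' (Suc k) (n - Suc k)) * r ^ n)"
    unfolding V_def by (intro sum.mono_neutral_cong_right) auto
  \<comment> \<open>Only an inequality survives here: the shift by \<open>Suc k\<close> pushes the
    top terms of the truncated sum beyond \<open>N\<close>.\<close>
  also have "\<dots> \<le> (\<Sum>n\<le>N. card (bounded_overpartitions' (Suc k) n) * r ^ (n + Suc k))"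
  proof -
    have "(\<Sum>n\<in>{Suc k..N}. card (bounded_overpartitions' (Suc k) (n - Suc k)) * r ^ n) =
          (\<Sum>n\<in>(\<lambda>n. n - Suc k) ` {Suc k..N}. card (bounded_overpartitions' (Suc k) n) * r ^ (n + Suc k))"
    proof (subst sum.reindex)
      show "inj_on (\<lambda>n. n - Suc k) {Suc k..N}" by (auto simp: inj_on_def)
      show "(\<Sum>n\<in>{Suc k..N}. card (bounded_overpartitions' (Suc k) (n - Suc k)) * r ^ n) =
        sum ((\<lambda>n. card (bounded_overpartitions' (Suc k) n) * r ^ (n + Suc k)) \<circ> (\<lambda>n. n - Suc k)) {Suc k..N}"
      proof (rule sum.cong)
        fix n assume "n \<in> {Suc k..N}"
        then have "n - Suc k + Suc k = n" by simp
        then show "card (bounded_overpartitions' (Suc k) (n - Suc k)) * r ^ n =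
           ((\<lambda>n. card (bounded_overpartitions' (Suc k) n) * r ^ (n + Suc k)) \<circ> (\<lambda>n. n - Suc k)) n"
          by (simp only: o_def)
      qed simp
    qed
    also have "\<dots> \<le> (\<Sum>n\<le>N. card (bounded_overpartitions' (Suc k) n) * r ^ (n + Suc k))"
      using r by (intro sum_mono2) auto
    finally show ?thesis .
  qed
  also have "\<dots> = r ^ Suc k * U"
    by (simp add: U_def sum_distrib_left power_add mult_ac)
  finally have V: "V \<le> r ^ Suc k * U" .
  have U: "U = C + V"
    unfolding U_def C_def V_def sum.distrib [symmetric] distrib_right [symmetric]
    by (subst card_bounded_overpartitions'_Suc) simp
  have C': "(\<Sum>n\<le>N. card (bounded_overpartitions (Suc k) n) * r ^ n) = C + 2 * V"
    unfolding C_def V_def card_bounded_overpartitions_Suc sum_distrib_left sum.distrib [symmetric]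
    by (intro sum.cong) (auto simp: algebra_simps)
  have rk: "r ^ Suc k < 1" using r power_Suc_less_one[of r k] by (cases "r = 0") auto
  have "V * (1 - r ^ Suc k) \<le> r ^ Suc k * C" using V U by (simp add: algebra_simps)
  then have "V \<le> r ^ Suc k * C / (1 - r ^ Suc k)" using rk by (simp add: pos_le_divide_eq)
  then have "C + 2 * V \<le> C + 2 * (r ^ Suc k * C / (1 - r ^ Suc k))" by simp
  also have "\<dots> = C * ((1 + r ^ Suc k) / (1 - r ^ Suc k))"
    using rk by (simp add: field_simps del: power_Suc)
  also have "\<dots> \<le> (\<Prod>j=1..k. (1 + r ^ j) / (1 - r ^ j)) * ((1 + r ^ Suc k) / (1 - r ^ Suc k))"
    using Suc rk r unfolding C_def by (intro mult_right_mono divide_nonneg_nonneg) auto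
  finally show ?case
    using C' by simp
qed

text \<open>Each factor is \<open>1 + 2 * r ^ j / (1 - r ^ j)\<close>, and the exponents
  \<open>2 * r ^ j / (1 - r)\<close> add up geometrically. The bound does not depend on
  \<open>k\<close>; it serves both for summability and for the products in Gauss's identity.\<close>

lemma prod_le_exp_geometric:
  fixes r :: real
  assumes r: "0 \<le> r" "r < 1"
  shows "(\<Prod>j=1..k. (1 + r ^ j) / (1 - r ^ j)) \<le> exp (2 * r / (1 - r)\<^sup>2)"
proof -
  have rj: "r ^ j \<le> r" if "j \<ge> 1" for j
    using power_decreasing[of 1 j r] that r by simp
  have "(\<Prod>j=1..k. (1 + r ^ j) / (1 - r ^ j)) \<le> (\<Prod>j=1..k. exp (2 * r ^ j / (1 - r)))"
  proof (intro prod_mono conjI)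
    fix j assume j: "j \<in> {1..k}"
    then have *: "r ^ j \<le> r" "0 \<le> r ^ j" using rj r by auto
    show "0 \<le> (1 + r ^ j) / (1 - r ^ j)" using * r by (intro divide_nonneg_nonneg) auto
    have "(1 + r ^ j) / (1 - r ^ j) = 1 + 2 * r ^ j / (1 - r ^ j)" using * r by (simp add: field_simps)
    also have "\<dots> \<le> 1 + 2 * r ^ j / (1 - r)"
      using * r by (intro add_left_mono divide_left_mono) auto
    also have "\<dots> \<le> exp (2 * r ^ j / (1 - r))" by (rule exp_ge_add_one_self)
    finally show "(1 + r ^ j) / (1 - r ^ j) \<le> exp (2 * r ^ j / (1 - r))" .
  qed
  also have "\<dots> = exp (2 / (1 - r) * (\<Sum>j=1..k. r ^ j))"
    by (subst exp_sum [symmetric]) (auto simp: sum_distrib_left intro!: sum.cong)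
  also have "\<dots> \<le> exp (2 / (1 - r) * (r / (1 - r)))"
  proof -
    have "(\<Sum>j=1..k. r ^ j) = r * (\<Sum>j<k. r ^ j)"
      by (simp add: sum_distrib_left sum.atLeast1_atMost_eq)
    also have "(\<Sum>j<k. r ^ j) \<le> (\<Sum>j. r ^ j)"
      using r by (intro sum_le_suminf summable_geometric) auto
    also have "\<dots> = 1 / (1 - r)" using r by (intro suminf_geometric) auto
    finally show ?thesis using r by (simp add: mult_left_mono divide_simps)
  qed
  also have "2 / (1 - r) * (r / (1 - r)) = 2 * r / (1 - r)\<^sup>2" by (simp add: power2_eq_square)
  finally show ?thesis .
qed

lemma summable_pbar:
  fixes r :: real
  assumes r: "0 \<le> r" "r < 1"
  shows "summable (\<lambda>n. pbar n * r ^ n)"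
proof (rule bounded_imp_summable)
  fix N
  \<comment> \<open>Diagonal choice \<open>k = N\<close>: no part of an overpartition of
    \<open>n \<le> N\<close> exceeds \<open>N\<close>.\<close>
  have "(\<Sum>n\<le>N. pbar n * r ^ n) = (\<Sum>n\<le>N. card (bounded_overpartitions N n) * r ^ n)"
    by (intro sum.cong) (auto simp: card_bounded_overpartitions_eq)
  also have "\<dots> \<le> exp (2 * r / (1 - r)\<^sup>2)"
    using sum_bounded_overpartitions_le[OF r] prod_le_exp_geometric[OF r] by (rule order_trans)
  finally show "(\<Sum>n\<le>N. pbar n * r ^ n) \<le> exp (2 * r / (1 - r)\<^sup>2)" .
qed (use r in auto)

lemma conv_radius_ge_oneI:
  fixes f :: "nat \<Rightarrow> complex"
  assumes "\<And>r. 0 < r \<Longrightarrow> r < 1 \<Longrightarrow> summable (\<lambda>n. norm (f n) * r ^ n)"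
  shows "conv_radius f \<ge> 1"
proof (rule conv_radius_geI_ex')
  fix r :: real assume "0 < r" "ereal r < 1"
  then have "summable (\<lambda>n. norm (f n * of_real r ^ n))"
    using assms[of r] by (simp add: norm_mult norm_power)
  then show "summable (\<lambda>n. f n * of_real r ^ n)" by (rule summable_norm_cancel)
qed

lemma fps_conv_radius_pbar: "fps_conv_radius pbar_fps \<ge> 1"
  unfolding fps_conv_radius_def pbar_fps_def
  by (rule conv_radius_ge_oneI) (use summable_pbar in \<open>auto simp: less_imp_le\<close>)

lemma fps_conv_radius_pbar_bounded: "fps_conv_radius (pbar_bounded_fps k) \<ge> 1"
  unfolding fps_conv_radius_def pbar_bounded_fps_def
proof (rule conv_radius_ge_oneI)
  fix r :: real assume r: "0 < r" "r < 1"
  show "summable (\<lambda>n. norm (fps_nth (Abs_fps (\<lambda>n. of_nat (card (bounded_overpartitions k n)) :: complex)) n) * r ^ n)"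
    by (rule summable_comparison_test'[OF summable_pbar[of r], of 0])
       (use r in \<open>auto intro!: mult_right_mono card_bounded_overpartitions_le simp: abs_mult\<close>)
qed

lemma norm_power_less_one:
  fixes q :: complex
  assumes "norm q < 1" "0 < j"
  shows "norm (q ^ j) < 1"
  using assms power_less_one_iff[of "norm q" j] by (simp add: norm_power)

lemma one_pm_power_nonzero:
  fixes q :: complex
  assumes "norm q < 1" "0 < j"
  shows "1 - q ^ j \<noteq> 0" "1 + q ^ j \<noteq> 0"
  using norm_power_less_one[OF assms] by (auto simp: add_eq_0_iff)

lemma eval_fps_pbar_bounded:
  assumes q: "norm q < 1"
  shows "eval_fps (pbar_bounded_fps k) q = (\<Prod>j=1..k. (1 + q ^ j) / (1 - q ^ j))"
proof -
  have q': "ereal (norm q) < fps_conv_radius (pbar_bounded_fps k)" for k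
    using q fps_conv_radius_pbar_bounded[of k] by (meson ereal_less(3) less_le_trans)
  show ?thesis
  proof (induction k)
    case 0
    have "pbar_bounded_fps 0 = 1"
      by (rule fps_ext) (simp add: pbar_bounded_fps_def bounded_overpartitions_0)
    then show ?case by simp
  next
    case (Suc k)
    have rad: "ereal (norm q) < fps_conv_radius (1 - fps_X ^ Suc k :: complex fps)"
         "ereal (norm q) < fps_conv_radius (1 + fps_X ^ Suc k :: complex fps)"
      by (auto intro!: less_le_trans[OF _ fps_conv_radius_diff] less_le_trans[OF _ fps_conv_radius_add]
          simp del: power_Suc)
    have "eval_fps (pbar_bounded_fps (Suc k) * (1 - fps_X ^ Suc k)) q =
          eval_fps (pbar_bounded_fps k * (1 + fps_X ^ Suc k)) q"
      by (simp only: pbar_bounded_fps_Suc)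
    then have "eval_fps (pbar_bounded_fps (Suc k)) q * (1 - q ^ Suc k) =
        eval_fps (pbar_bounded_fps k) q * (1 + q ^ Suc k)"
      using rad q'[of k] q'[of "Suc k"]
      by (simp add: eval_fps_mult eval_fps_diff eval_fps_add eval_fps_power del: power_Suc)
    then have "eval_fps (pbar_bounded_fps (Suc k)) q = eval_fps (pbar_bounded_fps k) q * ((1 + q ^ Suc k) / (1 - q ^ Suc k))"
      using one_pm_power_nonzero[OF q, of "Suc k"] by (simp add: field_simps del: power_Suc)
    then show ?case using Suc by (simp del: power_Suc)
  qed
qed

text \<open>Tannery's theorem: each coefficient is eventually constant in \<open>k\<close>, and
  \<open>pbar n * norm q ^ n\<close> is a summable majorant.\<close>

lemma pbar_product_tendsto:
  assumes q: "norm q < 1"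
  shows "(\<lambda>k. \<Prod>j=1..k. (1 + q ^ j) / (1 - q ^ j)) \<longlonglongrightarrow> eval_fps pbar_fps q"
proof -
  have "eventually (\<lambda>(n, k). norm (of_nat (card (bounded_overpartitions k n)) * q ^ n) \<le> pbar n * norm q ^ n)
          (at_top \<times>\<^sub>F sequentially)"
    by (rule always_eventually)
       (auto simp: norm_mult norm_power intro!: mult_right_mono card_bounded_overpartitions_le)
  moreover have "(\<lambda>k. of_nat (card (bounded_overpartitions k n)) * q ^ n) \<longlonglongrightarrow> of_nat (pbar n) * q ^ n" for n
  proof (rule tendsto_eventually)
    show "\<forall>\<^sub>F k in sequentially. of_nat (card (bounded_overpartitions k n)) * q ^ n = of_nat (pbar n) * q ^ n"
      using eventually_ge_at_top[of n] by eventually_elim (simp add: card_bounded_overpartitions_eq)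
  qed
  ultimately have "(\<lambda>k. \<Sum>n. of_nat (card (bounded_overpartitions k n)) * q ^ n) \<longlonglongrightarrow> (\<Sum>n. of_nat (pbar n) * q ^ n)"
    using tannerys_theorem[of "\<lambda>n k. of_nat (card (bounded_overpartitions k n)) * q ^ n"
        "\<lambda>n. of_nat (pbar n) * q ^ n" sequentially "\<lambda>n. pbar n * norm q ^ n"]
      summable_pbar[of "norm q"] q by auto
  then show ?thesis
    unfolding eval_fps_pbar_bounded[OF q, symmetric] eval_fps_def pbar_fps_def pbar_bounded_fps_def by simp
qed

section \<open>Gauss's theta identity\<close>

text \<open>These are the coefficients of Jacobi's theta_4; the factor 2 accounts for
  \<open>s\<close> and \<open>- s\<close>. The sign can be written \<open>(-1) ^ n\<close> because
  \<open>s\<close> and \<open>s^2\<close> have the same parity.\<close>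

definition theta_coeff :: "nat \<Rightarrow> complex" where
  "theta_coeff n = (if n = 0 then 1 else if \<exists>s. n = s\<^sup>2 then 2 * (-1) ^ n else 0)"

definition theta_fps :: "complex fps" where
  "theta_fps = Abs_fps theta_coeff"

lemma norm_theta_coeff_le: "norm (theta_coeff n) \<le> 2"
  by (auto simp: theta_coeff_def norm_mult norm_power)

lemma fps_conv_radius_theta: "fps_conv_radius theta_fps \<ge> 1"
  unfolding fps_conv_radius_def theta_fps_def
proof (rule conv_radius_ge_oneI)
  fix r :: real assume r: "0 < r" "r < 1"
  show "summable (\<lambda>n. norm (fps_nth (Abs_fps theta_coeff) n) * r ^ n)"
  proof (rule summable_comparison_test'[of "\<lambda>n. 2 * r ^ n" 0])
    show "summable (\<lambda>n. 2 * r ^ n)" using r by (intro summable_mult summable_geometric) auto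
  qed (use r in \<open>auto intro!: mult_right_mono norm_theta_coeff_le simp: abs_mult\<close>)
qed

lemma less_fps_conv_radius_oneI:
  assumes "norm q < 1" "fps_conv_radius f \<ge> 1"
  shows "ereal (norm q) < fps_conv_radius f"
  using assms by (meson ereal_less(3) less_le_trans)

lemma eval_theta_fps_sums:
  assumes "norm q < 1"
  shows "(\<lambda>s. (if s = 0 then 1 else 2 * (-1) ^ s * q ^ s\<^sup>2)) sums eval_fps theta_fps q"
proof -
  have "(\<lambda>n. theta_coeff n * q ^ n) sums eval_fps theta_fps q"
    using sums_eval_fps[OF less_fps_conv_radius_oneI[OF assms fps_conv_radius_theta]]
    by (simp add: theta_fps_def)
  then have "(\<lambda>s. theta_coeff (s\<^sup>2) * q ^ s\<^sup>2) sums eval_fps theta_fps q"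
    by (subst sums_mono_reindex[of "\<lambda>s. s\<^sup>2" "\<lambda>n. theta_coeff n * q ^ n"])
       (auto simp: strict_mono_def power_strict_mono theta_coeff_def image_iff dest: spec[of _ 0])
  moreover have "theta_coeff (s\<^sup>2) * q ^ s\<^sup>2 = (if s = 0 then 1 else 2 * (-1) ^ s * q ^ s\<^sup>2)" for s
    by (auto simp: theta_coeff_def minus_one_power_iff)
  ultimately show ?thesis by simp
qed

text \<open>
  The difference of the right-hand sides for \<open>n\<close> and \<open>n - 1\<close> telescopes, which makes this
  finite form of Gauss's identity provable by induction.
\<close>
lemma gauss_theta_finite:
  fixes q :: "'a :: field"
  assumes nz: "\<And>j. 1 + q ^ j \<noteq> 0" "\<And>j. 0 < j \<Longrightarrow> 1 - q ^ j \<noteq> 0"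
  shows "1 + 2 * (\<Sum>s=1..n. (-1) ^ s * q ^ s\<^sup>2) =
    (\<Sum>s\<le>n. 2 * (-1) ^ s * q ^ (s * Suc n) / (1 + q ^ s) * (\<Prod>j\<in>{s<..n}. (1 - q ^ j) / (1 + q ^ j)))"
proof (induction n)
  case 0
  then show ?case using nz(1)[of 0] by simp
next
  case (Suc n)
  define R where "R s m = (\<Prod>j\<in>{s<..m}. (1 - q ^ j) / (1 + q ^ j))" for s m
  define T where "T m s = 2 * (-1) ^ s * q ^ (s * Suc m) / (1 + q ^ s) * R s m" for m s
  \<comment> \<open>The telescoping certificate:
    \<open>T (Suc n) s - T n s = v (Suc s) - v s\<close>. The value 0 at \<open>s = 0\<close> agrees
    with the general form, which contains the factor \<open>1 - q ^ s\<close>.\<close>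
  define v where "v s = (if s = 0 then 0 else 2 * (-1) ^ s * R (s - 1) n * q ^ (s * Suc n) / (1 + q ^ Suc n))" for s
  have R1: "R s (Suc m) = R s m * ((1 - q ^ Suc m) / (1 + q ^ Suc m))" if "s \<le> m" for s m
  proof -
    have "{s<..Suc m} = insert (Suc m) {s<..m}" using that by auto
    then show ?thesis by (simp add: R_def)
  qed
  have R2: "R (s - 1) m = ((1 - q ^ s) / (1 + q ^ s)) * R s m" if "0 < s" "s \<le> m" for s m
  proof -
    have "{s - 1<..m} = insert s {s<..m}" using that by auto
    then show ?thesis by (simp add: R_def)
  qed
  have step: "T (Suc n) s - T n s = v (Suc s) - v s" if s: "s \<le> n" for s
  proof -
    define a b A where "a = q ^ s" and "b = q ^ Suc n" and "A = 2 * (-1) ^ s * q ^ (s * Suc n) * R s n"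
    have nz': "1 + a \<noteq> 0" "1 + b \<noteq> 0" using nz(1)[of s] nz(1)[of "Suc n"] by (auto simp: a_def b_def)
    have "T (Suc n) s = A * a / (1 + a) * ((1 - b) / (1 + b))"
      by (simp add: T_def R1[OF s] A_def a_def b_def power_add field_simps)
    moreover have "T n s = A / (1 + a)" by (simp add: T_def A_def a_def)
    moreover have "v (Suc s) = - A * b / (1 + b)"
      by (simp add: v_def A_def b_def power_add mult_ac)
    moreover have "v s = A * ((1 - a) / (1 + a)) / (1 + b)"
      using s R2[of s n] by (cases "s = 0") (auto simp: v_def A_def b_def a_def mult_ac)
    ultimately show ?thesis using nz' by (simp add: divide_simps) algebra
  qed
  have "(\<Sum>s\<le>Suc n. T (Suc n) s) - (\<Sum>s\<le>n. T n s) = (\<Sum>s\<le>n. T (Suc n) s - T n s) + T (Suc n) (Suc n)"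
    by (simp add: sum_subtractf)
  also have "(\<Sum>s\<le>n. T (Suc n) s - T n s) = (\<Sum>s<Suc n. v (Suc s) - v s)"
    by (intro sum.cong) (auto simp: step)
  also have "\<dots> = v (Suc n)" by (subst sum_lessThan_telescope) (simp add: v_def)
  also have "v (Suc n) = 2 * (-1) ^ Suc n * q ^ (Suc n)\<^sup>2 / (1 + q ^ Suc n)"
    by (simp add: v_def R_def power2_eq_square)
  also have "T (Suc n) (Suc n) = 2 * (-1) ^ Suc n * (q ^ (Suc n)\<^sup>2 * q ^ Suc n) / (1 + q ^ Suc n)"
    by (simp add: T_def R_def power2_eq_square power_add mult_ac)
  \<comment> \<open>The telescoped boundary term and the new summand \<open>s = Suc n\<close>
    combine, as \<open>A / (1 + b) + A * b / (1 + b) = A\<close>, to the new term of the theta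
    sum.\<close>
  also have "2 * (-1) ^ Suc n * q ^ (Suc n)\<^sup>2 / (1 + q ^ Suc n) + \<dots> = 2 * (-1) ^ Suc n * q ^ (Suc n)\<^sup>2"
  proof -
    have "A / (1 + b) + A * b / (1 + b) = A" if "1 + b \<noteq> 0" for A b :: 'a
      using that by (simp add: add_divide_distrib [symmetric] distrib_left [of A 1 b, simplified, symmetric])
    from this[OF nz(1)[of "Suc n"], of "2 * (-1) ^ Suc n * q ^ (Suc n)\<^sup>2"] show ?thesis by (simp only: mult.assoc)
  qed
  finally show ?case
    using Suc by (simp add: T_def R_def algebra_simps)
qed

text \<open>The triangle inequality replaces each factor by the reciprocal type
  \<open>(1 + r ^ j) / (1 - r ^ j) \<ge> 1\<close>, so the product may be extended down to
  \<open>j = 1\<close>.\<close>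

lemma norm_prod_ratio_le:
  fixes q :: complex
  assumes q: "norm q < 1"
  shows "norm (\<Prod>j\<in>{s<..n}. (1 - q ^ j) / (1 + q ^ j)) \<le> exp (2 * norm q / (1 - norm q)\<^sup>2)"
proof -
  define r where "r = norm q"
  have r: "0 \<le> r" "r < 1" using q by (auto simp: r_def)
  have rj: "r ^ j < 1" if "j > 0" for j using norm_power_less_one[OF q that] by (simp add: r_def norm_power)
  have ge1: "1 \<le> (1 + r ^ j) / (1 - r ^ j)" if "j > 0" for j using rj[OF that] r by (simp add: divide_simps)
  have "norm (\<Prod>j\<in>{s<..n}. (1 - q ^ j) / (1 + q ^ j)) = (\<Prod>j\<in>{s<..n}. norm (1 - q ^ j) / norm (1 + q ^ j))"
    by (simp add: prod_norm norm_divide flip: prod_norm)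
  also have "\<dots> \<le> (\<Prod>j\<in>{s<..n}. (1 + r ^ j) / (1 - r ^ j))"
  proof (intro prod_mono conjI frac_le)
    fix j assume j: "j \<in> {s<..n}"
    then have j: "j > 0" by auto
    show "norm (1 - q ^ j) \<le> 1 + r ^ j" using norm_triangle_ineq4[of 1 "q ^ j"] by (simp add: r_def norm_power)
    show "1 - r ^ j \<le> norm (1 + q ^ j)" using norm_diff_ineq[of 1 "q ^ j"] by (simp add: r_def norm_power)
    show "0 < 1 - r ^ j" using rj[OF j] by simp
  qed (use r in auto)
  also have "\<dots> \<le> (\<Prod>j=1..n. (1 + r ^ j) / (1 - r ^ j))"
    by (rule prod_mono2) (use ge1 in \<open>auto intro: order_trans[of 0 1]\<close>)
  also have "\<dots> \<le> exp (2 * r / (1 - r)\<^sup>2)" using r by (rule prod_le_exp_geometric)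
  finally show ?thesis by (simp add: r_def)
qed

text \<open>In the finite identity the summand \<open>s = 0\<close> is exactly the product, because
  \<open>2 / (1 + q ^ 0) = 1\<close>. Each of the other \<open>n\<close> summands carries a power of
  \<open>q\<close> of exponent at least \<open>n\<close>, so together they vanish in the
  limit.\<close>

lemma eval_theta_eq_prod_limit:
  assumes q: "norm q < 1"
  shows "(\<lambda>n. \<Prod>j=1..n. (1 - q ^ j) / (1 + q ^ j)) \<longlonglongrightarrow> eval_fps theta_fps q"
proof -
  define B where "B = exp (2 * norm q / (1 - norm q)\<^sup>2)"
  define R where "R s n = (\<Prod>j\<in>{s<..n}. (1 - q ^ j) / (1 + q ^ j))" for s n :: nat
  define Th where "Th n = (\<Sum>s\<le>n. if s = 0 then 1 else 2 * (-1) ^ s * q ^ s\<^sup>2)" for n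
  have Th: "Th \<longlonglongrightarrow> eval_fps theta_fps q"
    using eval_theta_fps_sums[OF q] by (simp add: Th_def[abs_def] sums_def_le)
  have diff: "norm (Th n - R 0 n) \<le> real n * norm q ^ n * (2 * B / (1 - norm q))" for n
  proof -
    have ins: "{..n} = insert 0 {1..n}" by auto
    have "Th n = 1 + 2 * (\<Sum>s=1..n. (-1) ^ s * q ^ s\<^sup>2)"
      unfolding Th_def ins by (auto simp: sum_distrib_left intro!: sum.cong)
    also have "\<dots> = (\<Sum>s\<le>n. 2 * (-1) ^ s * q ^ (s * Suc n) / (1 + q ^ s) * R s n)"
      unfolding R_def
    proof (rule gauss_theta_finite)
      show "1 + q ^ j \<noteq> 0" for j using one_pm_power_nonzero[OF q, of j] by (cases "j = 0") auto
      show "1 - q ^ j \<noteq> 0" if "0 < j" for j using one_pm_power_nonzero[OF q that] by auto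
    qed
    also have "\<dots> = R 0 n + (\<Sum>s=1..n. 2 * (-1) ^ s * q ^ (s * Suc n) / (1 + q ^ s) * R s n)"
      unfolding ins by simp
    finally have "norm (Th n - R 0 n) \<le> (\<Sum>s=1..n. norm (2 * (-1) ^ s * q ^ (s * Suc n) / (1 + q ^ s) * R s n))"
      by (simp add: sum_norm_le)
    also have "\<dots> \<le> (\<Sum>s=1..n. norm q ^ n * (2 * B / (1 - norm q)))"
    proof (rule sum_mono)
      fix s assume s: "s \<in> {1..n}"
      have "norm q ^ s \<le> norm q" using power_decreasing[of 1 s "norm q"] s q by simp
      then have 1: "1 - norm q \<le> norm (1 + q ^ s)"
        using norm_diff_ineq[of 1 "q ^ s"] by (simp add: norm_power)
      have 2: "norm (R s n) \<le> B" unfolding R_def B_def by (rule norm_prod_ratio_le[OF q])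
      have 3: "norm q ^ (s * Suc n) \<le> norm q ^ n"
      proof (rule power_decreasing)
        show "n \<le> s * Suc n" using s by (cases s) auto
      qed (use q in auto)
      have "norm (2 * (-1) ^ s * q ^ (s * Suc n) / (1 + q ^ s) * R s n) =
            2 * norm q ^ (s * Suc n) / norm (1 + q ^ s) * norm (R s n)"
        by (simp only: norm_mult norm_divide norm_power norm_minus_cancel norm_one norm_numeral power_one mult_1_right)
      also have "\<dots> \<le> 2 * norm q ^ n / (1 - norm q) * B"
        using 1 2 3 q by (intro mult_mono frac_le) auto
      finally show "norm (2 * (-1) ^ s * q ^ (s * Suc n) / (1 + q ^ s) * R s n) \<le> norm q ^ n * (2 * B / (1 - norm q))"
        by (simp add: mult_ac)
    qed
    finally show ?thesis by simp
  qed
  have "(\<lambda>n. real n * norm q ^ n * (2 * B / (1 - norm q))) \<longlonglongrightarrow> 0"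
    using powser_times_n_limit_0[of "norm q"] q by (intro tendsto_mult_left_zero) auto
  then have "(\<lambda>n. Th n - R 0 n) \<longlonglongrightarrow> 0"
    by (rule Lim_null_comparison[rotated]) (use diff in auto)
  from tendsto_diff[OF Th this] have "R 0 \<longlonglongrightarrow> eval_fps theta_fps q" by simp
  moreover have "R 0 = (\<lambda>n. \<Prod>j=1..n. (1 - q ^ j) / (1 + q ^ j))"
    by (auto simp: R_def intro!: ext prod.cong)
  ultimately show ?thesis by simp
qed

theorem eval_pbar_mult_theta:
  assumes q: "norm q < 1"
  shows "eval_fps pbar_fps q * eval_fps theta_fps q = 1"
proof -
  have "(\<lambda>n. (\<Prod>j=1..n. (1 + q ^ j) / (1 - q ^ j)) * (\<Prod>j=1..n. (1 - q ^ j) / (1 + q ^ j)))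
          \<longlonglongrightarrow> eval_fps pbar_fps q * eval_fps theta_fps q"
    by (intro tendsto_mult pbar_product_tendsto eval_theta_eq_prod_limit q)
  moreover have "(\<Prod>j=1..n. (1 + q ^ j) / (1 - q ^ j)) * (\<Prod>j=1..n. (1 - q ^ j) / (1 + q ^ j)) = 1" for n
    unfolding prod.distrib [symmetric] using one_pm_power_nonzero[OF q]
    by (intro prod.neutral) auto
  ultimately show ?thesis by (simp add: LIMSEQ_const_iff)
qed

text \<open>The analytic identity is brought back to coefficients; it yields the recurrence by which
  \<open>pbar\<close> is computed for small arguments.\<close>

lemma pbar_fps_mult_theta: "pbar_fps * theta_fps = 1"
proof (rule eval_fps_eqD)
  have rad: "fps_conv_radius (pbar_fps * theta_fps) \<ge> 1"
    using fps_conv_radius_mult[of pbar_fps theta_fps] fps_conv_radius_pbar fps_conv_radius_theta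
    by (meson min.boundedI order_trans)
  then show "0 < fps_conv_radius (pbar_fps * theta_fps)" using less_le_trans[OF _ rad, of 0] by simp
  show "0 < fps_conv_radius (1 :: complex fps)" by simp
  have "eventually (\<lambda>q. q \<in> ball 0 1) (nhds (0 :: complex))" by (intro eventually_nhds_in_open) auto
  then show "\<forall>\<^sub>F q in nhds 0. eval_fps (pbar_fps * theta_fps) q = eval_fps 1 q"
  proof eventually_elim
    case (elim q)
    then have q: "norm q < 1" by simp
    then show ?case
      using eval_pbar_mult_theta[OF q] fps_conv_radius_pbar fps_conv_radius_theta
      by (simp add: eval_fps_mult less_fps_conv_radius_oneI)
  qed
qed

section \<open>Theta inversion\<close>

lemma jordan_sin_ge:
  fixes x :: real
  assumes "0 \<le> x" "x \<le> pi / 2"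
  shows "2 * x / pi \<le> sin x"
proof -
  have "convex_on {0..pi} (\<lambda>x. - sin x)"
  proof (rule f''_ge0_imp_convex)
    show "((\<lambda>x. - sin x) has_real_derivative - cos x) (at x)" for x :: real
      by (auto intro!: derivative_eq_intros)
    show "((\<lambda>x. - cos x) has_real_derivative sin x) (at x)" for x :: real
      by (auto intro!: derivative_eq_intros)
  qed (auto intro: sin_ge_zero)
  then have "- sin ((1 - 2 * x / pi) *\<^sub>R 0 + (2 * x / pi) *\<^sub>R (pi / 2)) \<le>
      (1 - 2 * x / pi) * (- sin 0) + (2 * x / pi) * (- sin (pi / 2))"
    using assms by (intro convex_onD[of "{0..pi}" "\<lambda>x. - sin x"]) (auto simp: field_simps)
  then show ?thesis by simp
qed

text \<open>Jordan's inequality at the half angle. The Gaussian bound provides the majorant when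
  powers of cosines pass to the limit.\<close>

lemma cos_le_exp:
  fixes w :: real
  assumes "0 \<le> w" "w \<le> pi / 2"
  shows "cos w \<le> exp (- 2 * (w / pi)\<^sup>2)"
proof -
  have "w / pi \<le> sin (w / 2)" using jordan_sin_ge[of "w / 2"] assms by simp
  then have "(w / pi)\<^sup>2 \<le> (sin (w / 2))\<^sup>2" using assms by (intro power_mono) auto
  moreover have "cos w = 1 - 2 * (sin (w / 2))\<^sup>2"
    using cos_double_sin[of "w / 2"] by simp
  ultimately have "cos w \<le> 1 + (- 2 * (w / pi)\<^sup>2)" by simp
  also have "\<dots> \<le> exp (- 2 * (w / pi)\<^sup>2)" by (rule exp_ge_add_one_self)
  finally show ?thesis .
qed

lemma cos_power_even_expansion:
  "(2 * cos w) ^ (2 * m) =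
     real (2 * m choose m) + 2 * (\<Sum>d=1..m. real (2 * m choose (m + d)) * cos (2 * real d * w))"
proof -
  define g where "g j = real (2 * m choose j) * cos ((2 * real j - 2 * real m) * w)" for j
  have "of_real ((2 * cos w) ^ (2 * m)) = (cis w + cis (- w)) ^ (2 * m)"
    by (simp add: complex_eq_iff cis.ctr flip: of_real_power)
  also have "\<dots> = (\<Sum>j\<le>2 * m. of_nat (2 * m choose j) * cis w ^ j * cis (- w) ^ (2 * m - j))"
    by (rule binomial_ring)
  also have "\<dots> = (\<Sum>j\<le>2 * m. of_nat (2 * m choose j) * cis ((2 * real j - 2 * real m) * w))"
  proof (rule sum.cong)
    fix j assume "j \<in> {..2 * m}"
    then have "real j * w + real (2 * m - j) * (- w) = (2 * real j - 2 * real m) * w"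
      by (simp add: of_nat_diff algebra_simps)
    then have "cis w ^ j * cis (- w) ^ (2 * m - j) = cis ((2 * real j - 2 * real m) * w)"
      unfolding Complex.DeMoivre cis_mult by (simp only:)
    then show "of_nat (2 * m choose j) * cis w ^ j * cis (- w) ^ (2 * m - j) =
      of_nat (2 * m choose j) * cis ((2 * real j - 2 * real m) * w)" by (simp add: mult.assoc)
  qed simp
  finally have "Re (of_real ((2 * cos w) ^ (2 * m))) = (\<Sum>j\<le>2 * m. g j)"
    by (simp add: g_def)
  then have "(2 * cos w) ^ (2 * m) = (\<Sum>j\<le>2 * m. g j)" by (simp only: Re_complex_of_real)
  also have "{..2 * m} = (\<lambda>d. m - d) ` {1..m} \<union> {m} \<union> (\<lambda>d. m + d) ` {1..m}"
  proof (intro set_eqI iffI)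
    fix j assume "j \<in> {..2 * m}"
    then consider "j < m" | "j = m" | "m < j" "j \<le> 2 * m" by fastforce
    then show "j \<in> (\<lambda>d. m - d) ` {1..m} \<union> {m} \<union> (\<lambda>d. m + d) ` {1..m}"
    proof cases
      case 1 then show ?thesis by (auto intro!: image_eqI[of _ _ "m - j"])
    next
      case 3 then show ?thesis by (auto intro!: image_eqI[of _ _ "j - m"])
    qed auto
  qed auto
  also have "(\<Sum>j\<in>\<dots>. g j) = (\<Sum>j\<in>(\<lambda>d. m - d) ` {1..m}. g j) + g m + (\<Sum>j\<in>(\<lambda>d. m + d) ` {1..m}. g j)"
    by (subst sum.union_disjoint; (subst sum.union_disjoint)?) auto
  also have "(\<Sum>j\<in>(\<lambda>d. m - d) ` {1..m}. g j) = (\<Sum>d=1..m. real (2 * m choose (m + d)) * cos (2 * real d * w))"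
  proof (subst sum.reindex)
    show "inj_on ((-) m) {1..m}" by (auto simp: inj_on_def)
    show "sum (g \<circ> (-) m) {1..m} = (\<Sum>d=1..m. real (2 * m choose (m + d)) * cos (2 * real d * w))"
    proof (rule sum.cong)
      fix d assume d: "d \<in> {1..m}"
      have "2 * m choose (m - d) = 2 * m choose (m + d)"
        using d binomial_symmetric[of "m + d" "2 * m"] by (simp add: mult_2)
      moreover have "cos ((2 * real (m - d) - 2 * real m) * w) = cos (2 * real d * w)"
      proof -
        have "(2 * real (m - d) - 2 * real m) * w = - (2 * real d * w)" using d by (simp add: of_nat_diff algebra_simps)
        then show ?thesis by (simp only: cos_minus)
      qed
      ultimately show "(g \<circ> (-) m) d = real (2 * m choose (m + d)) * cos (2 * real d * w)" by (simp add: g_def)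
    qed simp
  qed
  also have "(\<Sum>j\<in>(\<lambda>d. m + d) ` {1..m}. g j) = (\<Sum>d=1..m. real (2 * m choose (m + d)) * cos (2 * real d * w))"
    by (subst sum.reindex) (auto simp: inj_on_def g_def)
  finally show ?thesis by (simp add: g_def)
qed

text \<open>Sampling at odd multiples of \<open>pi / (2 * l)\<close> is what produces the
  alternating sign of theta_4 at the surviving frequencies.\<close>

lemma sum_cos_odd_multiples:
  fixes l d :: nat
  assumes "l > 0"
  shows "(\<Sum>k<l. cos (2 * real d * (pi * (2 * real k + 1) / (2 * real l)))) = (if l dvd d then real l * (-1) ^ (d div l) else 0)"
proof (cases "l dvd d")
  case True
  then obtain v where d: "d = l * v" by auto
  have "cos (2 * real d * (pi * (2 * real k + 1) / (2 * real l))) = (-1) ^ v" for k :: nat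
  proof -
    have "2 * real d * (pi * (2 * real k + 1) / (2 * real l)) = pi * real (v * (2 * k + 1))"
      using assms by (simp add: d field_simps)
    also have "cos \<dots> = (-1) ^ (v * (2 * k + 1))" by (simp only: cos_npi2)
    also have "\<dots> = (-1) ^ v" by (simp add: power_mult power_add minus_one_power_iff)
    finally show ?thesis .
  qed
  then show ?thesis using True assms by (simp add: d)
next
  case False
  \<comment> \<open>The step between consecutive angles is \<open>2 * \<alpha>\<close>, so
    multiplication by \<open>2 * sin \<alpha>\<close> makes the sum telescope;
    \<open>sin \<alpha>\<close> vanishes only if \<open>l\<close> divides \<open>d\<close>.\<close>
  define \<alpha> where "\<alpha> = pi * d / l"
  have "sin \<alpha> \<noteq> 0"
  proof
    assume "sin \<alpha> = 0"
    then obtain i :: int where "\<alpha> = of_int i * pi" by (auto simp: sin_zero_iff_int2)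
    then have "real d = of_int i * real l" using assms by (simp add: \<alpha>_def field_simps)
    then have "int d = i * int l" by (metis of_int_eq_iff of_int_mult of_int_of_nat_eq)
    then have "int l dvd int d" by simp
    then show False using False by simp
  qed
  have "2 * sin \<alpha> * (\<Sum>k<l. cos (2 * real d * (pi * (2 * real k + 1) / (2 * real l)))) =
        (\<Sum>k<l. sin (2 * real (Suc k) * \<alpha>) - sin (2 * real k * \<alpha>))"
    unfolding sum_distrib_left
  proof (rule sum.cong)
    fix k
    have e: "2 * real d * (pi * (2 * real k + 1) / (2 * real l)) = (2 * real k + 1) * \<alpha>"
      using assms by (simp add: \<alpha>_def field_simps)
    have "2 * real (Suc k) * \<alpha> = (2 * real k + 1) * \<alpha> + \<alpha>" "2 * real k * \<alpha> = (2 * real k + 1) * \<alpha> - \<alpha>"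
      by (simp_all add: algebra_simps)
    then show "2 * sin \<alpha> * cos (2 * real d * (pi * (2 * real k + 1) / (2 * real l))) = sin (2 * real (Suc k) * \<alpha>) - sin (2 * real k * \<alpha>)"
      unfolding e by (simp only: sin_add sin_diff) simp
  qed simp
  also have "\<dots> = sin (2 * real l * \<alpha>) - sin (2 * real 0 * \<alpha>)" by (rule sum_lessThan_telescope)
  also have "2 * real l * \<alpha> = 2 * pi * real d" using assms by (simp add: \<alpha>_def)
  also have "sin (2 * pi * real d) - sin (2 * real 0 * \<alpha>) = 0"
    by (simp only: sin_2npi mult_zero_left of_nat_0 mult_zero_right sin_zero diff_self)
       (metis mult.commute mult.left_commute sin_npi sin_npi2 of_nat_mult of_nat_numeral diff_zero)
  finally show ?thesis using \<open>sin \<alpha> \<noteq> 0\<close> False by simp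
qed

definition binomial_ratio :: "nat \<Rightarrow> nat \<Rightarrow> real" where
  "binomial_ratio m r = real (2 * m choose (m + r)) / real (2 * m choose m)"

text \<open>
  The even powers of \<open>2 * cos\<close>, expanded into multiple angles and summed over equally spaced
  angles, keep only the binomial coefficients at multiples of \<open>2 * p\<close>.  This is Polya's finite
  form of theta inversion: with \<open>m\<close> close to \<open>4 * p\<^sup>2 / (pi * t)\<close> and \<open>p\<close> tending to infinity, both
  sides become theta series.
\<close>
lemma polya_theta_identity:
  assumes p: "p > 0"
  shows "(\<Sum>k<p. cos (pi * (2 * real k + 1) / (4 * real p)) ^ (2 * m)) =
     real p * (real (2 * m choose m) / 4 ^ m) * (1 + 2 * (\<Sum>v=1..m. (-1) ^ v * binomial_ratio m (2 * p * v)))"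
proof -
  \<comment> \<open>The orthogonality relation needs all \<open>2 * p\<close> angles between 0 and
    \<open>pi\<close>. They are symmetric about \<open>pi / 2\<close>, so the sum over the first
    \<open>p\<close> of them is recovered at the end by folding.\<close>
  define l where "l = 2 * p"
  define w where "w k = pi * (2 * real k + 1) / (2 * real l)" for k
  define C where "C = real (2 * m choose m)"
  have C: "C > 0" by (simp add: C_def)
  have l: "l > 0" using p by (simp add: l_def)
  have "(\<Sum>k<l. (2 * cos (w k)) ^ (2 * m)) = l * C + 2 * (\<Sum>d=1..m. real (2 * m choose (m + d)) * (\<Sum>k<l. cos (2 * real d * w k)))"
    unfolding cos_power_even_expansion C_def
    by (simp add: sum.distrib sum_distrib_left, subst sum.swap, simp add: mult_ac)
  also have "(\<Sum>d=1..m. real (2 * m choose (m + d)) * (\<Sum>k<l. cos (2 * real d * w k))) =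
      (\<Sum>d=1..m. real (2 * m choose (m + d)) * (if l dvd d then real l * (-1) ^ (d div l) else 0))"
    unfolding w_def using sum_cos_odd_multiples[OF l] by simp
  also have "\<dots> = (\<Sum>d\<in>(\<lambda>v. l * v) ` {1..m}. real (2 * m choose (m + d)) * (if l dvd d then real l * (-1) ^ (d div l) else 0))"
  proof (rule sum.mono_neutral_cong)
    fix d assume d: "d \<in> {1..m} - (*) l ` {1..m}"
    have "\<not> l dvd d"
    proof
      assume "l dvd d"
      then obtain v where v: "d = l * v" by auto
      have vl: "v \<le> l * v" using l by simp
      have lm: "l * v \<le> m" and "v \<noteq> 0" using d v by auto
      then have "v \<in> {1..m}" using order_trans[OF vl lm] by simp
      then show False using d v by auto
    qed
    then show "real (2 * m choose (m + d)) * (if l dvd d then real l * (-1) ^ (d div l) else 0) = 0" by simp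
  next
    fix d assume d: "d \<in> (*) l ` {1..m} - {1..m}"
    then have "d > m" using l by (auto simp: not_le)
    then show "real (2 * m choose (m + d)) * (if l dvd d then real l * (-1) ^ (d div l) else 0) = 0"
      by (simp add: binomial_eq_0)
  qed auto
  also have "\<dots> = (\<Sum>v=1..m. real (2 * m choose (m + l * v)) * (l * (-1) ^ v))"
    using l by (subst sum.reindex) (auto simp: inj_on_def)
  also have "\<dots> = l * C * (\<Sum>v=1..m. (-1) ^ v * binomial_ratio m (l * v))"
    unfolding binomial_ratio_def sum_distrib_left using C by (intro sum.cong) (auto simp: C_def)
  finally have 1: "(\<Sum>k<l. (2 * cos (w k)) ^ (2 * m)) =
      l * C * (1 + 2 * (\<Sum>v=1..m. (-1) ^ v * binomial_ratio m (l * v)))"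
    by (simp add: algebra_simps)
  have "(\<Sum>k<l. (2 * cos (w k)) ^ (2 * m)) = (\<Sum>k<p. (2 * cos (w k)) ^ (2 * m)) + (\<Sum>k\<in>{p..<l}. (2 * cos (w k)) ^ (2 * m))"
  proof -
    have "{..<l} = {..<p} \<union> {p..<l}" by (auto simp: l_def)
    then show ?thesis by (simp add: sum.union_disjoint ivl_disj_int)
  qed
  also have "(\<Sum>k\<in>{p..<l}. (2 * cos (w k)) ^ (2 * m)) = (\<Sum>k<p. (2 * cos (w k)) ^ (2 * m))"
  proof (rule sum.reindex_bij_witness[of _ "\<lambda>k. l - 1 - k" "\<lambda>k. l - 1 - k"])
    fix k assume k: "k \<in> {p..<l}"
    then have "w (l - 1 - k) = pi - w k" using p by (simp add: w_def l_def of_nat_diff field_simps)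
    then show "(2 * cos (w (l - 1 - k))) ^ (2 * m) = (2 * cos (w k)) ^ (2 * m)"
      by (simp add: power_mult)
  qed (auto simp: l_def)
  finally have "2 * (4 ^ m * (\<Sum>k<p. cos (w k) ^ (2 * m))) =
      l * C * (1 + 2 * (\<Sum>v=1..m. (-1) ^ v * binomial_ratio m (l * v)))"
    unfolding 1 by (simp add: power_mult_distrib power_mult sum_distrib_left)
  then show ?thesis
    by (simp add: l_def w_def C_def field_simps)
qed

section \<open>Gaussian bounds for binomial coefficients\<close>

lemma binomial_ratio_Suc: "binomial_ratio m (Suc r) = binomial_ratio m r * ((real m - real r) / (real m + real r + 1))"
proof (cases "r \<le> m")
  case True
  have "(m + r + 1) * (2 * m choose (m + Suc r)) = (m - r) * (2 * m choose (m + r))"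
  proof (cases "m = 0")
    case False
    then obtain k where k: "2 * m = Suc k" by (cases m) auto
    have "Suc (m + r) * (Suc k choose Suc (m + r)) = Suc k * (k choose (m + r))" by (rule Suc_times_binomial)
    moreover have "(2 * m - (m + r)) * (2 * m choose (m + r)) = 2 * m * ((2 * m - 1) choose (m + r))"
      by (rule binomial_absorb_comp)
    moreover have "2 * m - (m + r) = m - r" "m + r + 1 = Suc (m + r)" "m + Suc r = Suc (m + r)" "2 * m - 1 = k"
      using k by auto
    ultimately show ?thesis unfolding k by (simp only:)
  qed (use True in auto)
  then have "real ((m + r + 1) * (2 * m choose (m + Suc r))) = real ((m - r) * (2 * m choose (m + r)))" by (simp only:)
  then have "real (2 * m choose (m + Suc r)) * (real m + real r + 1) = (real m - real r) * real (2 * m choose (m + r))"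
    using True by (simp only: of_nat_mult of_nat_add of_nat_diff of_nat_1 mult.commute)
  then have "real (2 * m choose (m + Suc r)) = (real m - real r) * real (2 * m choose (m + r)) / (real m + real r + 1)"
    by (subst eq_divide_eq) auto
  then show ?thesis unfolding binomial_ratio_def by (simp add: mult_ac)
qed (auto simp: binomial_ratio_def binomial_eq_0)

lemma binomial_ratio_0 [simp]: "binomial_ratio m 0 = 1"
  by (simp add: binomial_ratio_def)

lemma binomial_ratio_nonneg: "binomial_ratio m r \<ge> 0"
  by (simp add: binomial_ratio_def)

text \<open>Consecutive ratios are \<open>1 - (2 * r + 1) / (m + r + 1)\<close>, and the odd numbers
  \<open>2 * j + 1\<close> with \<open>j < r\<close> sum to \<open>r^2\<close>. The parameter
  \<open>s\<close> freezes the denominator during the induction; it is later taken as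
  \<open>r\<close> for the limit and as \<open>m\<close> for the majorant.\<close>

lemma binomial_ratio_upper:
  assumes "m > 0" "r \<le> s"
  shows "binomial_ratio m r \<le> exp (- (real r)\<^sup>2 / (m + s))"
  using assms(2)
proof (induction r)
  case (Suc r)
  show ?case
  proof (cases "r \<le> m")
    case True
    have "(real m - real r) / (real m + real r + 1) = 1 + (- (2 * real r + 1) / (real m + real r + 1))"
      by (simp add: field_simps)
    also have "\<dots> \<le> 1 + (- (2 * real r + 1) / (real m + real s))"
    proof -
      have "(2 * real r + 1) / (real m + real s) \<le> (2 * real r + 1) / (real m + real r + 1)"
        using Suc.prems assms(1) by (intro divide_left_mono) auto
      then show ?thesis by (simp only: minus_divide_left [symmetric] add_left_mono neg_le_iff_le)
    qed
    also have "\<dots> \<le> exp (- (2 * real r + 1) / (real m + real s))" by (rule exp_ge_add_one_self)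
    finally have "binomial_ratio m (Suc r) \<le> exp (- (real r)\<^sup>2 / (m + s)) * exp (- (2 * real r + 1) / (real m + real s))"
      unfolding binomial_ratio_Suc using Suc True by (intro mult_mono) auto
    also have "\<dots> = exp (- (real (Suc r))\<^sup>2 / (m + s))"
      unfolding exp_add [symmetric] add_divide_distrib [symmetric] of_nat_add
      by (rule arg_cong[where f = exp]) (simp add: power2_eq_square algebra_simps)
    finally show ?thesis .
  qed (auto simp: binomial_ratio_def binomial_eq_0)
qed simp

text \<open>Here the ratio is written \<open>1 / (1 + (2 * r + 1) / (m - r))\<close> and bounded
  below by \<open>1 + x \<le> exp x\<close>.\<close>

lemma binomial_ratio_lower:
  assumes "r \<le> s" "s \<le> m"
  shows "exp (- (real r)\<^sup>2 / (real m - real s + 1)) \<le> binomial_ratio m r"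
  using assms(1)
proof (induction r)
  case (Suc r)
  have pos: "real m - real r > 0" "real m - real s + 1 > 0" using Suc.prems assms(2) by auto
  have "exp (- (2 * real r + 1) / (real m - real s + 1)) \<le> exp (- (2 * real r + 1) / (real m - real r))"
  proof -
    have "(2 * real r + 1) / (real m - real r) \<le> (2 * real r + 1) / (real m - real s + 1)"
      using pos Suc.prems by (intro divide_left_mono) auto
    then show ?thesis by (simp only: minus_divide_left [symmetric] exp_le_cancel_iff neg_le_iff_le)
  qed
  also have "\<dots> = inverse (exp ((2 * real r + 1) / (real m - real r)))"
    unfolding exp_minus [symmetric] by (simp only: minus_divide_left)
  also have "\<dots> \<le> inverse (1 + (2 * real r + 1) / (real m - real r))"
    using pos exp_ge_add_one_self[of "(2 * real r + 1) / (real m - real r)"]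
    by (intro le_imp_inverse_le) (auto intro!: add_pos_nonneg)
  also have "\<dots> = (real m - real r) / (real m + real r + 1)"
    using pos by (simp add: field_simps)
  finally have "exp (- (real r)\<^sup>2 / (real m - real s + 1)) * exp (- (2 * real r + 1) / (real m - real s + 1)) \<le>
      binomial_ratio m (Suc r)"
    unfolding binomial_ratio_Suc using Suc by (intro mult_mono) (auto simp: binomial_ratio_nonneg)
  also have "exp (- (real r)\<^sup>2 / (real m - real s + 1)) * exp (- (2 * real r + 1) / (real m - real s + 1)) =
      exp (- (real (Suc r))\<^sup>2 / (real m - real s + 1))"
    unfolding exp_add [symmetric] add_divide_distrib [symmetric]
    by (rule arg_cong[where f = exp]) (simp add: power2_eq_square algebra_simps)
  finally show ?case .
qed simp

section \<open>Limit of the finite formula: theta inversion for real arguments\<close>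

lemma central_binomial_asymp: "(\<lambda>m. real (2 * m choose m) / 4 ^ m * sqrt (2 * m + 1)) \<longlonglongrightarrow> sqrt (2 / pi)"
proof -
  define c where "c m = real (2 * m choose m) / 4 ^ m" for m
  have c_Suc: "c (Suc m) = c m * (2 * real m + 1) / (2 * real m + 2)" for m
  proof -
    have "Suc m * (2 * Suc m choose Suc m) = 2 * (2 * m + 1) * (2 * m choose m)"
    proof -
      define a X where "a = (2 * m + 1) choose m" and "X = (Suc (2 * m + 1) choose Suc m)"
      have 1: "Suc m * X = (2 * Suc m) * a"
        unfolding a_def X_def by (subst Suc_times_binomial) simp
      have "a = (Suc (2 * m) choose Suc m)"
        using binomial_symmetric[of m "2 * m + 1"] by (simp add: a_def)
      then have 2: "Suc m * a = Suc (2 * m) * (2 * m choose m)"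
        by (simp only: Suc_times_binomial)
      have "Suc m * X = 2 * (Suc m * a)" using 1 by (simp only: mult.assoc)
      then show ?thesis unfolding 2 by (simp add: X_def)
    qed
    then have "real (Suc m * (2 * Suc m choose Suc m)) = real (2 * (2 * m + 1) * (2 * m choose m))" by (simp only:)
    then have "real (2 * Suc m choose Suc m) * (real m + 1) = 2 * (2 * real m + 1) * real (2 * m choose m)"
      by (simp only: of_nat_mult of_nat_add of_nat_Suc of_nat_numeral of_nat_1 ac_simps)
    then have "real (2 * Suc m choose Suc m) = 2 * (2 * real m + 1) * real (2 * m choose m) / (real m + 1)"
      by (subst eq_divide_eq) auto
    then have "c (Suc m) = 2 * (2 * real m + 1) * real (2 * m choose m) / (real m + 1) / 4 ^ Suc m"
      unfolding c_def by (rule arg_cong)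
    also have "\<dots> = c m * (2 * real m + 1) / (2 * real m + 2)"
    proof -
      have "2 * x * B / (y + 1) / (4 * Q) = B / Q * x / (2 * y + 2)" if "Q > 0" "y \<ge> 0" for x y B Q :: real
        using that by (simp add: divide_simps)
      from this[of "4 ^ m" "real m" "2 * real m + 1" "real (2 * m choose m)"]
      show ?thesis unfolding power_Suc c_def by (simp only: zero_less_power zero_less_numeral of_nat_0_le_iff)
    qed
    finally show ?thesis .
  qed
  \<comment> \<open>The partial products of Wallis are exactly the inverse squares of the sequence
    in question.\<close>
  have "(\<Prod>k=1..m. (4 * real k ^ 2) / (4 * real k ^ 2 - 1)) = inverse ((c m)\<^sup>2 * (2 * real m + 1))" for m
  proof (induction m)
    case (Suc m)
    have gen: "inverse (a * u) * (4 * (X + 1)\<^sup>2 / (u * v)) = inverse (a * u\<^sup>2 / (2 * X + 2)\<^sup>2 * v)"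
      if "u > 0" "v > 0" "a > 0" "X \<ge> 0" for a u v X :: real
    proof -
      have "2 * X + 2 = 2 * (X + 1)" by simp
      then have "(2 * X + 2)\<^sup>2 = 4 * (X + 1)\<^sup>2" by (simp only: power_mult_distrib) simp
      then show ?thesis using that by (simp only:) (simp add: power2_eq_square field_simps)
    qed
    have "4 * real (Suc m) ^ 2 - 1 = (2 * real m + 1) * (2 * real m + 3)" by (simp add: power2_eq_square algebra_simps)
    moreover have "c m > 0" by (simp add: c_def)
    ultimately show ?case using Suc gen[of "2 * real m + 1" "2 * real m + 3" "(c m)\<^sup>2" "real m"]
      by (simp add: c_Suc power_mult_distrib power_divide add.commute)
  qed (simp add: c_def)
  also have "(c m)\<^sup>2 * (2 * real m + 1) = (c m * sqrt (2 * m + 1))\<^sup>2" for m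
    by (simp add: power_mult_distrib)
  finally have "(\<Prod>k=1..m. (4 * real k ^ 2) / (4 * real k ^ 2 - 1)) = inverse ((c m * sqrt (2 * m + 1))\<^sup>2)" for m .
  then have "(\<lambda>m. inverse ((c m * sqrt (2 * m + 1))\<^sup>2)) \<longlonglongrightarrow> pi / 2" using wallis by simp
  then have "(\<lambda>m. sqrt (inverse (inverse ((c m * sqrt (2 * m + 1))\<^sup>2)))) \<longlonglongrightarrow> sqrt (inverse (pi / 2))"
    by (intro tendsto_real_sqrt tendsto_inverse) auto
  moreover have "sqrt (inverse (inverse ((c m * sqrt (2 * m + 1))\<^sup>2))) = c m * sqrt (2 * m + 1)" for m
    by (simp add: c_def)
  ultimately show ?thesis by (simp add: c_def)
qed

lemma theta_inversion_real_aux: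
  fixes t :: real
  assumes t: "t > 0"
  defines "m \<equiv> \<lambda>p. nat \<lfloor>4 * real p ^ 2 / (pi * t)\<rfloor>"
  shows "filterlim m at_top sequentially"
    and "(\<lambda>p. real (m p) / real p ^ 2) \<longlonglongrightarrow> 4 / (pi * t)"
proof -
  have *: "filterlim (\<lambda>p. 4 * real p ^ 2 / (pi * t)) at_top sequentially"
    using t by real_asymp
  show "filterlim m at_top sequentially"
    unfolding m_def
    by (rule filterlim_compose[OF filterlim_nat_sequentially filterlim_compose[OF filterlim_floor_sequentially *]])
  show "(\<lambda>p. real (m p) / real p ^ 2) \<longlonglongrightarrow> 4 / (pi * t)"
  proof (rule tendsto_sandwich)
    have m: "real (m p) = of_int \<lfloor>4 * real p ^ 2 / (pi * t)\<rfloor>" for p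
      using t by (simp add: m_def)
    show "\<forall>\<^sub>F p in sequentially. real (m p) / real p ^ 2 \<le> 4 * real p ^ 2 / (pi * t) / real p ^ 2"
      unfolding m by (intro always_eventually allI divide_right_mono) auto
    show "\<forall>\<^sub>F p in sequentially. (4 * real p ^ 2 / (pi * t) - 1) / real p ^ 2 \<le> real (m p) / real p ^ 2"
      unfolding m by (intro always_eventually allI divide_right_mono) (linarith, simp)
    have "(\<lambda>p. 4 / (pi * t) - 1 / real p ^ 2) \<longlonglongrightarrow> 4 / (pi * t) - 0"
      by (intro tendsto_intros) real_asymp
    then show "(\<lambda>p. (4 * real p ^ 2 / (pi * t) - 1) / real p ^ 2) \<longlonglongrightarrow> 4 / (pi * t)"
    proof (rule Lim_transform_eventually[OF tendsto_eq_rhs])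
      show "\<forall>\<^sub>F p in sequentially. 4 / (pi * t) - 1 / real p ^ 2 = (4 * real p ^ 2 / (pi * t) - 1) / real p ^ 2"
        using eventually_gt_at_top[of 0] by eventually_elim (simp add: diff_divide_distrib)
    qed simp
    show "(\<lambda>p. 4 * real p ^ 2 / (pi * t) / real p ^ 2) \<longlonglongrightarrow> 4 / (pi * t)"
    proof (rule Lim_transform_eventually[OF tendsto_const])
      show "\<forall>\<^sub>F p in sequentially. 4 / (pi * t) = 4 * real p ^ 2 / (pi * t) / real p ^ 2"
        using eventually_gt_at_top[of 0] by eventually_elim simp
    qed
  qed
qed

lemma theta_inversion_real:
  fixes t :: real
  assumes t: "t > 0"
  shows "sqrt t * (1 + 2 * (\<Sum>v. (-1) ^ Suc v * exp (- pi * t * (real (Suc v))\<^sup>2))) =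
         2 * (\<Sum>k. exp (- pi * (real k + 1 / 2)\<^sup>2 / t))"
proof -
  define m where "m = (\<lambda>p. nat \<lfloor>4 * real p ^ 2 / (pi * t)\<rfloor>)"
  have m_lim: "filterlim m at_top sequentially" "(\<lambda>p. real (m p) / real p ^ 2) \<longlonglongrightarrow> 4 / (pi * t)"
    unfolding m_def using theta_inversion_real_aux[OF t] by simp_all
  define w where "w p k = pi * (2 * real k + 1) / (4 * real p)" for p k :: nat
  \<comment> \<open>Heuristically \<open>p / sqrt (pi * m)\<close> with
    \<open>m = 4 * p^2 / (pi * t)\<close>.\<close>
  have c_lim: "(\<lambda>p. real p * (real (2 * m p choose m p) / 4 ^ m p)) \<longlonglongrightarrow> sqrt t / 2"
  proof -
    have "(\<lambda>p. (real (2 * m p choose m p) / 4 ^ m p * sqrt (2 * m p + 1)) *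
         sqrt (inverse (2 * (real (m p) / real p ^ 2) + 1 / real p ^ 2))) \<longlonglongrightarrow>
         sqrt (2 / pi) * sqrt (inverse (2 * (4 / (pi * t)) + 0))"
      using t by (intro tendsto_mult tendsto_real_sqrt tendsto_inverse tendsto_add tendsto_const m_lim
          filterlim_compose[OF central_binomial_asymp m_lim(1)]) (real_asymp | simp)+
    also have "sqrt (2 / pi) * sqrt (inverse (2 * (4 / (pi * t)) + 0)) = sqrt (t / 4)"
      using t by (simp flip: real_sqrt_mult)
    also have "sqrt (t / 4) = sqrt t / 2" by (simp add: real_sqrt_divide)
    finally show ?thesis
    proof (rule Lim_transform_eventually)
      show "\<forall>\<^sub>F p in sequentially. (real (2 * m p choose m p) / 4 ^ m p * sqrt (2 * m p + 1)) *
         sqrt (inverse (2 * (real (m p) / real p ^ 2) + 1 / real p ^ 2)) =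
         real p * (real (2 * m p choose m p) / 4 ^ m p)"
        using eventually_gt_at_top[of 0]
      proof eventually_elim
        case (elim p)
        have "inverse (2 * (real (m p) / real p ^ 2) + 1 / real p ^ 2) = real p ^ 2 / (2 * m p + 1)"
          using elim by (simp add: divide_simps)
        then have "sqrt (inverse (2 * (real (m p) / real p ^ 2) + 1 / real p ^ 2)) = real p / sqrt (2 * m p + 1)"
          by (simp add: real_sqrt_divide)
        then show ?case by simp
      qed
    qed
  qed

  \<comment> \<open>Because \<open>ln (cos w)\<close> behaves like \<open>- w^2 / 2\<close>, the
    power tends to the exponential of minus the limit of \<open>m * w^2\<close>.\<close>
  have cos_lim: "(\<lambda>p. if k < p then cos (w p k) ^ (2 * m p) else 0) \<longlonglongrightarrow> exp (- pi * (real k + 1 / 2)\<^sup>2 / t)" for k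
  proof -
    have w0: "filterlim (\<lambda>p. w p k) (at_right 0) sequentially"
      unfolding w_def by real_asymp
    have "((\<lambda>x::real. ln (cos x) / x\<^sup>2) \<longlongrightarrow> - 1 / 2) (at_right 0)" by real_asymp
    from filterlim_compose[OF this w0] have 1: "(\<lambda>p. ln (cos (w p k)) / (w p k)\<^sup>2) \<longlonglongrightarrow> - 1 / 2" .
    have "(\<lambda>p. (real (m p) / real p ^ 2) * (pi * (2 * real k + 1) / 4)\<^sup>2) \<longlonglongrightarrow> 4 / (pi * t) * (pi * (2 * real k + 1) / 4)\<^sup>2"
      by (intro tendsto_mult m_lim tendsto_const)
    also have "(\<lambda>p. (real (m p) / real p ^ 2) * (pi * (2 * real k + 1) / 4)\<^sup>2) = (\<lambda>p. real (m p) * (w p k)\<^sup>2)"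
      by (simp add: w_def power_divide power_mult_distrib mult_ac)
    finally have 2: "(\<lambda>p. real (m p) * (w p k)\<^sup>2) \<longlonglongrightarrow> 4 / (pi * t) * (pi * (2 * real k + 1) / 4)\<^sup>2" .
    have "(\<lambda>p. exp (2 * (real (m p) * (w p k)\<^sup>2) * (ln (cos (w p k)) / (w p k)\<^sup>2))) \<longlonglongrightarrow>
       exp (2 * (4 / (pi * t) * (pi * (2 * real k + 1) / 4)\<^sup>2) * (- 1 / 2))"
      by (intro tendsto_exp tendsto_mult 1 2 tendsto_const)
    also have "2 * (4 / (pi * t) * (pi * (2 * real k + 1) / 4)\<^sup>2) * (- 1 / 2) = - pi * (real k + 1 / 2)\<^sup>2 / t"
      using t by (simp add: power2_eq_square field_simps)
    finally show ?thesis
    proof (rule Lim_transform_eventually)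
      have "\<forall>\<^sub>F p in sequentially. w p k \<in> {0<..<pi / 2}"
        by (rule eventually_compose_filterlim[OF _ w0]) (rule eventually_at_right_real, simp)
      then show "\<forall>\<^sub>F p in sequentially. exp (2 * (real (m p) * (w p k)\<^sup>2) * (ln (cos (w p k)) / (w p k)\<^sup>2)) =
         (if k < p then cos (w p k) ^ (2 * m p) else 0)"
        using eventually_gt_at_top[of k]
      proof eventually_elim
        case (elim p)
        have "2 * (real (m p) * (w p k)\<^sup>2) * (ln (cos (w p k)) / (w p k)\<^sup>2) = real (2 * m p) * ln (cos (w p k))"
          using elim by simp
        moreover have "cos (w p k) > 0" using elim by (intro cos_gt_zero) auto
        ultimately show ?case using elim by (simp only: exp_of_nat_mult exp_ln if_True)
      qed
    qed
  qed

  have m_ge: "\<forall>\<^sub>F p in sequentially. real (m p) / real p ^ 2 \<ge> 2 / (pi * t)"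
  proof -
    have "2 / (pi * t) < 4 / (pi * t)" using t by (simp add: divide_simps)
    from order_tendstoD(1)[OF m_lim(2) this] show ?thesis by eventually_elim simp
  qed
  have m_le: "real (m p) \<le> 4 * real p ^ 2 / (pi * t)" for p
    using t by (simp add: m_def)

  have lhs: "(\<lambda>p. \<Sum>k. if k < p then cos (w p k) ^ (2 * m p) else 0) \<longlonglongrightarrow> (\<Sum>k. exp (- pi * (real k + 1 / 2)\<^sup>2 / t))"
  proof -
    \<comment> \<open>Half of the limit of \<open>m p / p^2\<close> is a safe lower bound, and
      weakening the quadratic exponent to a linear one makes the majorant geometric.\<close>
    have "\<forall>\<^sub>F p in sequentially. \<forall>k. norm (if k < p then cos (w p k) ^ (2 * m p) else 0) \<le> exp (- 1 / (2 * pi * t)) ^ k"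
      using m_ge eventually_gt_at_top[of 0]
    proof eventually_elim
      case (elim p)
      have "norm (if k < p then cos (w p k) ^ (2 * m p) else 0) \<le> exp (- 1 / (2 * pi * t)) ^ k" for k
      proof (cases "k < p")
        case True
        have w: "0 \<le> w p k" "w p k \<le> pi / 2"
          using True elim by (auto simp: w_def divide_simps mult_left_mono)
        have "cos (w p k) ^ (2 * m p) \<le> exp (- 2 * (w p k / pi)\<^sup>2) ^ (2 * m p)"
          using w by (intro power_mono cos_le_exp cos_ge_zero) auto
        also have "\<dots> = exp (- (real (m p) / real p ^ 2) * ((2 * real k + 1)\<^sup>2 / 4))"
        proof -
          have e: "w p k / pi = (2 * real k + 1) / (4 * real p)" by (simp add: w_def)
          have "real (2 * m p) * (- 2 * (w p k / pi)\<^sup>2) = - (real (m p) / real p ^ 2) * ((2 * real k + 1)\<^sup>2 / 4)"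
            unfolding e power_divide power_mult_distrib by simp
          then show ?thesis by (simp only: exp_of_nat_mult [symmetric])
        qed
        also have "\<dots> \<le> exp (- (2 / (pi * t)) * (real k / 4))"
        proof -
          have "real k / 4 \<le> (2 * real k + 1)\<^sup>2 / 4" by (simp add: power2_eq_square algebra_simps)
          then have "2 / (pi * t) * (real k / 4) \<le> (real (m p) / real p ^ 2) * ((2 * real k + 1)\<^sup>2 / 4)"
            using elim t by (intro mult_mono) auto
          then show ?thesis by simp
        qed
        also have "\<dots> = exp (- 1 / (2 * pi * t)) ^ k"
          by (simp flip: exp_of_nat_mult add: field_simps)
        finally show ?thesis using True w by (simp add: cos_ge_zero)
      qed simp
      then show ?case by blast
    qed
    then have "\<forall>\<^sub>F (k, p) in at_top \<times>\<^sub>F sequentially. norm (if k < p then cos (w p k) ^ (2 * m p) else 0) \<le> exp (- 1 / (2 * pi * t)) ^ k"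
      by (intro eventually_prod_filter[THEN iffD2]) (use eventually_True in fastforce)
    moreover have "summable (\<lambda>k. exp (- 1 / (2 * pi * t)) ^ k)"
      using t by (intro summable_geometric) auto
    ultimately show ?thesis
      using tannerys_theorem[OF cos_lim, where M = "\<lambda>k. exp (- 1 / (2 * pi * t)) ^ k"] by auto
  qed

  have b_lim: "(\<lambda>p. if v < m p then (-1) ^ Suc v * binomial_ratio (m p) (2 * p * Suc v) else 0)
                 \<longlonglongrightarrow> (-1) ^ Suc v * exp (- pi * t * (real (Suc v))\<^sup>2)" for v
  proof -
    define r where "r p = 2 * p * Suc v" for p
    have inv: "(\<lambda>p. real p ^ 2 / real (m p)) \<longlonglongrightarrow> pi * t / 4"
      using tendsto_inverse[OF m_lim(2)] t by simp
    have rm: "(\<lambda>p. real (r p) / real (m p)) \<longlonglongrightarrow> 0"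
    proof -
      have "(\<lambda>p. real p ^ 2 / real (m p) * (2 * real (Suc v) / real p)) \<longlonglongrightarrow> pi * t / 4 * 0"
        by (intro tendsto_mult inv) real_asymp
      moreover have "\<forall>\<^sub>F p in sequentially. real p ^ 2 / real (m p) * (2 * real (Suc v) / real p) = real (r p) / real (m p)"
        using eventually_gt_at_top[of 0] by eventually_elim (simp add: r_def power2_eq_square, simp add: algebra_simps)
      ultimately show ?thesis by (simp add: Lim_transform_eventually)
    qed
    have r2m: "(\<lambda>p. (real (r p))\<^sup>2 / real (m p)) \<longlonglongrightarrow> pi * t * (real (Suc v))\<^sup>2"
    proof -
      have "(\<lambda>p. real p ^ 2 / real (m p) * (2 * real (Suc v))\<^sup>2) \<longlonglongrightarrow> pi * t / 4 * (2 * real (Suc v))\<^sup>2"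
        by (intro tendsto_mult inv tendsto_const)
      moreover have "real p ^ 2 / real (m p) * (2 * real (Suc v))\<^sup>2 = (real (r p))\<^sup>2 / real (m p)" for p
        unfolding r_def of_nat_mult power_mult_distrib by simp
      moreover have "pi * t / 4 * (2 * real (Suc v))\<^sup>2 = pi * t * (real (Suc v))\<^sup>2"
        unfolding power_mult_distrib by simp
      ultimately show ?thesis by (simp only:)
    qed
    have im: "(\<lambda>p. 1 / real (m p)) \<longlonglongrightarrow> 0"
      using filterlim_compose[OF lim_1_over_n m_lim(1)] by simp
    have m_pos: "\<forall>\<^sub>F p in sequentially. m p > k" for k
      using m_lim(1) unfolding filterlim_at_top by (auto simp: Suc_le_eq dest: spec[of _ "Suc k"])
    have r_le: "\<forall>\<^sub>F p in sequentially. r p \<le> m p"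
    proof -
      have "\<forall>\<^sub>F p in sequentially. real (r p) / real (m p) < 1" using order_tendstoD(2)[OF rm, of 1] by simp
      then show ?thesis using m_pos[of 0] by eventually_elim (auto simp: divide_simps)
    qed
    \<comment> \<open>Both Gaussian bounds are applied with \<open>s = r p\<close>; their
      denominators differ from \<open>m p\<close> only by lower order since \<open>r p / m p\<close>
      tends to 0.\<close>
    have "(\<lambda>p. binomial_ratio (m p) (r p)) \<longlonglongrightarrow> exp (- (pi * t * (real (Suc v))\<^sup>2))"
    proof (rule tendsto_sandwich)
      show "\<forall>\<^sub>F p in sequentially. binomial_ratio (m p) (r p) \<le> exp (- ((real (r p))\<^sup>2 / real (m p)) / (1 + real (r p) / real (m p)))"
        using m_pos[of 0]
      proof eventually_elim
        case (elim p)
        have "- ((real (r p))\<^sup>2 / real (m p)) / (1 + real (r p) / real (m p)) = - (real (r p))\<^sup>2 / (real (m p) + real (r p))"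
        proof -
          have "1 + real (r p) / real (m p) = (real (m p) + real (r p)) / real (m p)"
            using elim by (simp add: add_divide_distrib)
          then show ?thesis using elim by simp
        qed
        then show ?case using binomial_ratio_upper[OF elim order_refl, of "r p"] by (simp only: of_nat_add)
      qed
      show "\<forall>\<^sub>F p in sequentially. exp (- ((real (r p))\<^sup>2 / real (m p)) / (1 - real (r p) / real (m p) + 1 / real (m p))) \<le> binomial_ratio (m p) (r p)"
        using m_pos[of 0] r_le
      proof eventually_elim
        case (elim p)
        have "- ((real (r p))\<^sup>2 / real (m p)) / (1 - real (r p) / real (m p) + 1 / real (m p)) = - (real (r p))\<^sup>2 / (real (m p) - real (r p) + 1)"
        proof -
          have "1 - real (r p) / real (m p) + 1 / real (m p) = (real (m p) - real (r p) + 1) / real (m p)"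
            using elim by (simp add: add_divide_distrib diff_divide_distrib)
          then show ?thesis using elim by simp
        qed
        then show ?case using binomial_ratio_lower[OF order_refl elim(2)] by (simp only:)
      qed
      have "(\<lambda>p. exp (- ((real (r p))\<^sup>2 / real (m p)) / (1 + real (r p) / real (m p)))) \<longlonglongrightarrow>
            exp (- (pi * t * (real (Suc v))\<^sup>2) / (1 + 0))"
        by (intro tendsto_intros rm r2m) auto
      then show "(\<lambda>p. exp (- ((real (r p))\<^sup>2 / real (m p)) / (1 + real (r p) / real (m p)))) \<longlonglongrightarrow>
            exp (- (pi * t * (real (Suc v))\<^sup>2))" by simp
      have "(\<lambda>p. exp (- ((real (r p))\<^sup>2 / real (m p)) / (1 - real (r p) / real (m p) + 1 / real (m p)))) \<longlonglongrightarrow>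
            exp (- (pi * t * (real (Suc v))\<^sup>2) / (1 - 0 + 0))"
        by (intro tendsto_intros rm r2m im) auto
      then show "(\<lambda>p. exp (- ((real (r p))\<^sup>2 / real (m p)) / (1 - real (r p) / real (m p) + 1 / real (m p)))) \<longlonglongrightarrow>
            exp (- (pi * t * (real (Suc v))\<^sup>2))" by simp
    qed
    then have "(\<lambda>p. (-1) ^ Suc v * binomial_ratio (m p) (r p)) \<longlonglongrightarrow> (-1) ^ Suc v * exp (- (pi * t * (real (Suc v))\<^sup>2))"
      by (intro tendsto_mult tendsto_const)
    moreover have "\<forall>\<^sub>F p in sequentially. (-1) ^ Suc v * binomial_ratio (m p) (r p) =
        (if v < m p then (-1) ^ Suc v * binomial_ratio (m p) (2 * p * Suc v) else 0)"
      using m_pos[of v] by eventually_elim (simp add: r_def)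
    ultimately show ?thesis by (simp add: Lim_transform_eventually)
  qed

  have rhs: "(\<lambda>p. \<Sum>v. if v < m p then (-1) ^ Suc v * binomial_ratio (m p) (2 * p * Suc v) else 0)
     \<longlonglongrightarrow> (\<Sum>v. (-1) ^ Suc v * exp (- pi * t * (real (Suc v))\<^sup>2))"
  proof -
    have "\<forall>\<^sub>F p in sequentially. \<forall>v. norm (if v < m p then (-1) ^ Suc v * binomial_ratio (m p) (2 * p * Suc v) else 0)
        \<le> exp (- pi * t / 2) ^ v"
    proof (intro always_eventually allI)
      fix p v
      show "norm (if v < m p then (-1) ^ Suc v * binomial_ratio (m p) (2 * p * Suc v) else 0) \<le> exp (- pi * t / 2) ^ v"
      proof (cases "v < m p")
        case True
        then have m0: "m p > 0" by simp
        \<comment> \<open>For a majorant valid for all \<open>v\<close> at once the choice is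
          \<open>s = m p\<close>; larger indices have ratio 0.\<close>
        have bound: "binomial_ratio (m p) (2 * p * Suc v) \<le> exp (- (real (2 * p * Suc v))\<^sup>2 / (m p + m p))"
        proof (cases "2 * p * Suc v \<le> m p")
          case True
          then show ?thesis using binomial_ratio_upper[OF m0 True] by simp
        next
          case False
          then show ?thesis by (simp add: binomial_ratio_def binomial_eq_0)
        qed
        also have "\<dots> \<le> exp (- pi * t / 2 * real v)"
        proof -
          have "pi * t * real (m p) \<le> 4 * real p ^ 2" using m_le[of p] t by (simp add: pos_le_divide_eq mult_ac)
          moreover have "real v \<le> (real (Suc v))\<^sup>2" by (simp add: power2_eq_square algebra_simps)
          ultimately have "pi * t * real (m p) * real v \<le> 4 * real p ^ 2 * (real (Suc v))\<^sup>2"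
            by (rule mult_mono) auto
          also have "\<dots> = (real (2 * p * Suc v))\<^sup>2" unfolding of_nat_mult power_mult_distrib by simp
          finally have "pi * t / 2 * real v * (real (m p) + real (m p)) \<le> (real (2 * p * Suc v))\<^sup>2" by (simp add: mult_ac)
          then have "pi * t / 2 * real v \<le> (real (2 * p * Suc v))\<^sup>2 / (real (m p) + real (m p))"
            using m0 by (subst pos_le_divide_eq) auto
          then show ?thesis by (simp del: of_nat_mult)
        qed
        also have "\<dots> = exp (- pi * t / 2) ^ v" by (simp flip: exp_of_nat_mult add: mult_ac)
        finally show ?thesis using True by (simp add: abs_mult binomial_ratio_nonneg)
      qed simp
    qed
    then have "\<forall>\<^sub>F (v, p) in at_top \<times>\<^sub>F sequentially. norm (if v < m p then (-1) ^ Suc v * binomial_ratio (m p) (2 * p * Suc v) else 0)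
        \<le> exp (- pi * t / 2) ^ v"
      by (intro eventually_prod_filter[THEN iffD2]) (use eventually_True in fastforce)
    moreover have "summable (\<lambda>v. exp (- pi * t / 2) ^ v)"
      using t by (intro summable_geometric) auto
    ultimately show ?thesis
      using tannerys_theorem[OF b_lim, where M = "\<lambda>v. exp (- pi * t / 2) ^ v"] by auto
  qed

  have fin: "(\<Sum>k. if k < N then f k else 0) = (\<Sum>k<N. f k)" for f :: "nat \<Rightarrow> real" and N
    by (subst suminf_finite[of "{..<N}"]) auto
  have "(\<lambda>p. real p * (real (2 * m p choose m p) / 4 ^ m p) *
          (1 + 2 * (\<Sum>v. if v < m p then (-1) ^ Suc v * binomial_ratio (m p) (2 * p * Suc v) else 0)))
        \<longlonglongrightarrow> sqrt t / 2 * (1 + 2 * (\<Sum>v. (-1) ^ Suc v * exp (- pi * t * (real (Suc v))\<^sup>2)))"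
    by (intro tendsto_mult tendsto_add tendsto_const rhs c_lim)
  moreover have "\<forall>\<^sub>F p in sequentially. real p * (real (2 * m p choose m p) / 4 ^ m p) *
          (1 + 2 * (\<Sum>v. if v < m p then (-1) ^ Suc v * binomial_ratio (m p) (2 * p * Suc v) else 0)) =
        (\<Sum>k. if k < p then cos (w p k) ^ (2 * m p) else 0)"
    using eventually_gt_at_top[of 0]
  proof eventually_elim
    case (elim p)
    show ?case
      unfolding fin using polya_theta_identity[OF elim, of "m p"]
      by (simp only: w_def sum.atLeast1_atMost_eq One_nat_def)
  qed
  ultimately have "(\<lambda>p. \<Sum>k. if k < p then cos (w p k) ^ (2 * m p) else 0)
        \<longlonglongrightarrow> sqrt t / 2 * (1 + 2 * (\<Sum>v. (-1) ^ Suc v * exp (- pi * t * (real (Suc v))\<^sup>2)))"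
    by (rule Lim_transform_eventually)
  from LIMSEQ_unique[OF lhs this] show ?thesis by simp
qed

text \<open>This is theta_2 without its leading factor:
  \<open>(k + 1 / 2)^2 = k * (k + 1) + 1 / 4\<close>, and the quarter is split off as
  \<open>exp (- pi / (4 * \<tau>))\<close> to leave integral exponents.\<close>

definition psi_fps :: "complex fps" where
  "psi_fps = Abs_fps (\<lambda>n. if \<exists>k. n = k * Suc k then 1 else 0)"

lemma fps_conv_radius_psi: "fps_conv_radius psi_fps \<ge> 1"
  unfolding fps_conv_radius_def psi_fps_def
proof (rule conv_radius_ge_oneI)
  fix r :: real assume r: "0 < r" "r < 1"
  show "summable (\<lambda>n. norm (fps_nth (Abs_fps (\<lambda>n. if \<exists>k. n = k * Suc k then 1 else 0 :: complex)) n) * r ^ n)"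
  proof (rule summable_comparison_test'[of "\<lambda>n. r ^ n" 0])
    show "summable (\<lambda>n. r ^ n)" using r by (intro summable_geometric) auto
  qed (use r in auto)
qed

lemma eval_psi_fps_sums:
  assumes "norm x < 1"
  shows "(\<lambda>k. x ^ (k * Suc k)) sums eval_fps psi_fps x"
proof -
  define f where "f n = (if \<exists>k. n = k * Suc k then 1 else 0) * x ^ n" for n
  have "f sums eval_fps psi_fps x"
    using sums_eval_fps[OF less_fps_conv_radius_oneI[OF assms fps_conv_radius_psi]]
    by (simp add: psi_fps_def f_def[abs_def])
  moreover have "strict_mono (\<lambda>k::nat. k * Suc k)"
    by (rule strict_monoI_Suc) simp
  ultimately have "(\<lambda>k. f (k * Suc k)) sums eval_fps psi_fps x"
    by (subst sums_mono_reindex) (auto simp: f_def image_iff simp del: mult_Suc_right)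
  moreover have "f (k * Suc k) = x ^ (k * Suc k)" for k by (auto simp: f_def simp del: mult_Suc_right)
  ultimately show ?thesis by (simp only:)
qed

text \<open>Since \<open>k * (k + 1) \<ge> 2 * k\<close>, the terms after the first are dominated by
  a geometric series in \<open>(norm x)^2\<close>, whose ratio of at most 1/4 gives the factor
  4/3.\<close>

lemma norm_psi_minus_one_le:
  assumes x: "(norm x)\<^sup>2 \<le> 1 / 4"
  shows "norm (eval_fps psi_fps x - 1) \<le> 4 / 3 * (norm x)\<^sup>2"
proof -
  have "(norm x)\<^sup>2 < 1\<^sup>2" using x by simp
  then have x1: "norm x < 1" by (rule power2_less_imp_less) simp
  define w where "w = (norm x)\<^sup>2"
  have w: "0 \<le> w" "w \<le> 1 / 4" using x by (auto simp: w_def)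
  have "(\<lambda>k. x ^ (Suc k * Suc (Suc k))) sums (eval_fps psi_fps x - x ^ (0 * Suc 0))"
    using eval_psi_fps_sums[OF x1] by (subst sums_Suc_iff) simp
  then have s: "(\<lambda>k. x ^ (Suc k * Suc (Suc k))) sums (eval_fps psi_fps x - 1)" by simp
  have "(\<lambda>k. w * w ^ k) sums (w * (1 / (1 - w)))"
    using w by (intro sums_mult geometric_sums) auto
  moreover have "norm (x ^ (Suc k * Suc (Suc k))) \<le> w * w ^ k" for k
  proof -
    have "norm (x ^ (Suc k * Suc (Suc k))) \<le> norm x ^ (2 * Suc k)"
      unfolding norm_power using x1 by (intro power_decreasing) auto
    also have "\<dots> = w * w ^ k" by (simp only: w_def power_mult power_Suc)
    finally show ?thesis .
  qed
  ultimately have "norm (eval_fps psi_fps x - 1) \<le> w * (1 / (1 - w))"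
    by (intro norm_sums_le[OF s])
  also have "\<dots> \<le> w * (4 / 3)" using w by (intro mult_left_mono) (auto simp: field_simps)
  finally show ?thesis by (simp add: w_def)
qed

lemma psi_inverse_bounds:
  assumes x: "(norm x)\<^sup>2 \<le> 1 / 4"
  shows "norm (1 / eval_fps psi_fps x) \<le> 3 / 2"
    and "norm (1 / eval_fps psi_fps x - 1) \<le> 2 * (norm x)\<^sup>2"
proof -
  define S where "S = eval_fps psi_fps x"
  have 1: "norm (S - 1) \<le> 4 / 3 * (norm x)\<^sup>2" unfolding S_def by (rule norm_psi_minus_one_le[OF x])
  then have "norm (S - 1) \<le> 1 / 3" using x by simp
  moreover have "1 \<le> norm S + norm (S - 1)" using norm_triangle_ineq4[of S "S - 1"] by simp
  ultimately have S: "norm S \<ge> 2 / 3" by simp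
  then have "inverse (norm S) \<le> inverse (2 / 3)" by (intro le_imp_inverse_le) auto
  then have S2: "norm (1 / S) \<le> 3 / 2" by (simp add: norm_divide inverse_eq_divide)
  show "norm (1 / eval_fps psi_fps x) \<le> 3 / 2" using S2 by (simp add: S_def)
  have "S \<noteq> 0" using S by auto
  then have "1 / S - 1 = (1 - S) * (1 / S)" by (simp add: field_simps)
  then have "norm (1 / S - 1) = norm (S - 1) * norm (1 / S)" by (simp only: norm_mult norm_minus_commute)
  also have "\<dots> \<le> 4 / 3 * (norm x)\<^sup>2 * (3 / 2)" using 1 S2 by (intro mult_mono) auto
  finally show "norm (1 / eval_fps psi_fps x - 1) \<le> 2 * (norm x)\<^sup>2" by (simp add: S_def)
qed

section \<open>Inversion in the right half-plane and the modular formula\<close>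

lemma norm_exp_minus_pi_mult_less_one:
  fixes \<tau> :: complex
  shows "Re \<tau> > 0 \<Longrightarrow> norm (exp (- of_real pi * \<tau>) :: complex) < 1"
  by (simp add: norm_exp_eq_Re)

lemma Re_inverse_pos: "Re \<tau> > 0 \<Longrightarrow> Re (1 / \<tau>) > 0"
  by (simp add: Re_divide complex_eq_iff sum_power2_gt_zero_iff)

lemma norm_exp_minus_pi_divide_less_one:
  fixes \<tau> :: complex
  shows "Re \<tau> > 0 \<Longrightarrow> norm (exp (- of_real pi / \<tau>) :: complex) < 1"
  using norm_exp_minus_pi_mult_less_one[OF Re_inverse_pos] by simp

text \<open>Both sides are holomorphic in the right half-plane, where the principal square root has
  no cut, and they agree on the positive reals; the identity theorem does the rest.\<close>

theorem theta_inversion: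
  fixes \<tau> :: complex
  assumes \<tau>: "Re \<tau> > 0"
  shows "csqrt \<tau> * eval_fps theta_fps (exp (- of_real pi * \<tau>)) =
         2 * exp (- of_real pi / (4 * \<tau>)) * eval_fps psi_fps (exp (- of_real pi / \<tau>))"
proof -
  define H where "H = {z. Re z > 0}"
  define f where "f = (\<lambda>\<tau>::complex. csqrt \<tau> * eval_fps theta_fps (exp (- of_real pi * \<tau>)) -
         2 * exp (- of_real pi / (4 * \<tau>)) * eval_fps psi_fps (exp (- of_real pi / \<tau>)))"
  have H: "open H" "connected H"
    unfolding H_def by (auto intro: open_halfspace_Re_gt convex_connected convex_halfspace_Re_gt)
  have nonpos: "\<tau> \<notin> \<real>\<^sub>\<le>\<^sub>0" "\<tau> \<noteq> 0" if "\<tau> \<in> H" for \<tau>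
    using that by (auto simp: H_def complex_nonpos_Reals_iff)
  have th: "(\<lambda>\<tau>. eval_fps theta_fps (exp (- of_real pi * \<tau>))) holomorphic_on H"
  proof -
    have "(eval_fps theta_fps \<circ> (\<lambda>\<tau>. exp (- of_real pi * \<tau>))) holomorphic_on H"
    proof (rule holomorphic_on_compose_gen)
      show "eval_fps theta_fps holomorphic_on ball 0 1"
        by (rule holomorphic_on_eval_fps) (use less_fps_conv_radius_oneI[OF _ fps_conv_radius_theta] in \<open>auto simp: in_eball_iff\<close>)
    qed (auto intro!: holomorphic_intros simp: H_def norm_exp_eq_Re)
    then show ?thesis by (simp add: o_def)
  qed
  have ps: "(\<lambda>\<tau>. eval_fps psi_fps (exp (- of_real pi / \<tau>))) holomorphic_on H"
  proof -
    have "(eval_fps psi_fps \<circ> (\<lambda>\<tau>. exp (- of_real pi / \<tau>))) holomorphic_on H"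
    proof (rule holomorphic_on_compose_gen)
      show "eval_fps psi_fps holomorphic_on ball 0 1"
        by (rule holomorphic_on_eval_fps) (use less_fps_conv_radius_oneI[OF _ fps_conv_radius_psi] in \<open>auto simp: in_eball_iff\<close>)
      show "(\<lambda>\<tau>. exp (- of_real pi / \<tau>)) holomorphic_on H"
        using nonpos by (intro holomorphic_intros) auto
    qed (use norm_exp_minus_pi_divide_less_one in \<open>auto simp: H_def\<close>)
    then show ?thesis by (simp add: o_def)
  qed
  have f: "f holomorphic_on H"
    unfolding f_def using nonpos by (intro holomorphic_intros th ps) auto
  have real: "f (of_real t) = 0" if t: "t > 0" for t :: real
  proof -
    have "(\<lambda>s. (if s = 0 then 1 else 2 * (-1) ^ s * exp (- of_real pi * of_real t) ^ s\<^sup>2)) sums eval_fps theta_fps (exp (- of_real pi * of_real t))"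
      using norm_exp_minus_pi_mult_less_one[of "of_real t"] t by (intro eval_theta_fps_sums) simp
    then have "(\<lambda>s. 2 * (-1) ^ Suc s * exp (- of_real pi * of_real t) ^ (Suc s)\<^sup>2) sums (eval_fps theta_fps (exp (- of_real pi * of_real t)) - 1)"
      using sums_Suc_iff[of "\<lambda>s. (if s = 0 then 1 else 2 * (-1) ^ s * exp (- of_real pi * of_real t) ^ s\<^sup>2)"
          "eval_fps theta_fps (exp (- of_real pi * of_real t)) - 1"] by simp
    also have "(\<lambda>s. 2 * (-1) ^ Suc s * exp (- of_real pi * of_real t) ^ (Suc s)\<^sup>2) =
        (\<lambda>s. complex_of_real (2 * ((-1) ^ Suc s * exp (- pi * t * (real (Suc s))\<^sup>2))))"
      by (rule ext) (simp add: mult_ac flip: exp_of_nat_mult exp_of_real)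
    finally have s1: "(\<lambda>s. complex_of_real (2 * ((-1) ^ Suc s * exp (- pi * t * (real (Suc s))\<^sup>2)))) sums
        (eval_fps theta_fps (exp (- of_real pi * of_real t)) - 1)" .
    then have "summable (\<lambda>s. 2 * ((-1) ^ Suc s * exp (- pi * t * (real (Suc s))\<^sup>2)))"
      by (rule summable_of_real_iff[where 'a = complex, THEN iffD1, OF sums_summable])
    then have "summable (\<lambda>s. (-1) ^ Suc s * exp (- pi * t * (real (Suc s))\<^sup>2))"
      by (rule summable_mult_D) simp
    then have "(\<lambda>s. complex_of_real (2 * ((-1) ^ Suc s * exp (- pi * t * (real (Suc s))\<^sup>2)))) sums
        of_real (2 * (\<Sum>s. (-1) ^ Suc s * exp (- pi * t * (real (Suc s))\<^sup>2)))"
      by (intro sums_of_real sums_mult summable_sums)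
    with s1 have e1: "eval_fps theta_fps (exp (- of_real pi * of_real t)) - 1 =
        of_real (2 * (\<Sum>s. (-1) ^ Suc s * exp (- pi * t * (real (Suc s))\<^sup>2)))"
      by (rule sums_unique2)
    have "(\<lambda>k. 2 * exp (- of_real pi / (4 * of_real t)) * exp (- of_real pi / of_real t) ^ (k * Suc k)) sums
        (2 * exp (- of_real pi / (4 * of_real t)) * eval_fps psi_fps (exp (- of_real pi / of_real t)))"
      using norm_exp_minus_pi_divide_less_one[of "of_real t"] t by (intro sums_mult eval_psi_fps_sums) simp
    also have "(\<lambda>k. 2 * exp (- of_real pi / (4 * of_real t)) * exp (- of_real pi / of_real t) ^ (k * Suc k)) =
        (\<lambda>k. complex_of_real (2 * exp (- pi * (real k + 1 / 2)\<^sup>2 / t)))"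
    proof
      fix k
      have "- pi * (real k + 1 / 2)\<^sup>2 / t = - pi / (4 * t) + real (k * Suc k) * (- pi / t)"
        using t by (simp add: field_simps power2_eq_square)
      then have "complex_of_real (exp (- pi * (real k + 1 / 2)\<^sup>2 / t)) = of_real (exp (- pi / (4 * t)) * exp (- pi / t) ^ (k * Suc k))"
        by (simp only: exp_add exp_of_nat_mult)
      then show "2 * exp (- of_real pi / (4 * of_real t)) * exp (- of_real pi / of_real t) ^ (k * Suc k) =
        complex_of_real (2 * exp (- pi * (real k + 1 / 2)\<^sup>2 / t))"
        by (simp flip: exp_of_real)
    qed
    finally have s2: "(\<lambda>k. complex_of_real (2 * exp (- pi * (real k + 1 / 2)\<^sup>2 / t))) sums
        (2 * exp (- of_real pi / (4 * of_real t)) * eval_fps psi_fps (exp (- of_real pi / of_real t)))" .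
    then have "summable (\<lambda>k. 2 * exp (- pi * (real k + 1 / 2)\<^sup>2 / t))"
      by (rule summable_of_real_iff[where 'a = complex, THEN iffD1, OF sums_summable])
    then have "summable (\<lambda>k. exp (- pi * (real k + 1 / 2)\<^sup>2 / t))"
      by (rule summable_mult_D) simp
    then have "(\<lambda>k. complex_of_real (2 * exp (- pi * (real k + 1 / 2)\<^sup>2 / t))) sums
        of_real (2 * (\<Sum>k. exp (- pi * (real k + 1 / 2)\<^sup>2 / t)))"
      by (intro sums_of_real sums_mult summable_sums)
    with s2 have e2: "2 * exp (- of_real pi / (4 * of_real t)) * eval_fps psi_fps (exp (- of_real pi / of_real t)) =
        of_real (2 * (\<Sum>k. exp (- pi * (real k + 1 / 2)\<^sup>2 / t)))"
      by (rule sums_unique2)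
    have "csqrt (of_real t) = of_real (sqrt t)" using t by (intro of_real_sqrt [symmetric]) auto
    moreover have "eval_fps theta_fps (exp (- of_real pi * of_real t)) =
        of_real (1 + 2 * (\<Sum>s. (-1) ^ Suc s * exp (- pi * t * (real (Suc s))\<^sup>2)))"
      using e1 by (simp add: algebra_simps)
    ultimately show ?thesis
      unfolding f_def e2 using theta_inversion_real[OF t] by (simp only: of_real_mult [symmetric]) simp
  qed
  have lim: "(1 :: complex) islimpt (of_real ` {0<..})"
  proof (rule islimptI)
    fix T :: "complex set" assume T: "1 \<in> T" "open T"
    then obtain e where e: "e > 0" "ball 1 e \<subseteq> T" using openE by blast
    have "complex_of_real (1 + e / 2) \<in> ball 1 e" using e by (simp add: dist_norm)
    moreover have "complex_of_real (1 + e / 2) \<in> complex_of_real ` {0<..}"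
      using e by (intro imageI) auto
    moreover have "complex_of_real (1 + e / 2) \<noteq> 1" using e by simp
    ultimately show "\<exists>y\<in>complex_of_real ` {0<..}. y \<in> T \<and> y \<noteq> 1" using e by blast
  qed
  have "f \<tau> = 0"
  proof (rule analytic_continuation[OF f H _ _ lim])
    show "complex_of_real ` {0<..} \<subseteq> H" "1 \<in> H" "\<tau> \<in> H" using \<tau> by (auto simp: H_def)
  qed (use real in auto)
  then show ?thesis by (simp add: f_def)
qed

theorem pbar_modular:
  fixes \<tau> :: complex
  assumes \<tau>: "Re \<tau> > 0"
  shows "eval_fps pbar_fps (exp (- of_real pi * \<tau>)) =
         csqrt \<tau> / 2 * exp (of_real pi / (4 * \<tau>)) * (1 / eval_fps psi_fps (exp (- of_real pi / \<tau>)))"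
proof -
  define P T S where "P = eval_fps pbar_fps (exp (- of_real pi * \<tau>))" and "T = eval_fps theta_fps (exp (- of_real pi * \<tau>))"
    and "S = eval_fps psi_fps (exp (- of_real pi / \<tau>))"
  have PT: "P * T = 1"
    unfolding P_def T_def by (rule eval_pbar_mult_theta[OF norm_exp_minus_pi_mult_less_one[OF \<tau>]])
  have inv: "csqrt \<tau> * T = 2 * exp (- of_real pi / (4 * \<tau>)) * S"
    unfolding T_def S_def by (rule theta_inversion[OF \<tau>])
  \<comment> \<open>That the psi series has no zero here is read off from the inversion formula: the
    theta series is invertible by \<open>PT\<close>.\<close>
  have "csqrt \<tau> \<noteq> 0" using \<tau> by auto
  moreover have "T \<noteq> 0" using PT by auto
  ultimately have S: "S \<noteq> 0" using inv by auto
  have "exp (of_real pi / (4 * \<tau>)) * exp (- of_real pi / (4 * \<tau>)) = 1" by (simp flip: exp_add)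
  then have "P * (2 * S) = P * (2 * S) * (exp (of_real pi / (4 * \<tau>)) * exp (- of_real pi / (4 * \<tau>)))" by simp
  also have "\<dots> = exp (of_real pi / (4 * \<tau>)) * (P * (csqrt \<tau> * T))" unfolding inv by (simp only: mult_ac)
  also have "\<dots> = csqrt \<tau> * exp (of_real pi / (4 * \<tau>))" using PT by (simp add: mult_ac)
  finally show ?thesis using S unfolding P_def [symmetric] S_def [symmetric] by (simp add: field_simps)
qed

text \<open>The logarithm of \<open>(1 + x) / (1 - x)\<close> is twice the sum of
  \<open>x ^ n / n\<close> over odd \<open>n\<close>. Replacing \<open>x\<close> by
  \<open>norm x\<close> increases the real part of every term; only the gain at \<open>n = 1\<close>
  is kept.\<close>

lemma norm_ratio_le_exp:
  fixes x :: complex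
  assumes x: "norm x < 1"
  shows "norm ((1 + x) / (1 - x)) \<le> (1 + norm x) / (1 - norm x) * exp (2 * Re x - 2 * norm x)"
proof -
  define \<rho> where "\<rho> = norm x"
  have \<rho>: "0 \<le> \<rho>" "\<rho> < 1" using x by (auto simp: \<rho>_def)
  have s: "(\<lambda>n. (1 - (-1) ^ n) / of_nat n * z ^ n) sums (ln (1 + z) - ln (1 - z))" if "norm z < 1" for z :: complex
  proof -
    have "(\<lambda>n. (-1) ^ Suc n / of_nat n * z ^ n - (-1) ^ Suc n / of_nat n * (- z) ^ n) sums (ln (1 + z) - ln (1 + - z))"
      using that by (intro sums_diff Ln_series) auto
    also have "(\<lambda>n. (-1) ^ Suc n / of_nat n * z ^ n - (-1) ^ Suc n / of_nat n * (- z) ^ n) = (\<lambda>n. (1 - (-1) ^ n) / of_nat n * z ^ n)"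
    proof
      fix n
      have "(- z) ^ n = (-1) ^ n * z ^ n" by (rule power_minus)
      moreover have "(-1 :: complex) ^ n * (-1) ^ n = 1" by (simp flip: power_add add: mult_2 [symmetric])
      ultimately show "(-1) ^ Suc n / of_nat n * z ^ n - (-1) ^ Suc n / of_nat n * (- z) ^ n = (1 - (-1) ^ n) / of_nat n * z ^ n"
        by (simp add: algebra_simps diff_divide_distrib)
    qed
    finally show ?thesis by simp
  qed
  have Re_term: "Re ((1 - (-1) ^ n) / of_nat n * z ^ n) = (1 - (-1) ^ n) / real n * Re (z ^ n)" for n and z :: complex
  proof -
    have "(1 - (-1) ^ n) / of_nat n = complex_of_real ((1 - (-1) ^ n) / real n)" by simp
    then show ?thesis
      by (simp only: times_complex.sel Re_complex_of_real Im_complex_of_real mult_zero_left diff_zero)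
  qed
  have ln_norm: "Re (ln z) = ln (norm z)" if "z \<noteq> 0" for z :: complex using that by simp
  have nz: "1 + x \<noteq> 0" "1 - x \<noteq> 0" using x by (auto simp: add_eq_0_iff)
  have "(\<lambda>n. (1 - (-1) ^ n) / real n * Re (z ^ n)) sums (Re (ln (1 + z)) - Re (ln (1 - z)))" if "norm z < 1" for z :: complex
    using sums_Re[OF s[OF that]] by (simp only: Re_term minus_complex.sel)
  from sums_diff[OF this[of "of_real \<rho>"] this[OF x]]
  have "(\<lambda>n. (1 - (-1) ^ n) / real n * (Re (complex_of_real \<rho> ^ n) - Re (x ^ n))) sums
     ((Re (ln (1 + of_real \<rho>)) - Re (ln (1 - of_real \<rho>))) - (Re (ln (1 + x)) - Re (ln (1 - x))))"
    using \<rho> by (simp only: right_diff_distrib) simp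
  moreover have "0 \<le> (1 - (-1) ^ n) / real n * (Re (complex_of_real \<rho> ^ n) - Re (x ^ n))" for n
  proof (intro mult_nonneg_nonneg)
    have "Re (x ^ n) \<le> norm x ^ n" using complex_Re_le_cmod[of "x ^ n"] by (simp add: norm_power)
    then show "0 \<le> Re (complex_of_real \<rho> ^ n) - Re (x ^ n)"
      by (simp add: \<rho>_def flip: of_real_power)
  qed (auto simp: minus_one_power_iff)
  ultimately have "(\<Sum>n\<in>{1}. (1 - (-1) ^ n) / real n * (Re (complex_of_real \<rho> ^ n) - Re (x ^ n))) \<le>
     ((Re (ln (1 + of_real \<rho>)) - Re (ln (1 - of_real \<rho>))) - (Re (ln (1 + x)) - Re (ln (1 - x))))"
    by (metis (no_types, lifting) finite.emptyI finite_insert sum_le_suminf sums_summable sums_unique)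
  then have "2 * (\<rho> - Re x) \<le> ln (norm (1 + complex_of_real \<rho>)) - ln (norm (1 - complex_of_real \<rho>)) - (ln (norm (1 + x)) - ln (norm (1 - x)))"
    using nz \<rho> by (subst (asm) (1 2 3 4) ln_norm) (auto simp: complex_eq_iff)
  moreover have "norm (1 + complex_of_real \<rho>) = 1 + \<rho>" "norm (1 - complex_of_real \<rho>) = 1 - \<rho>"
  proof -
    have "norm (complex_of_real (1 + \<rho>)) = 1 + \<rho>" "norm (complex_of_real (1 - \<rho>)) = 1 - \<rho>"
      using \<rho> by (auto simp only: norm_of_real intro!: abs_of_nonneg)
    then show "norm (1 + complex_of_real \<rho>) = 1 + \<rho>" "norm (1 - complex_of_real \<rho>) = 1 - \<rho>" by simp_all
  qed
  ultimately have "ln (norm (1 + x)) - ln (norm (1 - x)) \<le> ln (1 + \<rho>) - ln (1 - \<rho>) + (2 * Re x - 2 * \<rho>)" by simp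
  then have "exp (ln (norm (1 + x)) - ln (norm (1 - x))) \<le> exp (ln (1 + \<rho>) - ln (1 - \<rho>) + (2 * Re x - 2 * \<rho>))" by simp
  moreover have "exp (ln (1 + \<rho>)) = 1 + \<rho>" "exp (ln (1 - \<rho>)) = 1 - \<rho>"
    using \<rho> by (simp_all add: exp_ln)
  moreover have "exp (ln (norm (1 + x))) = norm (1 + x)" "exp (ln (norm (1 - x))) = norm (1 - x)"
    using nz by simp_all
  ultimately show ?thesis unfolding \<rho>_def [symmetric] by (simp only: exp_add exp_diff norm_divide)
qed

text \<open>
  Away from \<open>q = norm q\<close> the product is smaller than at \<open>norm q\<close>: already the linear terms of
  the logarithms of the factors see the difference.
\<close>
lemma norm_pbar_le:
  assumes q: "norm q < 1"
  shows "norm (eval_fps pbar_fps q) \<le> norm (eval_fps pbar_fps (of_real (norm q))) *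
     exp (- ((1 + norm q) / (1 - norm q) * (1 - (1 - norm q)\<^sup>2 / (norm (1 - q))\<^sup>2)))"
proof -
  define r where "r = norm q"
  have r: "0 \<le> r" "r < 1" using q by (auto simp: r_def)
  have geo: "(\<lambda>k. \<Sum>j=1..k. z ^ j) \<longlonglongrightarrow> z / (1 - z)" if "norm z < 1" for z :: complex
  proof -
    have "(\<lambda>n. z * z ^ n) sums (z * (1 / (1 - z)))" using that by (intro sums_mult geometric_sums)
    then show ?thesis by (simp add: sums_def sum.atLeast1_atMost_eq)
  qed
  have le: "norm (\<Prod>j=1..k. (1 + q ^ j) / (1 - q ^ j)) \<le>
      norm (\<Prod>j=1..k. (1 + complex_of_real r ^ j) / (1 - complex_of_real r ^ j)) *
      exp (2 * Re (\<Sum>j=1..k. q ^ j) - 2 * Re (\<Sum>j=1..k. complex_of_real r ^ j))" for k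
  proof -
    have "norm (\<Prod>j=1..k. (1 + q ^ j) / (1 - q ^ j)) = (\<Prod>j=1..k. norm ((1 + q ^ j) / (1 - q ^ j)))"
      by (rule prod_norm [symmetric])
    also have "\<dots> \<le> (\<Prod>j=1..k. norm ((1 + complex_of_real r ^ j) / (1 - complex_of_real r ^ j)) * exp (2 * Re (q ^ j) - 2 * Re (complex_of_real r ^ j)))"
    proof (intro prod_mono conjI norm_ge_zero)
      fix j assume "j \<in> {1..k}"
      then have qj: "norm (q ^ j) < 1" using norm_power_less_one[OF q, of j] by auto
      have e: "complex_of_real r ^ j = of_real (norm (q ^ j))" by (simp add: r_def norm_power)
      have "norm ((1 + complex_of_real r ^ j) / (1 - complex_of_real r ^ j)) = \<bar>(1 + norm (q ^ j)) / (1 - norm (q ^ j))\<bar>"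
        unfolding e norm_of_real [symmetric, where 'a = complex] by simp
      also have "\<dots> = (1 + norm (q ^ j)) / (1 - norm (q ^ j))" using qj by (intro abs_of_nonneg divide_nonneg_nonneg add_nonneg_nonneg) auto
      finally show "norm ((1 + q ^ j) / (1 - q ^ j)) \<le>
         norm ((1 + complex_of_real r ^ j) / (1 - complex_of_real r ^ j)) * exp (2 * Re (q ^ j) - 2 * Re (complex_of_real r ^ j))"
        using norm_ratio_le_exp[OF qj] by (simp add: e del: of_real_power norm_power)
    qed
    also have "\<dots> = norm (\<Prod>j=1..k. (1 + complex_of_real r ^ j) / (1 - complex_of_real r ^ j)) *
      exp (2 * Re (\<Sum>j=1..k. q ^ j) - 2 * Re (\<Sum>j=1..k. complex_of_real r ^ j))"
      by (simp only: prod.distrib prod_norm exp_sum [symmetric] finite_atLeastAtMost sum_subtractf sum_distrib_left Re_sum)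
    finally show ?thesis .
  qed
  have "norm (eval_fps pbar_fps q) \<le> norm (eval_fps pbar_fps (of_real r)) *
     exp (2 * Re (q / (1 - q)) - 2 * Re (of_real r / (1 - of_real r)))"
  proof (rule LIMSEQ_le)
    show "(\<lambda>k. norm (\<Prod>j=1..k. (1 + q ^ j) / (1 - q ^ j))) \<longlonglongrightarrow> norm (eval_fps pbar_fps q)"
      by (intro tendsto_norm pbar_product_tendsto q)
    show "(\<lambda>k. norm (\<Prod>j=1..k. (1 + complex_of_real r ^ j) / (1 - complex_of_real r ^ j)) *
      exp (2 * Re (\<Sum>j=1..k. q ^ j) - 2 * Re (\<Sum>j=1..k. complex_of_real r ^ j))) \<longlonglongrightarrow>
       norm (eval_fps pbar_fps (of_real r)) * exp (2 * Re (q / (1 - q)) - 2 * Re (of_real r / (1 - of_real r)))"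
      using r by (intro tendsto_intros pbar_product_tendsto geo q) auto
  qed (use le in blast)
  \<comment> \<open>The linear gains of all factors form geometric series, and
    \<open>1 + 2 * Re (q / (1 - q))\<close> is the Poisson kernel
    \<open>(1 - r^2) / (norm (1 - q))^2\<close>.\<close>
  also have "2 * Re (q / (1 - q)) - 2 * Re (of_real r / (1 - of_real r)) =
      - ((1 + r) / (1 - r) * (1 - (1 - r)\<^sup>2 / (norm (1 - q))\<^sup>2))"
  proof -
    have nz: "norm (1 - q) \<noteq> 0" using q by auto
    have "Re (q / (1 - q)) = (Re q - r\<^sup>2) / (norm (1 - q))\<^sup>2"
      unfolding r_def cmod_power2 by (simp add: Re_divide) (simp add: power2_eq_square algebra_simps)
    moreover have "(norm (1 - q))\<^sup>2 = 1 - 2 * Re q + r\<^sup>2"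
      unfolding r_def cmod_power2 by (simp add: power2_eq_square algebra_simps)
    then have "2 * Re q - 2 * r\<^sup>2 = (1 - r\<^sup>2) - (norm (1 - q))\<^sup>2" by simp
    moreover have "2 * Re (q / (1 - q)) = (2 * Re q - 2 * r\<^sup>2) / (norm (1 - q))\<^sup>2"
      unfolding \<open>Re (q / (1 - q)) = _\<close> by simp
    ultimately have 1: "2 * Re (q / (1 - q)) = (1 - r\<^sup>2) / (norm (1 - q))\<^sup>2 - 1"
      using nz by (simp only: diff_divide_distrib [of "1 - r\<^sup>2"]) simp
    have "complex_of_real r / (1 - of_real r) = of_real (r / (1 - r))" by simp
    then have 2: "2 * Re (of_real r / (1 - of_real r)) = (1 + r) / (1 - r) - 1"
      using r by (simp only: Re_complex_of_real) (simp add: field_simps)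
    have "(1 + r) / (1 - r) * ((1 - r)\<^sup>2 / (norm (1 - q))\<^sup>2) = (1 - r\<^sup>2) / (norm (1 - q))\<^sup>2"
    proof -
      have "(1 + r) / (1 - r) * (1 - r)\<^sup>2 = 1 - r\<^sup>2" using r by (simp add: power2_eq_square field_simps)
      then show ?thesis by (simp only: times_divide_eq_right)
    qed
    then show ?thesis unfolding 1 2 by (simp only: right_diff_distrib)
  qed
  finally show ?thesis by (simp add: r_def)
qed

section \<open>The circle method\<close>

lemma has_integral_exp_i_pi:
  fixes d :: int
  shows "((\<lambda>u. exp (\<i> * of_real (pi * of_int d * u))) has_integral (if d = 0 then 2 else 0)) {-1..1}"
proof (cases "d = 0")
  case True
  then show ?thesis using has_integral_const_real[of "1::complex" "-1" 1] by (simp add: scaleR_conv_of_real)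
next
  case False
  define c where "c = \<i> * of_real (pi * of_int d)"
  have c: "c \<noteq> 0" using False by (simp add: c_def)
  have "((\<lambda>u. exp (c * of_real u)) has_integral (exp (c * of_real 1) / c - exp (c * of_real (-1)) / c)) {-1..1}"
  proof (rule fundamental_theorem_of_calculus)
    fix u :: real
    have "((\<lambda>z. exp (c * z) / c) has_field_derivative exp (c * of_real u)) (at (of_real u))"
      using c by (auto intro!: derivative_eq_intros)
    then show "((\<lambda>u. exp (c * of_real u) / c) has_vector_derivative exp (c * of_real u)) (at u within {-1..1})"
      by (rule has_vector_derivative_real_field)
  qed simp
  also have "exp (c * of_real 1) / c - exp (c * of_real (-1)) / c = 0"
  proof -
    have "exp (c * of_real 1) = exp (c * of_real (-1))"
      unfolding exp_eq by (rule exI[of _ d]) (simp add: c_def algebra_simps)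
    then show ?thesis by simp
  qed
  finally show ?thesis using False by (simp add: c_def mult_ac)
qed

text \<open>In the variable \<open>\<tau>\<close> the circle becomes a vertical segment of length 2,
  one period of \<open>exp (- pi * \<tau>)\<close>. Uniform convergence permits integration term by
  term, and only \<open>k = n\<close> survives.\<close>

lemma pbar_has_integral:
  assumes t0: "t0 > 0"
  shows "((\<lambda>u. eval_fps pbar_fps (exp (- of_real pi * Complex t0 u)) * exp (of_real (pi * real n) * Complex t0 u))
           has_integral (2 * of_nat (pbar n))) {-1..1}"
proof -
  define r where "r = exp (- pi * t0)"
  have r: "0 \<le> r" "r < 1" using t0 by (auto simp: r_def)
  define f where "f k u = of_nat (pbar k) * exp (- of_real pi * Complex t0 u) ^ k * exp (of_real (pi * real n) * Complex t0 u)" for k u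
  define g where "g u = eval_fps pbar_fps (exp (- of_real pi * Complex t0 u)) * exp (of_real (pi * real n) * Complex t0 u)" for u
  have q: "norm (exp (- of_real pi * Complex t0 u)) = r" for u by (simp add: norm_exp_eq_Re r_def)
  have sums: "(\<lambda>k. f k u) sums g u" for u
  proof -
    have "(\<lambda>k. of_nat (pbar k) * exp (- of_real pi * Complex t0 u) ^ k) sums eval_fps pbar_fps (exp (- of_real pi * Complex t0 u))"
    proof -
      have "norm (exp (- of_real pi * Complex t0 u)) < 1" unfolding q by (rule r(2))
      from sums_eval_fps[OF less_fps_conv_radius_oneI[OF this fps_conv_radius_pbar]] show ?thesis
        by (simp add: pbar_fps_def)
    qed
    then show ?thesis unfolding f_def g_def by (rule sums_mult2)
  qed
  have "uniform_limit {-1..1} (\<lambda>N u. \<Sum>k<N. f k u) (\<lambda>u. \<Sum>k. f k u) sequentially"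
  proof (rule Weierstrass_m_test)
    show "norm (f k u) \<le> pbar k * r ^ k * exp (pi * n * t0)" for k u
      by (simp add: f_def norm_mult norm_power q) (simp add: norm_exp_eq_Re r_def)
    show "summable (\<lambda>k. pbar k * r ^ k * exp (pi * n * t0))"
      by (intro summable_mult2 summable_pbar r)
  qed
  moreover have "(\<lambda>u. \<Sum>k. f k u) = g" using sums by (auto simp: sums_iff)
  ultimately have lim: "uniform_limit {-1..1} (\<lambda>N u. \<Sum>k<N. f k u) g sequentially" by simp
  have f_int: "(f k has_integral (if k = n then 2 * of_nat (pbar n) else 0)) {-1..1}" for k
  proof -
    have f_eq: "f k u = of_nat (pbar k) * exp (of_real (pi * (real n - real k) * t0)) * exp (\<i> * of_real (pi * of_int (int n - int k) * u))" for u
    proof -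
      have "exp (- of_real pi * Complex t0 u) ^ k * exp (of_real (pi * real n) * Complex t0 u) =
            exp (of_nat k * (- of_real pi * Complex t0 u) + of_real (pi * real n) * Complex t0 u)"
        by (simp only: exp_add exp_of_nat_mult)
      also have "of_nat k * (- of_real pi * Complex t0 u) + of_real (pi * real n) * Complex t0 u =
         of_real (pi * (real n - real k) * t0) + \<i> * of_real (pi * of_int (int n - int k) * u)"
        by (simp add: complex_eq_iff algebra_simps)
      finally show ?thesis by (simp only: f_def exp_add mult.assoc)
    qed
    have "(f k has_integral (of_nat (pbar k) * exp (of_real (pi * (real n - real k) * t0)) * (if int n - int k = 0 then 2 else 0))) {-1..1}"
      unfolding f_eq by (intro has_integral_mult_right has_integral_exp_i_pi)
    then show ?thesis by (cases "k = n") (auto simp: mult.commute)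
  qed
  have cont: "continuous_on {-1..1} (\<lambda>u. \<Sum>k<N. f k u)" for N
    unfolding f_def complex_of_real_def [symmetric] Complex_eq by (intro continuous_intros)
  obtain I J where I: "\<And>N. ((\<lambda>u. \<Sum>k<N. f k u) has_integral I N) {-1..1}" and J: "(g has_integral J) {-1..1}" "I \<longlonglongrightarrow> J"
    using uniform_limit_integral[OF lim cont] by auto
  have I_eq: "I N = (\<Sum>k<N. if k = n then 2 * of_nat (pbar n) else 0)" for N
    using has_integral_unique[OF I has_integral_sum[of "{..<N}" f, OF _ f_int]] by simp
  have "eventually (\<lambda>N. I N = 2 * of_nat (pbar n)) sequentially"
    using eventually_gt_at_top[of n] by eventually_elim (simp add: I_eq)
  then have "I \<longlonglongrightarrow> 2 * of_nat (pbar n)" by (rule tendsto_eventually)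
  with J have "J = 2 * of_nat (pbar n)" using LIMSEQ_unique by blast
  with J show ?thesis unfolding g_def [abs_def] by (simp only:)
qed

text \<open>The tails are compared with Gaussians recentred at the end points: for
  \<open>y > 1/2\<close> one has \<open>y^2 \<ge> (y - 1/2)^2 + 1/4\<close>, and the quarter yields
  the factor \<open>exp (- z / 2)\<close>.\<close>

lemma gaussian_interval_bounds:
  fixes z :: real
  assumes z: "z > 0"
  defines "I \<equiv> sqrt (pi / (2 * z))"
  obtains G where "((\<lambda>y. exp (- 2 * z * y\<^sup>2)) has_integral G) {-1/2..1/2}" "G \<le> I" "I * (1 - 2 * exp (- z / 2)) \<le> G"
proof -
  define \<sigma> where "\<sigma> = 1 / (2 * sqrt z)"
  have \<sigma>: "\<sigma> > 0" "\<sigma>\<^sup>2 = 1 / (4 * z)" using z by (auto simp: \<sigma>_def power_divide power_mult_distrib)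
  define N where "N \<mu> y = I * normal_density \<mu> \<sigma> y" for \<mu> y
  have N_eq: "N \<mu> y = exp (- 2 * z * (y - \<mu>)\<^sup>2)" for \<mu> y
  proof -
    have "sqrt (2 * pi * \<sigma>\<^sup>2) = I" unfolding I_def \<sigma> using z by simp
    moreover have "I > 0" using z by (simp add: I_def)
    moreover have "(y - \<mu>)\<^sup>2 / (2 * \<sigma>\<^sup>2) = 2 * z * (y - \<mu>)\<^sup>2" unfolding \<sigma> using z by (simp add: field_simps)
    ultimately show ?thesis by (simp add: N_def normal_density_def)
  qed
  have I0: "I > 0" using z by (simp add: I_def)
  have N_int: "integrable lborel (N \<mu>)" "(\<integral>y. N \<mu> y \<partial>lborel) = I" for \<mu>
    using \<sigma>(1) unfolding N_def by auto
  define A where "A = {-1/2..1/2 :: real}"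
  define G where "G = (\<integral>y. indicator A y * N 0 y \<partial>lborel)"
  have intA: "integrable lborel (\<lambda>y. indicator A y * N 0 y)"
    using integrable_mult_indicator[OF _ N_int(1)[of 0], of A] by (simp add: A_def)
  have "set_integrable lborel A (N 0)" using intA by (simp add: set_integrable_def)
  then have "(N 0 has_integral (LINT x : A | lborel. N 0 x)) A"
    by (simp add: set_borel_integral_eq_integral integrable_integral)
  moreover have "(LINT x : A | lborel. N 0 x) = G"
    by (simp add: G_def set_lebesgue_integral_def)
  ultimately have 1: "((\<lambda>y. exp (- 2 * z * y\<^sup>2)) has_integral G) {-1/2..1/2}"
  proof -
    assume "(N 0 has_integral (LINT x : A | lborel. N 0 x)) A" "(LINT x : A | lborel. N 0 x) = G"
    moreover have "N 0 = (\<lambda>y. exp (- 2 * z * y\<^sup>2))" by (rule ext) (simp add: N_eq)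
    ultimately show ?thesis by (simp only: A_def)
  qed
  have 2: "G \<le> I"
  proof -
    have "G \<le> (\<integral>y. N 0 y \<partial>lborel)" unfolding G_def
      by (intro integral_mono intA N_int) (auto simp: indicator_def N_eq)
    then show ?thesis by (simp add: N_int)
  qed
  have "I - G = (\<integral>y. N 0 y - indicator A y * N 0 y \<partial>lborel)"
    unfolding G_def by (subst Bochner_Integration.integral_diff) (auto simp: N_int intA)
  also have "\<dots> \<le> (\<integral>y. exp (- z / 2) * N (1/2) y + exp (- z / 2) * N (-1/2) y \<partial>lborel)"
  proof (intro integral_mono)
    fix y :: real
    show "N 0 y - indicator A y * N 0 y \<le> exp (- z / 2) * N (1/2) y + exp (- z / 2) * N (-1/2) y"
    proof (cases "y \<in> A")
      case False
      then consider "y > 1/2" | "y < -1/2" by (auto simp: A_def)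
      then show ?thesis
      proof cases
        case 1
        have "(y - 1/2)\<^sup>2 + 1/4 \<le> y\<^sup>2" using 1 by (simp add: power2_eq_square algebra_simps)
        then have "z * ((y - 1/2)\<^sup>2 + 1/4) \<le> z * y\<^sup>2" using z by (intro mult_left_mono) auto
        then have "exp (- 2 * z * y\<^sup>2) \<le> exp (- z / 2 + - 2 * z * (y - 1/2)\<^sup>2)" by (simp add: algebra_simps)
        then have "N 0 y \<le> exp (- z / 2) * N (1/2) y" unfolding N_eq exp_add by simp
        then show ?thesis using False by (simp add: N_eq add_increasing2)
      next
        case 2
        have "(y + 1/2)\<^sup>2 + 1/4 \<le> y\<^sup>2" using 2 by (simp add: power2_eq_square algebra_simps)
        then have "z * ((y + 1/2)\<^sup>2 + 1/4) \<le> z * y\<^sup>2" using z by (intro mult_left_mono) auto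
        then have "exp (- 2 * z * y\<^sup>2) \<le> exp (- z / 2 + - 2 * z * (y + 1/2)\<^sup>2)" by (simp add: algebra_simps)
        then have "N 0 y \<le> exp (- z / 2) * N (-1/2) y" unfolding N_eq exp_add by simp
        then show ?thesis using False by (simp add: N_eq add_increasing)
      qed
    qed (simp add: N_eq)
  qed (auto intro!: Bochner_Integration.integrable_add Bochner_Integration.integrable_diff integrable_mult_right N_int intA)
  also have "\<dots> = 2 * exp (- z / 2) * I"
    by (subst Bochner_Integration.integral_add) (auto simp: N_int)
  finally have 3: "I * (1 - 2 * exp (- z / 2)) \<le> G" by (simp add: algebra_simps)
  from that 1 2 3 show ?thesis .
qed

text \<open>Integration by parts: \<open>(1 / z - 4 * y^2) * exp (- 2 * z * y^2)\<close> is the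
  derivative of \<open>y * exp (- 2 * z * y^2) / z\<close>. This reduces the second moment to the
  Gaussian integral and a boundary term.\<close>

lemma saddle_integral_bounds:
  fixes z :: real
  assumes z: "z \<ge> 1"
  defines "I \<equiv> sqrt (pi / (2 * z))"
  obtains J where "((\<lambda>y. (1 - 4 * y\<^sup>2) * exp (- 2 * z * y\<^sup>2)) has_integral J) {-1/2..1/2}"
    "\<bar>J - I * (1 - 1 / z)\<bar> \<le> exp (- z / 2) * (2 * I + 1 / z)"
proof -
  obtain G where G: "((\<lambda>y. exp (- 2 * z * y\<^sup>2)) has_integral G) {-1/2..1/2}" "G \<le> I" "I * (1 - 2 * exp (- z / 2)) \<le> G"
    using gaussian_interval_bounds[of z] z unfolding I_def by auto
  have I0: "I > 0" using z by (simp add: I_def)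
  define F where "F y = y * exp (- 2 * z * y\<^sup>2) / z" for y
  have "((\<lambda>y. (1 / z - 4 * y\<^sup>2) * exp (- 2 * z * y\<^sup>2)) has_integral (F (1/2) - F (-1/2))) {-1/2..1/2}"
  proof (rule fundamental_theorem_of_calculus)
    fix y :: real
    show "(F has_vector_derivative (1 / z - 4 * y\<^sup>2) * exp (- 2 * z * y\<^sup>2)) (at y within {-1/2..1/2})"
      unfolding F_def has_real_derivative_iff_has_vector_derivative [symmetric]
      using z by (auto intro!: derivative_eq_intros simp: field_simps power2_eq_square)
  qed simp
  moreover have "F (1/2) - F (-1/2) = exp (- z / 2) / z" by (simp add: F_def power2_eq_square add_divide_distrib [symmetric])
  ultimately have "((\<lambda>y. (1 / z - 4 * y\<^sup>2) * exp (- 2 * z * y\<^sup>2) + (1 - 1 / z) * exp (- 2 * z * y\<^sup>2)) has_integral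
      (exp (- z / 2) / z + (1 - 1 / z) * G)) {-1/2..1/2}"
    by (intro has_integral_add has_integral_mult_right G) simp
  then have 1: "((\<lambda>y. (1 - 4 * y\<^sup>2) * exp (- 2 * z * y\<^sup>2)) has_integral (exp (- z / 2) / z + (1 - 1 / z) * G)) {-1/2..1/2}"
    by (simp add: algebra_simps)
  have "(1 - 1 / z) * (I - G) \<le> 1 * (2 * exp (- z / 2) * I)"
    using G z by (intro mult_mono) (auto simp: algebra_simps)
  moreover have "0 \<le> (1 - 1 / z) * (I - G)" using G z by (intro mult_nonneg_nonneg) auto
  moreover have "0 \<le> exp (- z / 2) / z" "0 \<le> exp (- z / 2) * I" using z I0 by auto
  moreover have "(exp (- z / 2) / z + (1 - 1 / z) * G) - I * (1 - 1 / z) = exp (- z / 2) / z - (1 - 1 / z) * (I - G)"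
    by (simp add: algebra_simps diff_divide_distrib)
  moreover have "exp (- z / 2) * (2 * I + 1 / z) = 2 * (exp (- z / 2) * I) + exp (- z / 2) / z"
    by (simp add: algebra_simps)
  ultimately have 2: "\<bar>(exp (- z / 2) / z + (1 - 1 / z) * G) - I * (1 - 1 / z)\<bar> \<le> exp (- z / 2) * (2 * I + 1 / z)"
    unfolding abs_le_iff by linarith
  from that 1 2 show ?thesis by blast
qed

text \<open>
  The integral over the chord is moved to the arc of the circle \<open>norm \<tau> = t\<close> through its end
  points, where the exponent is real.  With \<open>y = sin (Arg \<tau> / 2)\<close> as parameter the integrand
  becomes a Gaussian.
\<close>
lemma saddle_chord_integral:
  fixes x :: real
  assumes x: "x > 0"
  defines "t \<equiv> 1 / (2 * x)" and "z \<equiv> pi * x"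
  defines "Q \<equiv> \<lambda>\<tau>. csqrt \<tau> / 2 * exp (of_real pi / (4 * \<tau>) + of_real (pi * x\<^sup>2) * \<tau>)"
  obtains K where "((\<lambda>u. Q (Complex (t / 2) u)) has_integral K) {- (sqrt 3 * t / 2)..sqrt 3 * t / 2}"
    "((\<lambda>y. t * sqrt t * exp z * ((1 - 4 * y\<^sup>2) * exp (- 2 * z * y\<^sup>2))) has_integral Re K) {-1/2..1/2}"
proof -
  define S where "S = {\<tau>. Re \<tau> > 0}"
  have t: "t > 0" using x by (simp add: t_def)
  have S: "open S" "convex S" unfolding S_def by (auto intro: open_halfspace_Re_gt convex_halfspace_Re_gt)
  have "Q holomorphic_on S"
    unfolding Q_def by (intro holomorphic_intros) (auto simp: S_def complex_nonpos_Reals_iff)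
  \<comment> \<open>A primitive on the half-plane replaces contour deformation: both integrals are
    increments of \<open>H\<close> between the same two points.\<close>
  then obtain H where H': "\<And>\<tau>. \<tau> \<in> S \<Longrightarrow> (H has_field_derivative Q \<tau>) (at \<tau> within S)"
    using holomorphic_convex_primitive'[OF S(2,1)] by metis
  then have H: "(H has_field_derivative Q \<tau>) (at \<tau>)" if "Re \<tau> > 0" for \<tau>
    using that at_within_open[OF _ S(1)] by (metis S_def mem_Collect_eq)
  \<comment> \<open>The height at which the line \<open>Re \<tau> = t / 2\<close> meets the circle
    of radius \<open>t\<close>; on the arc this is \<open>y = 1/2\<close>.\<close>
  define b where "b = sqrt 3 * t / 2"
  define K where "K = (H (Complex (t / 2) b) - H (Complex (t / 2) (- b))) / \<i>"
  have b0: "b > 0" using t by (simp add: b_def)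
  have "((\<lambda>u. \<i> * Q (Complex (t / 2) u)) has_integral (H (Complex (t / 2) b) - H (Complex (t / 2) (- b)))) {- b..b}"
  proof (rule fundamental_theorem_of_calculus)
    fix u :: real
    have "((\<lambda>u. Complex (t / 2) u) has_vector_derivative \<i>) (at u within {- b..b})"
      unfolding Complex_eq by (auto intro!: derivative_eq_intros)
    moreover have "(H has_field_derivative Q (Complex (t / 2) u)) (at (Complex (t / 2) u) within (\<lambda>u. Complex (t / 2) u) ` {- b..b})"
      using t by (intro has_field_derivative_at_within[OF H]) simp
    ultimately show "((\<lambda>u. H (Complex (t / 2) u)) has_vector_derivative \<i> * Q (Complex (t / 2) u)) (at u within {- b..b})"
      using field_vector_diff_chain_within[of "\<lambda>u. Complex (t / 2) u" \<i> u "{- b..b}" H] by (simp add: o_def)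
  qed (use b0 in simp)
  then have "((\<lambda>u. (1 / \<i>) * (\<i> * Q (Complex (t / 2) u))) has_integral ((1 / \<i>) * (H (Complex (t / 2) b) - H (Complex (t / 2) (- b))))) {- b..b}"
    by (rule has_integral_mult_right)
  then have 1: "((\<lambda>u. Q (Complex (t / 2) u)) has_integral K) {- b..b}" by (simp add: K_def)

  define w where "w y = of_real (sqrt (1 - y\<^sup>2)) + \<i> * of_real y" for y
  define \<gamma> where "\<gamma> y = of_real t * (w y)\<^sup>2" for y
  have g_eq: "\<gamma> y = Complex (t * (1 - 2 * y\<^sup>2)) (t * (2 * y * sqrt (1 - y\<^sup>2)))" if "y\<^sup>2 \<le> 1" for y
    using that by (simp add: \<gamma>_def w_def complex_eq_iff power2_eq_square algebra_simps)
  \<comment> \<open>Only the imaginary part is followed: \<open>K\<close> is the increment of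
    \<open>H\<close> divided by \<open>\<i>\<close>, and its real part is what approximates the real
    number \<open>2 * pbar n\<close>.\<close>
  have "((\<lambda>y. Im (H (\<gamma> y))) has_real_derivative t * sqrt t * exp z * ((1 - 4 * y\<^sup>2) * exp (- 2 * z * y\<^sup>2))) (at y within {-1/2..1/2})"
    if y: "y \<in> {-1/2..1/2}" for y
  proof -
    have "\<bar>y\<bar> \<le> 1/2" using y by auto
    then have "\<bar>y\<bar>\<^sup>2 \<le> (1/2)\<^sup>2" by (intro power_mono) auto
    then have y2: "y\<^sup>2 \<le> 1/4" by (simp add: power2_eq_square)
    define s where "s = sqrt (1 - y\<^sup>2)"
    have s: "s > 0" "s\<^sup>2 = 1 - y\<^sup>2" using y2 by (auto simp: s_def)
    have w_eq: "w y = Complex s y" by (simp add: w_def s_def complex_eq_iff)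
    have dw: "(w has_vector_derivative (of_real (- y / s) + \<i>)) (at y within {-1/2..1/2})"
    proof -
      have "((\<lambda>y. sqrt (1 - y\<^sup>2)) has_real_derivative - y / s) (at y within {-1/2..1/2})"
        using y2 by (auto intro!: derivative_eq_intros simp: s_def field_simps)
      then have "((\<lambda>y. complex_of_real (sqrt (1 - y\<^sup>2))) has_vector_derivative of_real (- y / s)) (at y within {-1/2..1/2})"
        by (intro has_vector_derivative_of_real) (simp add: has_real_derivative_iff_has_vector_derivative)
      moreover have "((\<lambda>y. \<i> * of_real y) has_vector_derivative \<i>) (at y within {-1/2..1/2})"
        by (auto intro!: derivative_eq_intros)
      ultimately show ?thesis unfolding w_def by (rule has_vector_derivative_add)
    qed
    have dg: "(\<gamma> has_vector_derivative ((of_real (- y / s) + \<i>) * (2 * of_real t * w y))) (at y within {-1/2..1/2})"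
    proof -
      have "((\<lambda>w. of_real t * w\<^sup>2) has_field_derivative 2 * of_real t * w y) (at (w y) within w ` {-1/2..1/2})"
        by (auto intro!: derivative_eq_intros)
      from field_vector_diff_chain_within[OF dw this] show ?thesis by (simp add: o_def \<gamma>_def[abs_def])
    qed
    have Re_g: "Re (\<gamma> y) > 0" using g_eq[of y] y2 t by simp
    have dH: "((H \<circ> \<gamma>) has_vector_derivative ((of_real (- y / s) + \<i>) * (2 * of_real t * w y) * Q (\<gamma> y))) (at y within {-1/2..1/2})"
      by (intro field_vector_diff_chain_within[OF dg] has_field_derivative_at_within[OF H[OF Re_g]])
    have csq: "csqrt (\<gamma> y) = of_real (sqrt t) * w y"
    proof (rule csqrt_unique)
      show "(of_real (sqrt t) * w y)\<^sup>2 = \<gamma> y" using t by (simp add: \<gamma>_def power_mult_distrib flip: of_real_power)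
      show "0 < Re (of_real (sqrt t) * w y) \<or> Re (of_real (sqrt t) * w y) = 0 \<and> 0 \<le> Im (of_real (sqrt t) * w y)"
        using s t by (simp add: w_eq)
    qed
    \<comment> \<open>At the saddle radius both summands have modulus \<open>z / 2\<close>, so on
      the circle they are complex conjugates of each other.\<close>
    have expo: "of_real pi / (4 * \<gamma> y) + of_real (pi * x\<^sup>2) * \<gamma> y = of_real (z * (1 - 2 * y\<^sup>2))"
    proof -
      define v where "v = Complex s (- y)"
      have wv: "w y * v = 1" using s by (simp add: w_eq v_def complex_eq_iff power2_eq_square)
      have w0: "w y \<noteq> 0" using wv by auto
      have "1 / (w y)\<^sup>2 = v\<^sup>2" using wv w0 by (simp add: field_simps flip: power_mult_distrib)
      moreover have "of_real pi / (4 * \<gamma> y) = of_real (pi / (4 * t)) * (1 / (w y)\<^sup>2)"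
        by (simp add: \<gamma>_def)
      ultimately have "of_real pi / (4 * \<gamma> y) = of_real (pi / (4 * t)) * v\<^sup>2" by (simp only:)
      also have "pi / (4 * t) = z / 2" using x by (simp add: t_def z_def)
      finally have "of_real pi / (4 * \<gamma> y) + of_real (pi * x\<^sup>2) * \<gamma> y = of_real (z / 2) * v\<^sup>2 + of_real (pi * x\<^sup>2 * t) * (w y)\<^sup>2"
        by (simp add: \<gamma>_def)
      also have "pi * x\<^sup>2 * t = z / 2" using x by (simp add: t_def z_def power2_eq_square)
      also have "of_real (z / 2) * v\<^sup>2 + of_real (z / 2) * (w y)\<^sup>2 = of_real (z * (s\<^sup>2 - y\<^sup>2))"
        by (simp add: w_eq v_def complex_eq_iff power2_eq_square algebra_simps)
      also have "s\<^sup>2 - y\<^sup>2 = 1 - 2 * y\<^sup>2" using s by simp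
      finally show ?thesis .
    qed
    have Qg: "Q (\<gamma> y) = of_real (sqrt t / 2 * exp (z * (1 - 2 * y\<^sup>2))) * w y"
      unfolding Q_def csq expo exp_of_real by (simp add: mult_ac)
    have "(of_real (- y / s) + \<i>) * (2 * of_real t * w y) * Q (\<gamma> y) =
       of_real (t * sqrt t * exp (z * (1 - 2 * y\<^sup>2)) / s) * (Complex (- y) s * (Complex s y)\<^sup>2)"
    proof -
      have "of_real (- y / s) + \<i> = of_real (1 / s) * Complex (- y) s" using s by (simp add: complex_eq_iff)
      then show ?thesis unfolding Qg w_eq by (simp add: power2_eq_square)
    qed
    also have "Im \<dots> = t * sqrt t * exp (z * (1 - 2 * y\<^sup>2)) / s * (s * (s\<^sup>2 - 3 * y\<^sup>2))"
    proof -
      have "Im (Complex (- y) s * (Complex s y)\<^sup>2) = s * (s\<^sup>2 - 3 * y\<^sup>2)"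
        by (simp add: power2_eq_square algebra_simps)
      moreover have "Im (of_real c * v) = c * Im v" for c v by simp
      ultimately show ?thesis by (simp only:)
    qed
    also have "\<dots> = t * sqrt t * exp (z * (1 - 2 * y\<^sup>2)) * (1 - 4 * y\<^sup>2)"
      using s by simp
    also have "exp (z * (1 - 2 * y\<^sup>2)) = exp z * exp (- 2 * z * y\<^sup>2)" by (simp add: algebra_simps flip: exp_add)
    finally have Im_eq: "Im ((of_real (- y / s) + \<i>) * (2 * of_real t * w y) * Q (\<gamma> y)) =
       t * sqrt t * exp z * ((1 - 4 * y\<^sup>2) * exp (- 2 * z * y\<^sup>2))" by (simp only: mult_ac)
    have "((\<lambda>y. Im ((H \<circ> \<gamma>) y)) has_vector_derivative Im ((of_real (- y / s) + \<i>) * (2 * of_real t * w y) * Q (\<gamma> y))) (at y within {-1/2..1/2})"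
      using bounded_linear.has_vector_derivative[OF bounded_linear_Im dH] by simp
    then show ?thesis unfolding Im_eq has_real_derivative_iff_has_vector_derivative by simp
  qed
  then have "((\<lambda>y. t * sqrt t * exp z * ((1 - 4 * y\<^sup>2) * exp (- 2 * z * y\<^sup>2))) has_integral (Im (H (\<gamma> (1/2))) - Im (H (\<gamma> (-1/2))))) {-1/2..1/2}"
    by (intro fundamental_theorem_of_calculus) (auto simp: has_real_derivative_iff_has_vector_derivative)
  moreover have "\<gamma> (1/2) = Complex (t / 2) b" "\<gamma> (-1/2) = Complex (t / 2) (- b)"
  proof -
    have "sqrt (1 - (1/2)\<^sup>2) = sqrt 3 / 2"
      by (simp add: power2_eq_square real_sqrt_divide)
    moreover have "sqrt (1 - (-1/2)\<^sup>2) = sqrt 3 / 2"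
      by (simp add: power2_eq_square real_sqrt_divide)
    ultimately show "\<gamma> (1/2) = Complex (t / 2) b" "\<gamma> (-1/2) = Complex (t / 2) (- b)"
      by (subst g_eq; simp add: b_def power2_eq_square)+
  qed
  moreover have "Re K = Im (H (Complex (t / 2) b)) - Im (H (Complex (t / 2) (- b)))"
    by (simp add: K_def Re_divide)
  ultimately have 2: "((\<lambda>y. t * sqrt t * exp z * ((1 - 4 * y\<^sup>2) * exp (- 2 * z * y\<^sup>2))) has_integral Re K) {-1/2..1/2}"
    by simp
  from that 1 2 show ?thesis by (simp add: b_def)
qed

section \<open>Error estimates along the line of integration\<close>

lemma exp_minus_3_le: "exp (- 3 :: real) \<le> 1 / 4"
proof -
  have "(4::real) \<le> exp 3" using exp_ge_add_one_self[of "3::real"] by simp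
  then have "inverse (exp 3) \<le> inverse (4::real)" by (intro le_imp_inverse_le) auto
  then show ?thesis by (simp add: exp_minus)
qed

lemma pi_bounds: "3 < pi" "pi < (3.142 :: real)"
  using pi_approx by simp_all

text \<open>The square of the distance is \<open>(1 - r)^2 + 4 * r * (sin (pi * u / 2))^2\<close>
  with \<open>r = norm q\<close>, and Jordan's inequality bounds the sine below by
  \<open>\<bar>u\<bar>\<close>.\<close>

lemma norm_one_minus_exp_ge:
  fixes u t0 :: real
  assumes u: "\<bar>u\<bar> \<le> 1"
  defines "q \<equiv> exp (- of_real pi * Complex t0 u)"
  shows "4 * norm q * u\<^sup>2 \<le> (norm (1 - q))\<^sup>2"
proof -
  define r where "r = norm q"
  have r: "r = exp (- pi * t0)" by (simp add: r_def q_def norm_exp_eq_Re)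
  have q: "q = of_real r * cis (- (pi * u))"
    unfolding q_def r by (simp add: exp_eq_polar)
  have "(norm (1 - q))\<^sup>2 = 1 - 2 * r * cos (pi * u) + r\<^sup>2 * ((cos (pi * u))\<^sup>2 + (sin (pi * u))\<^sup>2)"
    unfolding cmod_power2 q by (simp add: power2_eq_square algebra_simps del: sin_cos_squared_add sin_cos_squared_add2 sin_cos_squared_add3)
  also have "\<dots> = (1 - r)\<^sup>2 + 2 * r * (1 - cos (pi * u))"
    by (simp only: sin_cos_squared_add2) (simp add: power2_eq_square algebra_simps)
  also have "1 - cos (pi * u) = 2 * (sin (pi * \<bar>u\<bar> / 2))\<^sup>2"
  proof -
    have "cos (pi * u) = cos (2 * (pi * \<bar>u\<bar> / 2))" by (cases "u \<ge> 0") auto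
    then show ?thesis by (simp only: cos_double_sin)
  qed
  finally have eq: "(norm (1 - q))\<^sup>2 = (1 - r)\<^sup>2 + 4 * r * (sin (pi * \<bar>u\<bar> / 2))\<^sup>2" by simp
  have "\<bar>u\<bar> \<le> sin (pi * \<bar>u\<bar> / 2)"
    using jordan_sin_ge[of "pi * \<bar>u\<bar> / 2"] u by (simp add: mult_left_le)
  then have "\<bar>u\<bar>\<^sup>2 \<le> (sin (pi * \<bar>u\<bar> / 2))\<^sup>2" by (rule power_mono) simp
  then have "4 * r * u\<^sup>2 \<le> 4 * r * (sin (pi * \<bar>u\<bar> / 2))\<^sup>2"
    using r by (intro mult_left_mono) auto
  then show ?thesis using eq by (simp add: r_def add_increasing)
qed

text \<open>
  The three zones of the circle: on the chord the modular transformation is almost exact, next to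
  it the modular transformation bounds the generating function, and further out the product does.
\<close>
lemma circle_error_bound:
  fixes x u :: real
  assumes x: "x \<ge> 14" and u: "\<bar>u\<bar> \<le> 1"
  defines "t0 \<equiv> 1 / (4 * x)" and "z \<equiv> pi * x"
  defines "\<tau> \<equiv> Complex t0 u"
  defines "Q \<equiv> csqrt \<tau> / 2 * exp (of_real pi / (4 * \<tau>) + of_real (pi * x\<^sup>2) * \<tau>)"
  shows "norm (eval_fps pbar_fps (exp (- of_real pi * \<tau>)) * exp (of_real (pi * x\<^sup>2) * \<tau>) -
           (if \<bar>u\<bar> \<le> sqrt 3 * t0 then Q else 0)) \<le> 3 / 4 * exp (z / 2)"
proof -
  have t0: "t0 > 0" "t0 \<le> 1 / 56" using x by (auto simp: t0_def divide_simps)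
  have z: "z \<ge> 42" using mult_mono[of 3 pi 14 x] x pi_bounds by (simp add: z_def)
  define R where "R = Re (1 / \<tau>)"
  have R: "R = t0 / (t0\<^sup>2 + u\<^sup>2)" by (simp add: R_def \<tau>_def Re_divide)
  have \<tau>: "Re \<tau> > 0" using t0 by (simp add: \<tau>_def)
  define S where "S = eval_fps psi_fps (exp (- of_real pi / \<tau>))"
  define A where "A = eval_fps pbar_fps (exp (- of_real pi * \<tau>))"
  have A: "A = csqrt \<tau> / 2 * exp (of_real pi / (4 * \<tau>)) * (1 / S)"
    unfolding A_def S_def by (rule pbar_modular[OF \<tau>])
  have AQ: "A * exp (of_real (pi * x\<^sup>2) * \<tau>) = Q * (1 / S)"
    unfolding A Q_def exp_add by (simp add: mult_ac)
  have t0x: "pi * x\<^sup>2 * t0 = z / 4" using x by (simp add: t0_def z_def power2_eq_square)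
  have norm_exp2: "norm (exp (of_real (pi * x\<^sup>2) * \<tau>)) = exp (z / 4)"
    by (simp add: norm_exp_eq_Re \<tau>_def t0x)
  have Re14: "Re (of_real pi / (4 * \<tau>)) = pi * R / 4"
    by (simp add: R_def Re_divide power2_eq_square divide_simps)
  have nQ: "norm Q = sqrt (norm \<tau>) / 2 * exp (pi * R / 4 + z / 4)"
    unfolding Q_def exp_add norm_mult norm_divide norm_csqrt norm_exp2
    by (simp add: norm_exp_eq_Re Re14 exp_add)
  have W: "(norm (exp (- of_real pi / \<tau>)))\<^sup>2 = exp (- 2 * pi * R)"
  proof -
    have "Re (- of_real pi / \<tau>) = - pi * R" by (simp add: R_def Re_divide)
    then show ?thesis by (simp add: norm_exp_eq_Re flip: exp_double)
  qed
  have W14: "(norm (exp (- of_real pi / \<tau>)))\<^sup>2 \<le> 1 / 4" if "3 \<le> 2 * pi * R"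
  proof -
    have "exp (- 2 * pi * R) \<le> exp (- 3)" using that by simp
    then show ?thesis unfolding W using exp_minus_3_le by (rule order_trans)
  qed
  have norm_tau: "(norm \<tau>)\<^sup>2 = t0\<^sup>2 + u\<^sup>2" by (simp add: \<tau>_def cmod_power2)
  have z_exp: "1 \<le> 3 / 4 * exp (z / 2)"
    using exp_ge_add_one_self[of "z / 2"] z by linarith
  have t0sq: "t0\<^sup>2 \<le> (1 / 56)\<^sup>2" using t0 by (intro power_mono) auto
  \<comment> \<open>The cut at \<open>10 * t0\<close> is a compromise: up to it
    \<open>2 * pi * R \<ge> 3\<close> keeps the psi series away from 0, and beyond it
    \<open>\<eta>\<close> is small enough for the product bound.\<close>
  consider "\<bar>u\<bar> \<le> sqrt 3 * t0" | "\<bar>u\<bar> > sqrt 3 * t0" "\<bar>u\<bar> \<le> 10 * t0" | "\<bar>u\<bar> > sqrt 3 * t0" "\<bar>u\<bar> > 10 * t0" by linarith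
  then show ?thesis
  proof cases
    case 1
    have "\<bar>u\<bar>\<^sup>2 \<le> (sqrt 3 * t0)\<^sup>2" using 1 by (intro power_mono) auto
    then have u2: "u\<^sup>2 \<le> 3 * t0\<^sup>2" by (simp add: power_mult_distrib)
    have "t0 / (4 * t0\<^sup>2) \<le> R" unfolding R using u2 t0 by (intro divide_left_mono) (auto intro!: mult_pos_pos add_pos_nonneg)
    then have R_ge: "x \<le> R" using x by (simp add: t0_def power2_eq_square)
    have piR: "z \<le> pi * R" unfolding z_def using R_ge by (intro mult_left_mono) auto
    have nt: "norm \<tau> \<le> 1"
    proof (rule power2_le_imp_le)
      have "t0\<^sup>2 + u\<^sup>2 \<le> 4 * t0\<^sup>2" using u2 by simp
      also have "\<dots> \<le> 4 * (1 / 56)\<^sup>2" using t0sq by simp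
      finally show "(norm \<tau>)\<^sup>2 \<le> 1\<^sup>2" unfolding norm_tau by (simp add: power2_eq_square)
    qed simp
    have w: "(norm (exp (- of_real pi / \<tau>)))\<^sup>2 \<le> 1 / 4" by (rule W14) (use piR z in simp)
    have "norm (A * exp (of_real (pi * x\<^sup>2) * \<tau>) - Q) = norm Q * norm (1 / S - 1)"
      unfolding AQ norm_mult [symmetric] by (simp add: algebra_simps)
    also have "\<dots> \<le> (1 / 2 * exp (pi * R / 4 + z / 4)) * (2 * exp (- 2 * pi * R))"
    proof (rule mult_mono)
      show "norm Q \<le> 1 / 2 * exp (pi * R / 4 + z / 4)" unfolding nQ using nt by (intro mult_right_mono) auto
      show "norm (1 / S - 1) \<le> 2 * exp (- 2 * pi * R)"
        using psi_inverse_bounds(2)[OF w] unfolding W S_def .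
    qed auto
    also have "\<dots> = exp (z / 4 - 7 / 4 * (pi * R))" by (simp flip: exp_add)
    also have "\<dots> \<le> exp 0" using piR z by (subst exp_le_cancel_iff) linarith
    finally show ?thesis using 1 z_exp by (simp add: A_def)
  next
    case 2
    have "(sqrt 3 * t0)\<^sup>2 \<le> \<bar>u\<bar>\<^sup>2" using 2 t0 by (intro power_mono) auto
    then have u2: "3 * t0\<^sup>2 \<le> u\<^sup>2" by (simp add: power_mult_distrib)
    have "\<bar>u\<bar>\<^sup>2 \<le> (10 * t0)\<^sup>2" using 2 by (intro power_mono) auto
    then have u2': "u\<^sup>2 \<le> 100 * t0\<^sup>2" by (simp add: power_mult_distrib)
    have "R \<le> t0 / (4 * t0\<^sup>2)" unfolding R using u2 t0 by (intro divide_left_mono) (auto intro!: mult_pos_pos add_pos_nonneg)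
    then have R_le: "R \<le> x" using x by (simp add: t0_def power2_eq_square)
    have "t0 / (101 * t0\<^sup>2) \<le> R" unfolding R using u2' t0 by (intro divide_left_mono) (auto intro!: mult_pos_pos add_pos_nonneg)
    then have R_ge: "4 * x / 101 \<le> R" using x by (simp add: t0_def power2_eq_square)
    have piR: "pi * R \<le> z" unfolding z_def using R_le by (intro mult_left_mono) auto
    have nt: "norm \<tau> \<le> 1"
    proof (rule power2_le_imp_le)
      have "t0\<^sup>2 + u\<^sup>2 \<le> 101 * t0\<^sup>2" using u2' by simp
      also have "\<dots> \<le> 101 * (1 / 56)\<^sup>2" using t0sq by simp
      finally show "(norm \<tau>)\<^sup>2 \<le> 1\<^sup>2" unfolding norm_tau by (simp add: power2_eq_square)
    qed simp
    have "3 * (56 / 101) \<le> pi * R" using R_ge x pi_bounds by (intro mult_mono) auto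
    then have w: "(norm (exp (- of_real pi / \<tau>)))\<^sup>2 \<le> 1 / 4" by (intro W14) simp
    have "norm (A * exp (of_real (pi * x\<^sup>2) * \<tau>)) = norm Q * norm (1 / S)"
      unfolding AQ norm_mult ..
    also have "\<dots> \<le> (1 / 2 * exp (z / 2)) * (3 / 2)"
    proof (rule mult_mono)
      have "exp (pi * R / 4 + z / 4) \<le> exp (z / 2)" using piR by (subst exp_le_cancel_iff) linarith
      then show "norm Q \<le> 1 / 2 * exp (z / 2)" unfolding nQ using nt by (intro mult_mono) auto
      show "norm (1 / S) \<le> 3 / 2"
        using psi_inverse_bounds(1)[OF w] unfolding S_def .
    qed auto
    finally show ?thesis using 2 by (simp add: A_def)
  next
    case 3
    define q where "q = exp (- of_real pi * \<tau>)"
    define r where "r = norm q"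
    define s where "s = pi * t0"
    have "s \<le> 3.142 * (1 / 56)" unfolding s_def using t0 pi_bounds by (intro mult_mono) auto
    then have s: "0 < s" "s \<le> 0.0562" using t0 by (auto simp: s_def)
    have r_eq: "r = exp (- s)" by (simp add: r_def q_def norm_exp_eq_Re \<tau>_def s_def)
    have r1: "1 - s \<le> r" using exp_ge_add_one_self[of "- s"] by (simp add: r_eq)
    have r01: "0 < r" "r < 1" using s by (auto simp: r_eq)
    have q1: "norm q < 1" using r01 by (simp add: r_def)
    have P: "norm (eval_fps pbar_fps (of_real r)) \<le> 3 / 4 * exp z"
    proof -
      have e: "complex_of_real r = exp (- of_real pi * of_real t0)"
        by (simp add: r_eq s_def flip: exp_of_real)
      have R0: "Re (- of_real pi / complex_of_real t0) = - pi * (4 * x)" using x by (simp add: t0_def)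
      have "(norm (exp (- of_real pi / complex_of_real t0)))\<^sup>2 = exp (- 2 * (pi * (4 * x)))"
        by (simp only: norm_exp_eq_Re R0) (simp flip: exp_double)
      also have "\<dots> \<le> exp (- 3)" using z by (simp add: z_def)
      finally have w: "(norm (exp (- of_real pi / complex_of_real t0)))\<^sup>2 \<le> 1 / 4" using exp_minus_3_le by (rule order_trans)
      have "norm (eval_fps pbar_fps (of_real r)) =
         norm (csqrt (of_real t0)) / 2 * norm (exp (of_real pi / (4 * complex_of_real t0))) * norm (1 / eval_fps psi_fps (exp (- of_real pi / complex_of_real t0)))"
        unfolding e by (subst pbar_modular) (use t0 in \<open>simp_all add: norm_mult norm_divide\<close>)
      also have "\<dots> \<le> 1 / 2 * exp z * (3 / 2)"
      proof (intro mult_mono)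
        have "sqrt t0 \<le> 1" using t0 by simp
        then show "norm (csqrt (of_real t0)) / 2 \<le> 1 / 2" using t0 by simp
        have "complex_of_real pi / (4 * of_real t0) = of_real z" using x by (simp add: t0_def z_def)
        then show "norm (exp (of_real pi / (4 * complex_of_real t0))) \<le> exp z"
          by (simp add: norm_exp_eq_Re)
        show "norm (1 / eval_fps psi_fps (exp (- of_real pi / complex_of_real t0))) \<le> 3 / 2"
          by (rule psi_inverse_bounds(1)[OF w])
      qed auto
      finally show ?thesis by simp
    qed
    define \<eta> where "\<eta> = (1 - r)\<^sup>2 / (norm (1 - q))\<^sup>2"
    have \<eta>: "\<eta> \<le> 0.04"
    proof -
      have "(10 * t0)\<^sup>2 \<le> \<bar>u\<bar>\<^sup>2" using 3 t0 by (intro power_mono) auto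
      then have u2: "100 * t0\<^sup>2 \<le> u\<^sup>2" by (simp add: power_mult_distrib)
      have "4 * r * (100 * t0\<^sup>2) \<le> 4 * r * u\<^sup>2" using u2 r01 by (intro mult_left_mono) auto
      also have "\<dots> \<le> (norm (1 - q))\<^sup>2"
        using norm_one_minus_exp_ge[OF u, of t0] by (simp add: r_def q_def \<tau>_def)
      finally have d: "400 * r * t0\<^sup>2 \<le> (norm (1 - q))\<^sup>2" by simp
      have "(1 - r)\<^sup>2 \<le> s\<^sup>2" using r1 r01 by (intro power_mono) auto
      then have "\<eta> \<le> s\<^sup>2 / (400 * r * t0\<^sup>2)"
        unfolding \<eta>_def using d r01 t0 by (intro frac_le) auto
      also have "\<dots> = pi\<^sup>2 / (400 * r)" using t0 by (simp add: s_def power_mult_distrib)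
      also have "\<dots> \<le> 9.88 / (400 * 0.94)"
      proof (intro frac_le)
        have "pi\<^sup>2 \<le> 3.142\<^sup>2" using pi_bounds by (intro power_mono) auto
        then show "pi\<^sup>2 \<le> 9.88" by (simp add: power2_eq_square)
      qed (use r1 s in auto)
      finally show ?thesis by simp
    qed
    \<comment> \<open>At \<open>norm q\<close> the generating function has size
      \<open>exp z\<close>, and the factor \<open>exp (z / 4)\<close> comes on top, so a saving of
      \<open>3 / 4 * z\<close> is required. The available \<open>8 * x / pi\<close> is about
      \<open>0.81 * z\<close>, which leaves little room; the subtracted 1 is absorbed as
      \<open>x / 14\<close>.\<close>
    have E: "3 / 4 * z \<le> (1 + r) / (1 - r) * (1 - \<eta>)"
    proof -
      have "2 / s - 1 \<le> 2 / (1 - r) - 1" using r1 r01 s by (intro diff_right_mono divide_left_mono) auto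
      also have "\<dots> = (1 + r) / (1 - r)" using r01 by (simp add: field_simps)
      finally have 1: "2 / s - 1 \<le> (1 + r) / (1 - r)" .
      have 2: "2 / s = 8 * x / pi" using x by (simp add: s_def t0_def)
      have 3: "8 * x / 3.142 \<le> 8 * x / pi" using pi_bounds x by (intro divide_left_mono) auto
      have "8 * x / 3.142 - x / 14 \<le> (1 + r) / (1 - r)" using 1 3 x unfolding 2 by linarith
      then have "(8 * x / 3.142 - x / 14) * 0.96 \<le> (1 + r) / (1 - r) * (1 - \<eta>)"
        using \<eta> x r01 by (intro mult_mono) auto
      moreover have "3 / 4 * z \<le> 3 / 4 * (3.142 * x)" unfolding z_def using pi_bounds x by (intro mult_left_mono mult_right_mono) auto
      moreover have "3 / 4 * (3.142 * x) \<le> (8 * x / 3.142 - x / 14) * 0.96" using x by simp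
      ultimately show ?thesis by linarith
    qed
    have "norm A \<le> norm (eval_fps pbar_fps (of_real r)) * exp (- ((1 + r) / (1 - r) * (1 - \<eta>)))"
      unfolding A_def r_def \<eta>_def q_def [symmetric] by (rule norm_pbar_le[OF q1])
    also have "\<dots> \<le> 3 / 4 * exp z * exp (- (3 / 4 * z))"
      using P E by (intro mult_mono) auto
    finally have "norm (A * exp (of_real (pi * x\<^sup>2) * \<tau>)) \<le> 3 / 4 * exp z * exp (- (3 / 4 * z)) * exp (z / 4)"
      unfolding norm_mult norm_exp2 by (intro mult_right_mono) auto
    also have "\<dots> = 3 / 4 * exp (z / 2)" by (simp add: mult.assoc flip: exp_add)
    finally show ?thesis using 3 by (simp add: A_def)
  qed
qed

text \<open>The growing exponential part of the first term of Zuckerman's series, the derivative of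
  \<open>sinh (pi * sqrt n) / sqrt n\<close> divided by \<open>2 * pi\<close>. The argument is real
  so that second differences can be treated by calculus.\<close>

definition pbar_main :: "real \<Rightarrow> real" where
  "pbar_main n = exp (pi * sqrt n) / (8 * n) * (1 - 1 / (pi * sqrt n))"

text \<open>For \<open>2 * pbar n\<close> the pointwise error 3/4 over a segment of length 2
  contributes 3/2, and the truncated Gaussian contributes at most 1/2; halving the sum gives the
  constant 1.\<close>

theorem pbar_asymptotic:
  assumes n: "n \<ge> 196"
  shows "\<bar>real (pbar n) - pbar_main (real n)\<bar> \<le> exp (pi * sqrt (real n) / 2)"
proof -
  define x where "x = sqrt (real n)"
  have x2: "x\<^sup>2 = real n" by (simp add: x_def)
  have "sqrt 196 \<le> x" unfolding x_def using n by (intro real_sqrt_le_mono) simp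
  moreover have "sqrt 196 = 14" by (rule real_sqrt_unique) auto
  ultimately have x: "x \<ge> 14" by simp
  define z where "z = pi * x"
  define t where "t = 1 / (2 * x)"
  have t: "t > 0" "t \<le> 1 / 28" using x by (auto simp: t_def divide_simps)
  have z: "z \<ge> 42" using mult_mono[of 3 pi 14 x] x pi_bounds by (simp add: z_def)
  define Q where "Q \<tau> = csqrt \<tau> / 2 * exp (of_real pi / (4 * \<tau>) + of_real (pi * x\<^sup>2) * \<tau>)" for \<tau>
  obtain K where K: "((\<lambda>u. Q (Complex (t / 2) u)) has_integral K) {- (sqrt 3 * t / 2)..sqrt 3 * t / 2}"
    "((\<lambda>y. t * sqrt t * exp z * ((1 - 4 * y\<^sup>2) * exp (- 2 * z * y\<^sup>2))) has_integral Re K) {-1/2..1/2}"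
    using saddle_chord_integral[of x] x unfolding Q_def t_def z_def by auto
  define D where "D u = eval_fps pbar_fps (exp (- of_real pi * Complex (t / 2) u)) * exp (of_real (pi * x\<^sup>2) * Complex (t / 2) u) -
    (if u \<in> {- (sqrt 3 * t / 2)..sqrt 3 * t / 2} then Q (Complex (t / 2) u) else 0)" for u
  have "sqrt 3 * t / 2 \<le> 1"
  proof -
    have "sqrt 3 \<le> 2" by (intro real_le_lsqrt) auto
    then have "sqrt 3 * t \<le> 2 * (1 / 28)" using t by (intro mult_mono) auto
    then show ?thesis by simp
  qed
  then have sub: "{- (sqrt 3 * t / 2)..sqrt 3 * t / 2} \<subseteq> {-1..1}" by auto
  have "(D has_integral (2 * of_nat (pbar n) - K)) {-1..1}"
    unfolding D_def
  proof (rule has_integral_diff)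
    show "((\<lambda>u. eval_fps pbar_fps (exp (- of_real pi * Complex (t / 2) u)) * exp (of_real (pi * x\<^sup>2) * Complex (t / 2) u))
       has_integral 2 * of_nat (pbar n)) {-1..1}"
      unfolding x2 by (rule pbar_has_integral) (use t in simp)
    show "((\<lambda>u. if u \<in> {- (sqrt 3 * t / 2)..sqrt 3 * t / 2} then Q (Complex (t / 2) u) else 0) has_integral K) {-1..1}"
      by (rule has_integral_restrict[OF sub, THEN iffD2, OF K(1)])
  qed
  then have "norm (2 * of_nat (pbar n) - K) \<le> 3 / 4 * exp (z / 2) * measure lborel (cbox (-1) (1::real))"
  proof (intro has_integral_bound)
    fix u :: real assume "u \<in> cbox (-1) 1"
    then have u: "\<bar>u\<bar> \<le> 1" by auto
    have t2: "t / 2 = 1 / (4 * x)" by (simp add: t_def)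
    have "(u \<in> {- (sqrt 3 * t / 2)..sqrt 3 * t / 2}) = (\<bar>u\<bar> \<le> sqrt 3 * (1 / (4 * x)))"
      unfolding t2 [symmetric] by auto
    then show "norm (D u) \<le> 3 / 4 * exp (z / 2)"
      using circle_error_bound[OF x u] unfolding D_def Q_def z_def t2 by simp
  qed auto
  then have 1: "norm (2 * of_nat (pbar n) - K) \<le> 3 / 2 * exp (z / 2)" by simp
  have "\<bar>Re (2 * of_nat (pbar n) - K)\<bar> \<le> norm (2 * of_nat (pbar n) - K)" by (rule abs_Re_le_cmod)
  then have 2: "\<bar>2 * real (pbar n) - Re K\<bar> \<le> 3 / 2 * exp (z / 2)" using 1 by simp
  define I where "I = sqrt (pi / (2 * z))"
  have I: "I = sqrt t" using x by (simp add: I_def z_def t_def)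
  obtain J where J: "((\<lambda>y. (1 - 4 * y\<^sup>2) * exp (- 2 * z * y\<^sup>2)) has_integral J) {-1/2..1/2}"
    "\<bar>J - I * (1 - 1 / z)\<bar> \<le> exp (- z / 2) * (2 * I + 1 / z)"
    using saddle_integral_bounds[of z] z unfolding I_def by auto
  have RK: "Re K = t * sqrt t * exp z * J"
    using has_integral_unique[OF K(2) has_integral_mult_right[OF J(1)]] by simp
  have M: "t * sqrt t * exp z * (I * (1 - 1 / z)) = 2 * pbar_main (real n)"
  proof -
    have "t * sqrt t * exp z * (I * (1 - 1 / z)) = t\<^sup>2 * exp z * (1 - 1 / z)"
      using t by (simp add: I power2_eq_square)
    also have "t\<^sup>2 = 1 / (4 * real n)" by (simp add: t_def power_divide power_mult_distrib x2)
    finally show ?thesis by (simp add: pbar_main_def z_def x_def)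
  qed
  have "\<bar>Re K - 2 * pbar_main (real n)\<bar> = \<bar>t * sqrt t * exp z * (J - I * (1 - 1 / z))\<bar>"
    unfolding RK M [symmetric] by (simp only: right_diff_distrib)
  also have "\<dots> = t * sqrt t * exp z * \<bar>J - I * (1 - 1 / z)\<bar>"
    using t by (simp add: abs_mult)
  also have "\<dots> \<le> t * sqrt t * exp z * (exp (- z / 2) * (2 * I + 1 / z))"
    using J t by (intro mult_left_mono) auto
  also have "\<dots> = t * sqrt t * (2 * I + 1 / z) * exp (z / 2)"
  proof -
    have "exp z * exp (- z / 2) = exp (z / 2)" by (simp flip: exp_add)
    then show ?thesis by (simp add: mult_ac)
  qed
  also have "\<dots> \<le> 1 / 2 * exp (z / 2)"
  proof (rule mult_right_mono)
    have "sqrt t \<le> 1" using t by simp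
    moreover have "1 / z \<le> 1" using z by simp
    ultimately have "t * sqrt t * (2 * I + 1 / z) \<le> (1 / 28) * 1 * (2 * 1 + 1)"
      using t z by (intro mult_mono add_mono) (auto simp: I)
    then show "t * sqrt t * (2 * I + 1 / z) \<le> 1 / 2" by (rule order_trans) simp
  qed simp
  finally have "\<bar>Re K - 2 * pbar_main (real n)\<bar> \<le> 1 / 2 * exp (z / 2)" .
  with 2 have "\<bar>real (pbar n) - pbar_main (real n)\<bar> \<le> exp (z / 2)" by linarith
  then show ?thesis by (simp add: z_def x_def)
qed

section \<open>Large arguments\<close>

text \<open>The function \<open>m * x^2 / 2 - f x\<close> is convex, and the second difference of
  \<open>m * x^2 / 2\<close> is exactly \<open>m\<close>; it remains to compare the value at
  \<open>a\<close> with the mean at the end points.\<close>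

lemma second_difference_le:
  fixes f :: "real \<Rightarrow> real"
  assumes f': "\<And>x. x \<in> {a - 1..a + 1} \<Longrightarrow> (f has_real_derivative f' x) (at x)"
    and f'': "\<And>x. x \<in> {a - 1..a + 1} \<Longrightarrow> (f' has_real_derivative f'' x) (at x)"
    and le: "\<And>x. x \<in> {a - 1..a + 1} \<Longrightarrow> f'' x \<le> m"
  shows "f (a + 1) + f (a - 1) - 2 * f a \<le> m"
proof -
  define g where "g x = m * x\<^sup>2 / 2 - f x" for x
  have "convex_on {a - 1..a + 1} g"
  proof (rule f''_ge0_imp_convex)
    fix x assume x: "x \<in> {a - 1..a + 1}"
    show "(g has_real_derivative (m * x - f' x)) (at x)"
      unfolding g_def by (auto intro!: derivative_eq_intros f' x)
    show "((\<lambda>x. m * x - f' x) has_real_derivative (m - f'' x)) (at x)"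
      by (auto intro!: derivative_eq_intros f'' x)
    show "0 \<le> m - f'' x" using le[OF x] by simp
  qed simp
  then have "g ((1 - 1 / 2) *\<^sub>R (a - 1) + (1 / 2) *\<^sub>R (a + 1)) \<le> (1 - 1 / 2) * g (a - 1) + 1 / 2 * g (a + 1)"
    by (rule convex_onD) auto
  moreover have "(1 - 1 / 2) *\<^sub>R (a - 1) + (1 / 2) *\<^sub>R (a + 1) = a"
    by (simp add: field_simps)
  ultimately have "g a \<le> 1 / 2 * g (a - 1) + 1 / 2 * g (a + 1)" by simp
  then show ?thesis by (simp add: g_def power2_eq_square field_simps)
qed

lemma ln_pbar_main_div_second_difference:
  fixes a :: real
  assumes a: "a \<ge> 197"
  defines "F \<equiv> \<lambda>x. ln (pbar_main x) / x"
  shows "F (a + 1) + F (a - 1) - 2 * F a \<le> 3 * pi / 4 * (a - 1) powr (- 5 / 2) - 11 / (a + 1) ^ 3"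
proof -
  \<comment> \<open>The correction \<open>1 / (pi * sqrt x)\<close>, written as a power so that its
    derivative is again a multiple of itself.\<close>
  define w where "w x = x powr (- 1 / 2) / pi" for x
  define f where "f x = pi * x powr (- 1 / 2) - ln (8 * x) / x + ln (1 - w x) / x" for x
  define f' where "f' x = - pi / 2 * x powr (- 3 / 2) - (1 - ln (8 * x)) / x\<^sup>2 + (w x / (1 - w x) / (2 * x\<^sup>2) - ln (1 - w x) / x\<^sup>2)" for x
  define h'' where "h'' x = - (w x / (1 - w x)\<^sup>2 / (4 * x ^ 3)) - w x / (1 - w x) / x ^ 3 - w x / (1 - w x) / (2 * x ^ 3) + 2 * ln (1 - w x) / x ^ 3" for x
  define f'' where "f'' x = 3 * pi / 4 * x powr (- 5 / 2) - (2 * ln (8 * x) - 3) / x ^ 3 + h'' x" for x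
  have w: "0 < w x" "w x < 1" if "x > 1" for x
  proof -
    have "x powr (- 1 / 2) < 1" using that powr_less_one[of x "- 1 / 2"] by simp
    then show "w x < 1" using pi_bounds by (simp add: w_def)
    show "0 < w x" using that by (simp add: w_def)
  qed
  have w': "(w has_real_derivative - w x / (2 * x)) (at x)" if "x > 1" for x
  proof -
    have "x powr (- 1 / 2 - 1) = x powr (- 1 / 2) / x" using that by (subst powr_diff) simp
    then show ?thesis unfolding w_def using that by (auto intro!: derivative_eq_intros)
  qed
  have lnw': "((\<lambda>x. ln (1 - w x)) has_real_derivative w x / (1 - w x) / (2 * x)) (at x)" if "x > 1" for x
    using w[OF that] that by (auto intro!: derivative_eq_intros w' simp: field_simps)
  have ww': "((\<lambda>x. w x / (1 - w x)) has_real_derivative - (w x / (1 - w x)\<^sup>2 / (2 * x))) (at x)" if "x > 1" for x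
    using w[OF that] that by (auto intro!: derivative_eq_intros w' simp: field_simps power2_eq_square)
  have F_eq: "F x = f x" if "x > 1" for x
  proof -
    have 1: "x powr (- 1 / 2) = 1 / sqrt x" using that by (simp add: powr_minus powr_half_sqrt inverse_eq_divide)
    have 2: "1 - 1 / (pi * sqrt x) = 1 - w x" unfolding w_def 1 by simp
    have "ln (pbar_main x) = pi * sqrt x - ln (8 * x) + ln (1 - w x)"
      unfolding pbar_main_def 2 using w[OF that] that by (simp add: ln_mult ln_div)
    moreover have "pi * sqrt x / x = pi * x powr (- 1 / 2)"
    proof -
      have "sqrt x * sqrt x = x" "sqrt x > 0" using that by simp_all
      then have "sqrt x / x = 1 / sqrt x" by (simp add: field_simps)
      then show ?thesis unfolding 1 by (simp only: times_divide_eq_right [symmetric])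
    qed
    ultimately show ?thesis by (simp add: F_def f_def add_divide_distrib diff_divide_distrib)
  qed
  have "f (a + 1) + f (a - 1) - 2 * f a \<le> 3 * pi / 4 * (a - 1) powr (- 5 / 2) - 11 / (a + 1) ^ 3"
  proof (rule second_difference_le)
    fix x assume x: "x \<in> {a - 1..a + 1}"
    then have x1: "x > 1" "x \<ge> 196" using a by auto
    have p1: "x powr (- 1 / 2 - 1) = x powr (- 3 / 2)" "x powr (- 3 / 2 - 1) = x powr (- 5 / 2)" by simp_all
    have d1: "((\<lambda>x. pi * x powr (- 1 / 2)) has_real_derivative - pi / 2 * x powr (- 3 / 2)) (at x)"
      using x1 by (auto intro!: derivative_eq_intros)
    have d2: "((\<lambda>x. ln (8 * x) / x) has_real_derivative (1 - ln (8 * x)) / x\<^sup>2) (at x)"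
      using x1 by (auto intro!: derivative_eq_intros simp: power2_eq_square)
    have d3: "((\<lambda>x. ln (1 - w x) / x) has_real_derivative (w x / (1 - w x) / (2 * x\<^sup>2) - ln (1 - w x) / x\<^sup>2)) (at x)"
    proof -
      have "((\<lambda>x. ln (1 - w x) / x) has_real_derivative ((w x / (1 - w x) / (2 * x)) * x - ln (1 - w x) * 1) / (x * x)) (at x)"
        using x1 by (intro DERIV_divide lnw' DERIV_ident) auto
      moreover have "((w x / (1 - w x) / (2 * x)) * x - ln (1 - w x) * 1) / (x * x) = w x / (1 - w x) / (2 * x\<^sup>2) - ln (1 - w x) / x\<^sup>2"
        using x1 by (simp add: diff_divide_distrib power2_eq_square)
      ultimately show ?thesis by simp
    qed
    show "(f has_real_derivative f' x) (at x)"
      unfolding f_def f'_def by (intro DERIV_add DERIV_diff d1 d2 d3)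
    have e1: "((\<lambda>x. - pi / 2 * x powr (- 3 / 2)) has_real_derivative 3 * pi / 4 * x powr (- 5 / 2)) (at x)"
      using x1 by (auto intro!: derivative_eq_intros)
    have e2: "((\<lambda>x. (1 - ln (8 * x)) / x\<^sup>2) has_real_derivative (2 * ln (8 * x) - 3) / x ^ 3) (at x)"
      using x1 by (auto intro!: derivative_eq_intros simp: divide_simps) (simp add: algebra_simps eval_nat_numeral)
    have e3: "((\<lambda>x. w x / (1 - w x) / (2 * x\<^sup>2)) has_real_derivative
        - (w x / (1 - w x)\<^sup>2 / (4 * x ^ 3)) - w x / (1 - w x) / x ^ 3) (at x)"
    proof -
      have "((\<lambda>x. w x / (1 - w x) / (2 * x\<^sup>2)) has_real_derivative
        (- (w x / (1 - w x)\<^sup>2 / (2 * x)) * (2 * x\<^sup>2) - w x / (1 - w x) * (4 * x)) / ((2 * x\<^sup>2) * (2 * x\<^sup>2))) (at x)"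
        using x1 by (intro DERIV_divide ww') (auto intro!: derivative_eq_intros)
      moreover have "(- (A / (2 * x)) * (2 * x\<^sup>2) - B * (4 * x)) / ((2 * x\<^sup>2) * (2 * x\<^sup>2)) = - (A / (4 * x ^ 3)) - B / x ^ 3" for A B
        using x1 by (simp add: divide_simps) (simp add: algebra_simps eval_nat_numeral)
      ultimately show ?thesis by (simp only:)
    qed
    have e4: "((\<lambda>x. ln (1 - w x) / x\<^sup>2) has_real_derivative w x / (1 - w x) / (2 * x ^ 3) - 2 * ln (1 - w x) / x ^ 3) (at x)"
    proof -
      have "((\<lambda>x. ln (1 - w x) / x\<^sup>2) has_real_derivative
        ((w x / (1 - w x) / (2 * x)) * x\<^sup>2 - ln (1 - w x) * (2 * x)) / (x\<^sup>2 * x\<^sup>2)) (at x)"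
        using x1 by (intro DERIV_divide lnw') (auto intro!: derivative_eq_intros)
      moreover have "((A / (2 * x)) * x\<^sup>2 - B * (2 * x)) / (x\<^sup>2 * x\<^sup>2) = A / (2 * x ^ 3) - 2 * B / x ^ 3" for A B
        using x1 by (simp add: divide_simps) (simp add: algebra_simps eval_nat_numeral)
      ultimately show ?thesis by (simp only:)
    qed
    show "(f' has_real_derivative f'' x) (at x)"
    proof -
      define E where "E = 3 * pi / 4 * x powr (- 5 / 2) - (2 * ln (8 * x) - 3) / x ^ 3 +
        ((- (w x / (1 - w x)\<^sup>2 / (4 * x ^ 3)) - w x / (1 - w x) / x ^ 3) - (w x / (1 - w x) / (2 * x ^ 3) - 2 * ln (1 - w x) / x ^ 3))"
      have "(f' has_real_derivative E) (at x)"
        unfolding f'_def E_def by (intro DERIV_add DERIV_diff e1 e2 e3 e4)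
      moreover have "E = f'' x" unfolding E_def f''_def h''_def by linarith
      ultimately show ?thesis by simp
    qed
    \<comment> \<open>The contribution of the factor \<open>1 - w x\<close> has a favourable sign
      term by term and is discarded.\<close>
    have "h'' x \<le> 0"
    proof -
      have "ln (1 - w x) \<le> 0" using w[OF x1(1)] by simp
      then have "2 * ln (1 - w x) / x ^ 3 \<le> 0" using x1 by (simp add: divide_nonpos_nonneg)
      moreover have "0 \<le> w x / (1 - w x)\<^sup>2 / (4 * x ^ 3)" "0 \<le> w x / (1 - w x) / x ^ 3" "0 \<le> w x / (1 - w x) / (2 * x ^ 3)"
        using w[OF x1(1)] x1 by auto
      moreover have "- A - B - C + D \<le> 0" if "D \<le> 0" "0 \<le> A" "0 \<le> B" "0 \<le> C" for A B C D :: real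
        using that by linarith
      ultimately show ?thesis unfolding h''_def by (simp only:)
    qed
    moreover have "x powr (- 5 / 2) \<le> (a - 1) powr (- 5 / 2)"
      using x a by (intro powr_mono2') auto
    then have "3 * pi / 4 * x powr (- 5 / 2) \<le> 3 * pi / 4 * (a - 1) powr (- 5 / 2)"
      by (intro mult_left_mono) auto
    moreover have "11 / (a + 1) ^ 3 \<le> (2 * ln (8 * x) - 3) / x ^ 3"
    proof (rule frac_le)
      \<comment> \<open>The constant comes from \<open>ln (8 * 196) \<ge> 7\<close>.\<close>
      show l11: "11 \<le> 2 * ln (8 * x) - 3"
      proof -
        have "exp (7::real) \<le> 8 * 196"
        proof -
          have "exp (1::real) \<le> 2.72" using e_less_272 by simp
          have "exp (7::real) = exp 1 ^ 7" by (simp flip: exp_of_nat_mult)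
          also have "\<dots> \<le> 2.72 ^ 7" using \<open>exp (1::real) \<le> 2.72\<close> by (intro power_mono) auto
          also have "\<dots> \<le> (8 * 196 :: real)" by (simp add: eval_nat_numeral)
          finally show ?thesis .
        qed
        then have "ln (exp 7) \<le> ln (8 * x)" using x1 by (subst ln_le_cancel_iff) auto
        then show ?thesis by simp
      qed
      then show "0 \<le> 2 * ln (8 * x) - 3" by linarith
      show "x ^ 3 \<le> (a + 1) ^ 3" using x x1 by (intro power_mono) auto
    qed (use x1 in auto)
    ultimately show "f'' x \<le> 3 * pi / 4 * (a - 1) powr (- 5 / 2) - 11 / (a + 1) ^ 3"
      unfolding f''_def by linarith
  qed
  then show ?thesis using F_eq a by simp
qed

lemma ln_pbar_approx:
  assumes n: "n \<ge> 196"
  shows "\<bar>ln (real (pbar n)) - ln (pbar_main (real n))\<bar> \<le> 1 / (4 * (real n)\<^sup>2)"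
proof -
  define x where "x = sqrt (real n)"
  have x2: "x\<^sup>2 = real n" by (simp add: x_def)
  have "sqrt 196 \<le> x" unfolding x_def using n by (intro real_sqrt_le_mono) simp
  moreover have "sqrt 196 = 14" by (rule real_sqrt_unique) auto
  ultimately have x: "x \<ge> 14" by simp
  define z where "z = pi * x"
  define M where "M = pbar_main (real n)"
  have z: "z \<ge> 42" using mult_mono[of 3 pi 14 x] x pi_bounds by (simp add: z_def)
  have M_eq: "M = exp z / (8 * x\<^sup>2) * (1 - 1 / z)"
    by (simp add: M_def pbar_main_def z_def x2) (simp add: x_def)
  have M0: "M > 0" unfolding M_eq using z x by (intro mult_pos_pos divide_pos_pos) auto
  \<comment> \<open>The aim is \<open>exp (z / 2) \<le> M / (8 * x ^ 4)\<close>. As \<open>M\<close>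
    is at least \<open>8 / 9 * exp z / (8 * x^2)\<close>, this needs
    \<open>exp (z / 2) \<ge> 9 / 8 * 64 * x ^ 6\<close>.\<close>
  have "72 * x ^ 6 \<le> exp (z / 2)"
  proof -
    have "(1.28125::real) \<le> exp (1 / 4)" using exp_lower_Taylor_quadratic[of "1 / 4 :: real"] by (simp add: power2_eq_square)
    then have "(1.28125::real) ^ 14 \<le> exp (1 / 4) ^ 14" by (intro power_mono) auto
    moreover have "exp (1 / 4 :: real) ^ 14 = exp (7 / 2)" by (simp flip: exp_of_nat_mult)
    ultimately have e: "(28.7::real) \<le> exp (7 / 2)" by (simp add: eval_nat_numeral)
    \<comment> \<open>Equality holds at \<open>x = 14\<close>, where
      \<open>28.7 = 2.05 * 14\<close>. The sixth power of \<open>exp (x / 4)\<close> stays below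
      \<open>exp (z / 2)\<close> because \<open>pi > 3\<close>, and \<open>2.05 ^ 6\<close> exceeds
      72.\<close>
    have "2.05 * x \<le> 28.7 * (1 + (x - 14) / 4)" using x by (simp add: field_simps)
    also have "\<dots> \<le> exp (7 / 2) * exp ((x - 14) / 4)"
      using e x by (intro mult_mono exp_ge_add_one_self) auto
    also have "\<dots> = exp (x / 4)" by (simp flip: exp_add add: field_simps)
    finally have "(2.05 * x) ^ 6 \<le> exp (x / 4) ^ 6" using x by (intro power_mono) auto
    also have "exp (x / 4) ^ 6 = exp (3 / 2 * x)" by (simp flip: exp_of_nat_mult)
    also have "\<dots> \<le> exp (z / 2)" unfolding z_def using pi_bounds x by simp
    finally have "2.05 ^ 6 * x ^ 6 \<le> exp (z / 2)" by (simp only: power_mult_distrib)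
    moreover have "72 * x ^ 6 \<le> 2.05 ^ 6 * x ^ 6" using x by (intro mult_right_mono) (auto simp: eval_nat_numeral)
    ultimately show ?thesis by linarith
  qed
  then have "exp (z / 2) * (72 * x ^ 6) \<le> exp (z / 2) * exp (z / 2)" by (intro mult_left_mono) auto
  also have "exp (z / 2) * exp (z / 2) = exp z" by (simp flip: exp_add)
  also have "exp z = M * (8 * x\<^sup>2) / (1 - 1 / z)" unfolding M_eq using z x by simp
  also have "\<dots> \<le> M * (8 * x\<^sup>2) / (8 / 9)"
    using M0 z x by (intro divide_left_mono) (auto simp: field_simps)
  finally have "exp (z / 2) * (8 * x ^ 4) \<le> M"
    using x by (simp add: eval_nat_numeral mult_ac)
  then have E: "exp (z / 2) \<le> M / (8 * (real n)\<^sup>2)"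
    using x by (simp add: pos_le_divide_eq flip: x2)
  define \<epsilon> where "\<epsilon> = 1 / (8 * (real n)\<^sup>2)"
  have "(1::real) \<le> (real n)\<^sup>2" using n by (intro one_le_power) simp
  then have "1 / (8 * (real n)\<^sup>2) \<le> 1 / 2" by (intro divide_left_mono) linarith+
  then have eps: "0 < \<epsilon>" "\<epsilon> \<le> 1 / 2" using n by (simp_all add: \<epsilon>_def)
  define r where "r = real (pbar n) / M"
  have "\<bar>real (pbar n) - M\<bar> \<le> M * \<epsilon>"
    using pbar_asymptotic[OF n] E unfolding M_def [symmetric] z_def x_def \<epsilon>_def by simp
  then have "\<bar>r - 1\<bar> \<le> \<epsilon>"
    using M0 by (simp add: r_def abs_le_iff field_simps)
  then have r: "r > 0" "\<bar>r - 1\<bar> \<le> 1 / 2" "\<bar>r - 1\<bar> \<le> \<epsilon>" using eps by auto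
  have "\<bar>ln (1 + (r - 1))\<bar> \<le> 2 * \<bar>r - 1\<bar>"
  proof -
    have "\<bar>r - 1\<bar> * \<bar>r - 1\<bar> \<le> \<bar>r - 1\<bar> * (1 / 2)" using r by (intro mult_left_mono) auto
    then have "2 * (r - 1)\<^sup>2 \<le> \<bar>r - 1\<bar>" by (simp add: power2_eq_square)
    moreover have "\<bar>ln (1 + (r - 1)) - (r - 1)\<bar> \<le> 2 * (r - 1)\<^sup>2"
      using r by (intro abs_ln_one_plus_x_minus_x_bound)
    moreover have "\<bar>L\<bar> \<le> 2 * \<bar>s\<bar>" if "2 * q \<le> \<bar>s\<bar>" "\<bar>L - s\<bar> \<le> 2 * q" for L s q :: real
      using that by linarith
    ultimately show ?thesis by blast
  qed
  also have "\<dots> \<le> 2 * \<epsilon>" using r by simp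
  also have "\<dots> = 1 / (4 * (real n)\<^sup>2)" by (simp add: \<epsilon>_def)
  finally have "\<bar>ln r\<bar> \<le> 1 / (4 * (real n)\<^sup>2)" by simp
  moreover have "ln r = ln (real (pbar n)) - ln M"
  proof -
    have "real (pbar n) > 0" using r(1) M0 by (simp add: r_def zero_less_divide_iff)
    then show ?thesis using M0 by (simp add: r_def ln_div)
  qed
  ultimately show ?thesis by (simp add: M_def)
qed

lemma pbar_log_inequality_large:
  assumes n: "n \<ge> 197"
  shows "ln (real (pbar (n + 1))) / real (n + 1) + ln (real (pbar (n - 1))) / real (n - 1) - 2 * ln (real (pbar n)) / real n
     < ln (1 + 3 * pi / (4 * real n powr (5 / 2)))"
proof -
  define a where "a = real n"
  have a: "a \<ge> 197" using n by (simp add: a_def)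
  have an: "real (n + 1) = a + 1" "real (n - 1) = a - 1" using n by (auto simp: a_def of_nat_diff)
  define F where "F = (\<lambda>x. ln (pbar_main x) / x)"
  define y where "y = 3 * pi / 4 * a powr (- 5 / 2)"
  have err: "\<bar>ln (real (pbar k)) / real k - F (real k)\<bar> \<le> 1 / (4 * (a - 1) ^ 3)" if "k \<ge> n - 1" for k
  proof -
    have k: "k \<ge> 196" "real k \<ge> a - 1" using that n by (auto simp: a_def)
    have "\<bar>ln (real (pbar k)) / real k - F (real k)\<bar> = \<bar>ln (real (pbar k)) - ln (pbar_main (real k))\<bar> / real k"
      using k by (simp add: F_def abs_divide flip: diff_divide_distrib)
    also have "\<dots> \<le> 1 / (4 * (real k)\<^sup>2) / real k"
      by (intro divide_right_mono ln_pbar_approx k) simp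
    also have "\<dots> = 1 / (4 * real k ^ 3)" by (simp add: eval_nat_numeral)
    also have "\<dots> \<le> 1 / (4 * (a - 1) ^ 3)"
      using k a by (intro divide_left_mono mult_left_mono power_mono) auto
    finally show ?thesis .
  qed
  define c where "c = 1 / (4 * (a - 1) ^ 3)"
  have "\<bar>ln (real (pbar (n + 1))) / (a + 1) - F (a + 1)\<bar> \<le> c" "\<bar>ln (real (pbar (n - 1))) / (a - 1) - F (a - 1)\<bar> \<le> c"
    "\<bar>ln (real (pbar n)) / a - F a\<bar> \<le> c"
    using err[of "n + 1"] err[of "n - 1"] err[of n] unfolding an a_def [symmetric] c_def by simp_all
  then have "ln (real (pbar (n + 1))) / real (n + 1) + ln (real (pbar (n - 1))) / real (n - 1) - 2 * (ln (real (pbar n)) / real n)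
      \<le> F (a + 1) + F (a - 1) - 2 * F a + 4 * c"
    unfolding an a_def [symmetric] by linarith
  also have "4 * c = 1 / (a - 1) ^ 3" by (simp add: c_def)
  also have "F (a + 1) + F (a - 1) - 2 * F a + 1 / (a - 1) ^ 3 \<le> 3 * pi / 4 * (a - 1) powr (- 5 / 2) - 11 / (a + 1) ^ 3 + 1 / (a - 1) ^ 3"
    using ln_pbar_main_div_second_difference[OF a] unfolding F_def by simp
  \<comment> \<open>Budget in units of \<open>1 / a ^ 3\<close>: the logarithmic term gains 5;
    moving the power from \<open>a - 1\<close> to \<open>a\<close> costs 0.7, the approximation of
    \<open>pbar\<close> costs 2 and the square in \<open>ln (1 + y) \<ge> y - y^2\<close> costs
    1.\<close>
  also have "\<dots> < y - y\<^sup>2"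
  proof -
    have rt: "a powr (- 5 / 2) \<le> 1 / (14 * a\<^sup>2)"
    proof -
      have "a powr (- 5 / 2) = a powr (- 1 / 2) * a powr (- 2)" by (simp flip: powr_add)
      also have "a powr (- 1 / 2) = 1 / sqrt a" using a by (simp add: powr_minus powr_half_sqrt inverse_eq_divide)
      also have "a powr (- 2) = 1 / a\<^sup>2" using a by (simp add: powr_minus inverse_eq_divide)
      finally have "a powr (- 5 / 2) = 1 / (sqrt a * a\<^sup>2)" by simp
      moreover have "14 \<le> sqrt a" using a by (intro real_le_rsqrt) simp
      then have "14 * a\<^sup>2 \<le> sqrt a * a\<^sup>2" by (intro mult_right_mono) auto
      ultimately show ?thesis using a by (simp add: frac_le)
    qed
    have "(a - 1) powr (- 5 / 2) \<le> a powr (- 5 / 2) * (1 + 4 / a)"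
    proof -
      have b: "0 < 1 - 1 / a" "1 - 1 / a \<le> 1" using a by auto
      have "a - 1 = a * (1 - 1 / a)" using a by (simp add: right_diff_distrib)
      then have "(a - 1) powr (- 5 / 2) = (a * (1 - 1 / a)) powr (- 5 / 2)" by (simp only:)
      also have "\<dots> = a powr (- 5 / 2) * (1 - 1 / a) powr (- 5 / 2)" by (rule powr_mult)
      also have "(1 - 1 / a) powr (- 5 / 2) \<le> (1 - 1 / a) powr (- 3)"
        using b by (intro powr_mono') auto
      also have "(1 - 1 / a) powr (- 3) = 1 / (1 - 1 / a) ^ 3"
        using b by (simp add: powr_minus inverse_eq_divide)
      also have "\<dots> \<le> 1 + 4 / a"
      proof -
        have "1 / a \<le> 1 / 197" using a by simp
        moreover define v where "v = 1 / a"
        ultimately have v: "0 \<le> v" "v \<le> 1 / 197" using a by auto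
        have "(1 - v) ^ 3 \<ge> 1 + 3 * (- v)" using Bernoulli_inequality[of "- v" 3] v by simp
        then have "(1 - 3 * v) * (1 + 4 * v) \<le> (1 - v) ^ 3 * (1 + 4 * v)" using v by (intro mult_right_mono) auto
        moreover have "1 \<le> (1 - 3 * v) * (1 + 4 * v)"
        proof -
          have "v * (12 * v) \<le> v * 1" using v by (intro mult_left_mono) auto
          then show ?thesis by (simp add: algebra_simps)
        qed
        ultimately have "1 \<le> (1 - v) ^ 3 * (1 + 4 * v)" by linarith
        then have "1 / (1 - v) ^ 3 \<le> 1 + 4 * v" using v by (simp add: divide_le_eq mult.commute)
        then show ?thesis by (simp add: v_def)
      qed
      finally show ?thesis by (simp add: mult_left_mono)
    qed
    then have "3 * pi / 4 * (a - 1) powr (- 5 / 2) \<le> 3 * pi / 4 * (a powr (- 5 / 2) * (1 + 4 / a))"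
      by (intro mult_left_mono) auto
    also have "\<dots> = y + 3 * pi / a * a powr (- 5 / 2)" by (simp add: y_def algebra_simps)
    also have "3 * pi / a * a powr (- 5 / 2) \<le> 3 * 3.142 / a * (1 / (14 * a\<^sup>2))"
      using rt a pi_bounds by (intro mult_mono divide_right_mono) auto
    finally have 1: "3 * pi / 4 * (a - 1) powr (- 5 / 2) \<le> y + 0.7 / a ^ 3"
    proof (rule order_trans[OF _ add_left_mono])
      show "3 * 3.142 / a * (1 / (14 * a\<^sup>2)) \<le> 0.7 / a ^ 3"
        using a by (simp add: divide_simps eval_nat_numeral)
    qed simp
    have "y \<le> 3 * 3.142 / 4 * (1 / (14 * a\<^sup>2))"
      unfolding y_def using rt pi_bounds by (intro mult_mono) auto
    also have "\<dots> \<le> 1 / a\<^sup>2" using a by (simp add: divide_simps)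
    finally have "y\<^sup>2 \<le> (1 / a\<^sup>2)\<^sup>2" by (intro power_mono) (auto simp: y_def)
    also have "\<dots> = 1 / a * (1 / a ^ 3)" by (simp add: eval_nat_numeral)
    also have "\<dots> \<le> 1 * (1 / a ^ 3)" using a by (intro mult_right_mono) auto
    finally have 2: "y\<^sup>2 \<le> 1 / a ^ 3" by simp
    have 3: "1 / (a - 1) ^ 3 \<le> 2 / a ^ 3"
    proof -
      have "a ^ 3 \<le> (1.01 * (a - 1)) ^ 3" using a by (intro power_mono) auto
      also have "\<dots> = 1.01 ^ 3 * (a - 1) ^ 3" by (simp only: power_mult_distrib)
      also have "\<dots> \<le> 2 * (a - 1) ^ 3" using a by (intro mult_right_mono) (auto simp: eval_nat_numeral)
      finally show ?thesis using a by (simp add: divide_simps)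
    qed
    have 4: "5 / a ^ 3 \<le> 11 / (a + 1) ^ 3"
    proof -
      have "(a + 1) ^ 3 \<le> (1.01 * a) ^ 3" using a by (intro power_mono) auto
      also have "\<dots> = 1.01 ^ 3 * a ^ 3" by (simp only: power_mult_distrib)
      also have "\<dots> \<le> 2 * a ^ 3" using a by (intro mult_right_mono) (auto simp: eval_nat_numeral)
      finally have "(a + 1) ^ 3 \<le> 2 * a ^ 3" .
      moreover have "0 \<le> a ^ 3" using a by simp
      ultimately have "5 * (a + 1) ^ 3 \<le> 11 * a ^ 3" by linarith
      then show ?thesis using a by (simp add: divide_simps)
    qed
    have "0 < 1 / a ^ 3" using a by simp
    moreover have "P - U + V < y - q" if "P \<le> y + 0.7 * X" "q \<le> X" "V \<le> 2 * X" "5 * X \<le> U" "0 < X" for P U V q X :: real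
      using that by linarith
    moreover have "3 * pi / 4 * (a - 1) powr (- 5 / 2) \<le> y + 0.7 * (1 / a ^ 3)" using 1 by simp
    moreover have "1 / (a - 1) ^ 3 \<le> 2 * (1 / a ^ 3)" "5 * (1 / a ^ 3) \<le> 11 / (a + 1) ^ 3" using 3 4 by simp_all
    ultimately show ?thesis using 2 by blast
  qed
  also have "\<dots> \<le> ln (1 + y)"
  proof (rule ln_one_plus_pos_lower_bound)
    show "0 \<le> y" by (simp add: y_def)
    have "a powr (- 5 / 2) \<le> 197 powr (- 5 / 2)" using a by (intro powr_mono2') auto
    also have "\<dots> \<le> 197 powr (- 1)" by (intro powr_mono) auto
    also have "\<dots> = 1 / (197 :: real)" by (simp add: powr_minus)
    finally have "y \<le> 3 * 3.142 / 4 * (1 / 197)"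
      unfolding y_def using pi_bounds by (intro mult_mono) auto
    then show "y \<le> 1" by simp
  qed
  also have "y = 3 * pi / (4 * real n powr (5 / 2))"
  proof -
    have "a powr (- 5 / 2) = 1 / a powr (5 / 2)" using powr_minus_divide[of a "5 / 2"] by simp
    then show ?thesis unfolding y_def a_def by simp
  qed
  finally show ?thesis by simp
qed

section \<open>Small arguments\<close>

text \<open>The sum over squares in the theta recurrence, run along the list of earlier values.
  Consuming one entry and dropping \<open>g = 2 * k\<close> more bridges the gap
  \<open>2 * k + 1\<close> from \<open>k^2\<close> to the next square; the nested subtraction
  alternates the signs.\<close>

fun alt_sum :: "nat \<Rightarrow> int list \<Rightarrow> int" where
  "alt_sum g [] = 0"
| "alt_sum g (x # xs) = x - alt_sum (g + 2) (drop g xs)"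

text \<open>The part of the convolution from index \<open>k^2\<close> on, where \<open>m\<close>
  values of \<open>pbar\<close> are left. Strong induction is needed because one step removes
  \<open>2 * k + 1\<close> of them.\<close>

lemma pbar_recurrence_aux:
  assumes "k \<ge> 1"
  shows "(\<Sum>i\<in>{k\<^sup>2..<k\<^sup>2 + m}. theta_coeff i * of_nat (pbar (k\<^sup>2 + m - 1 - i))) =
         2 * (-1) ^ k * of_int (alt_sum (2 * k) (map (\<lambda>i. int (pbar i)) (rev [0..<m])))"
  using assms
proof (induction m arbitrary: k rule: less_induct)
  case (less m)
  show ?case
  proof (cases m)
    case 0
    then show ?thesis by simp
  next
    case (Suc m')
    \<comment> \<open>If fewer than \<open>2 * k\<close> entries remain, truncated subtraction gives
      0, which matches \<open>drop\<close> running off the list.\<close>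
    define d where "d = m' - 2 * k"
    have sq: "(Suc k)\<^sup>2 = k\<^sup>2 + 2 * k + 1" by (simp add: power2_eq_square)
    have L: "alt_sum (2 * k) (map (\<lambda>i. int (pbar i)) (rev [0..<m])) =
        int (pbar m') - alt_sum (2 * Suc k) (map (\<lambda>i. int (pbar i)) (rev [0..<d]))"
      by (simp add: Suc drop_map drop_rev d_def)
    have "{k\<^sup>2..<k\<^sup>2 + m} = insert (k\<^sup>2) {Suc (k\<^sup>2)..<k\<^sup>2 + m}" using Suc by auto
    then have "(\<Sum>i\<in>{k\<^sup>2..<k\<^sup>2 + m}. theta_coeff i * of_nat (pbar (k\<^sup>2 + m - 1 - i))) =
       theta_coeff (k\<^sup>2) * of_nat (pbar m') + (\<Sum>i\<in>{Suc (k\<^sup>2)..<k\<^sup>2 + m}. theta_coeff i * of_nat (pbar (k\<^sup>2 + m - 1 - i)))"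
      by (simp add: Suc)
    also have "(\<Sum>i\<in>{Suc (k\<^sup>2)..<k\<^sup>2 + m}. theta_coeff i * of_nat (pbar (k\<^sup>2 + m - 1 - i))) =
       (\<Sum>i\<in>{(Suc k)\<^sup>2..<(Suc k)\<^sup>2 + d}. theta_coeff i * of_nat (pbar ((Suc k)\<^sup>2 + d - 1 - i)))"
    proof (rule sum.mono_neutral_cong)
      fix i assume i: "i \<in> {Suc (k\<^sup>2)..<k\<^sup>2 + m} - {(Suc k)\<^sup>2..<(Suc k)\<^sup>2 + d}"
      then have lt: "k\<^sup>2 < i" "i < (Suc k)\<^sup>2" by (auto simp: sq d_def Suc)
      have "i \<noteq> s\<^sup>2" for s
      proof
        assume s: "i = s\<^sup>2"
        have "k < s" using lt(1) unfolding s by (rule power2_less_imp_less) simp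
        moreover have "s < Suc k" using lt(2) unfolding s by (rule power2_less_imp_less) simp
        ultimately show False by simp
      qed
      then show "theta_coeff i * of_nat (pbar (k\<^sup>2 + m - 1 - i)) = 0" using lt by (simp add: theta_coeff_def)
    next
      fix i assume i: "i \<in> {(Suc k)\<^sup>2..<(Suc k)\<^sup>2 + d} - {Suc (k\<^sup>2)..<k\<^sup>2 + m}"
      then show "theta_coeff i * of_nat (pbar ((Suc k)\<^sup>2 + d - 1 - i)) = 0" by (auto simp: sq d_def Suc)
    next
      fix i assume i: "i \<in> {Suc (k\<^sup>2)..<k\<^sup>2 + m} \<inter> {(Suc k)\<^sup>2..<(Suc k)\<^sup>2 + d}"
      then have "k\<^sup>2 + m - 1 - i = (Suc k)\<^sup>2 + d - 1 - i" by (auto simp: sq d_def Suc)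
      then show "theta_coeff i * of_nat (pbar (k\<^sup>2 + m - 1 - i)) = theta_coeff i * of_nat (pbar ((Suc k)\<^sup>2 + d - 1 - i))"
        by (simp only:)
    qed auto
    also have "\<dots> = 2 * (-1) ^ Suc k * of_int (alt_sum (2 * Suc k) (map (\<lambda>i. int (pbar i)) (rev [0..<d])))"
      by (rule less.IH) (auto simp: d_def Suc)
    also have "theta_coeff (k\<^sup>2) = 2 * (-1) ^ k"
      using less.prems by (auto simp: theta_coeff_def minus_one_power_iff)
    finally show ?thesis unfolding L by (simp add: algebra_simps)
  qed
qed

lemma pbar_recurrence:
  assumes "n \<ge> 1"
  shows "int (pbar n) = 2 * alt_sum 2 (map (\<lambda>i. int (pbar i)) (rev [0..<n]))"
proof -
  have "0 = fps_nth (theta_fps * pbar_fps) n"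
    using assms by (simp add: mult.commute[of theta_fps] pbar_fps_mult_theta)
  also have "\<dots> = (\<Sum>i=0..n. theta_coeff i * of_nat (pbar (n - i)))"
    by (simp add: fps_mult_nth theta_fps_def pbar_fps_def)
  also have "{0..n} = insert 0 {1..<1 + n}" by auto
  also have "(\<Sum>i\<in>insert 0 {1..<1 + n}. theta_coeff i * of_nat (pbar (n - i))) =
      of_nat (pbar n) + (\<Sum>i\<in>{1..<1 + n}. theta_coeff i * of_nat (pbar (n - i)))"
    by (simp add: theta_coeff_def)
  also have "(\<Sum>i\<in>{1..<1 + n}. theta_coeff i * of_nat (pbar (n - i))) =
     2 * (-1) ^ 1 * of_int (alt_sum (2 * 1) (map (\<lambda>i. int (pbar i)) (rev [0..<n])))"
    using pbar_recurrence_aux[of 1 n] by simp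
  finally have "of_nat (pbar n) = complex_of_int (2 * alt_sum 2 (map (\<lambda>i. int (pbar i)) (rev [0..<n])))"
    by (simp add: eq_neg_iff_add_eq_0)
  then have "complex_of_int (int (pbar n)) = complex_of_int (2 * alt_sum 2 (map (\<lambda>i. int (pbar i)) (rev [0..<n])))"
    by (simp only: of_int_of_nat_eq)
  then show ?thesis by (simp only: of_int_eq_iff)
qed

text \<open>Fixed-point arithmetic: the integer \<open>x\<close> stands for \<open>x / scale\<close>.\<close>

abbreviation (input) scale :: int where "scale \<equiv> 100000000"

text \<open>Partial sums of \<open>v + v^3 / 3 + v^5 / 5 + ...\<close>: \<open>x\<close> stands for
  the current power of \<open>v\<close>, \<open>w\<close> for \<open>v^2\<close>, and
  \<open>k\<close> for the odd denominator. All divisions round down.\<close>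

primrec artanh_lower :: "nat \<Rightarrow> int \<Rightarrow> int \<Rightarrow> int \<Rightarrow> int" where
  "artanh_lower 0 k x w = 0"
| "artanh_lower (Suc m) k x w = x div k + artanh_lower m (k + 2) (x * w div scale) w"

text \<open>Every floor is raised by 1, and the next power itself is returned at the end to cover
  the remainder of the series.\<close>

primrec artanh_upper :: "nat \<Rightarrow> int \<Rightarrow> int \<Rightarrow> int \<Rightarrow> int" where
  "artanh_upper 0 k x w = x"
| "artanh_upper (Suc m) k x w = x div k + 1 + artanh_upper m (k + 2) (x * w div scale + 1) w"

section \<open>Correctness of the fixed-point logarithm\<close>

lemma of_int_div_le: "k > 0 \<Longrightarrow> real_of_int (x div k) \<le> real_of_int x / real_of_int k"
  by (simp add: real_of_int_div4)

lemma of_int_div_ge: "k > 0 \<Longrightarrow> real_of_int x / real_of_int k \<le> real_of_int (x div k + 1)"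
  using real_of_int_div2[of x k] real_of_int_div3[of x k] by simp

lemma artanh_lower_le:
  fixes v :: real
  assumes "0 \<le> x" "real_of_int x \<le> of_int scale * v ^ k" "0 \<le> w" "real_of_int w \<le> of_int scale * v\<^sup>2" "k \<ge> 1" "0 \<le> v"
  shows "real_of_int (artanh_lower m (int k) x w) \<le> of_int scale * (\<Sum>j<m. v ^ (k + 2 * j) / (k + 2 * j))"
  using assms
proof (induction m arbitrary: k x)
  case (Suc m)
  have 1: "real_of_int (x div int k) \<le> of_int scale * (v ^ k / k)"
  proof -
    have "real_of_int (x div int k) \<le> real_of_int x / real k" using of_int_div_le[of "int k" x] Suc.prems by simp
    also have "\<dots> \<le> of_int scale * v ^ k / k" using Suc.prems by (intro divide_right_mono) auto
    finally show ?thesis by simp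
  qed
  have 2: "real_of_int (x * w div scale) \<le> of_int scale * v ^ (k + 2)"
  proof -
    have "real_of_int (x * w div scale) \<le> real_of_int (x * w) / of_int scale" by (rule of_int_div_le) simp
    also have "\<dots> \<le> (of_int scale * v ^ k) * (of_int scale * v\<^sup>2) / of_int scale"
      unfolding of_int_mult using Suc.prems by (intro divide_right_mono mult_mono) auto
    also have "\<dots> = of_int scale * v ^ (k + 2)" by (simp add: power_add power2_eq_square)
    finally show ?thesis .
  qed
  have "real_of_int (artanh_lower m (int (k + 2)) (x * w div scale) w) \<le> of_int scale * (\<Sum>j<m. v ^ (k + 2 + 2 * j) / (k + 2 + 2 * j))"
    using Suc.prems 2 by (intro Suc.IH) (auto simp: pos_imp_zdiv_nonneg_iff)
  moreover have "(\<Sum>j<Suc m. v ^ (k + 2 * j) / (k + 2 * j)) = v ^ k / k + (\<Sum>j<m. v ^ (k + 2 + 2 * j) / (k + 2 + 2 * j))"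
    by (subst sum.lessThan_Suc_shift) (simp add: algebra_simps)
  ultimately show ?case using 1 by (simp add: algebra_simps)
qed simp

lemma artanh_upper_ge:
  fixes v :: real
  assumes "0 \<le> x" "of_int scale * v ^ k \<le> real_of_int x" "0 \<le> w" "of_int scale * v\<^sup>2 \<le> real_of_int w" "k \<ge> 1" "0 \<le> v"
  shows "of_int scale * ((\<Sum>j<m. v ^ (k + 2 * j) / (k + 2 * j)) + v ^ (k + 2 * m)) \<le> real_of_int (artanh_upper m (int k) x w)"
  using assms
proof (induction m arbitrary: k x)
  case (Suc m)
  have 1: "of_int scale * (v ^ k / k) \<le> real_of_int (x div int k + 1)"
  proof -
    have "of_int scale * v ^ k / k \<le> real_of_int x / real k" using Suc.prems by (intro divide_right_mono) auto
    also have "\<dots> \<le> real_of_int (x div int k + 1)" using of_int_div_ge[of "int k" x] Suc.prems by simp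
    finally show ?thesis by simp
  qed
  have 2: "of_int scale * v ^ (k + 2) \<le> real_of_int (x * w div scale + 1)"
  proof -
    have "of_int scale * v ^ (k + 2) = (of_int scale * v ^ k) * (of_int scale * v\<^sup>2) / of_int scale"
      by (simp add: power_add power2_eq_square)
    also have "\<dots> \<le> real_of_int (x * w) / of_int scale"
      unfolding of_int_mult using Suc.prems by (intro divide_right_mono mult_mono) auto
    also have "\<dots> \<le> real_of_int (x * w div scale + 1)" by (rule of_int_div_ge) simp
    finally show ?thesis .
  qed
  have "of_int scale * ((\<Sum>j<m. v ^ (k + 2 + 2 * j) / (k + 2 + 2 * j)) + v ^ (k + 2 + 2 * m)) \<le>
     real_of_int (artanh_upper m (int (k + 2)) (x * w div scale + 1) w)"
    using Suc.prems 2 by (intro Suc.IH) (auto simp: pos_imp_zdiv_nonneg_iff intro!: add_nonneg_nonneg)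
  moreover have "(\<Sum>j<Suc m. v ^ (k + 2 * j) / (k + 2 * j)) = v ^ k / k + (\<Sum>j<m. v ^ (k + 2 + 2 * j) / (k + 2 + 2 * j))"
    by (subst sum.lessThan_Suc_shift) (simp add: algebra_simps)
  ultimately show ?case using 1 by (simp add: algebra_simps)
qed simp

text \<open>The logarithm of \<open>b / a\<close> is twice the area tangent of
  \<open>(b - a) / (b + a)\<close>. Since \<open>b \<le> 2 * a\<close> this argument is at most 1/3,
  and after eight terms the remainder is below \<open>3 ^ (- 17)\<close>, less than one unit of the
  scale.\<close>

lemma ln_ratio_bounds:
  fixes a b :: int
  assumes ab: "0 < a" "a < b" "b \<le> 2 * a"
  defines "v \<equiv> scale * (b - a) div (b + a)"
  shows "real_of_int (2 * artanh_lower 8 1 v (v * v div scale)) \<le> of_int scale * ln (of_int b / of_int a)"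
    and "of_int scale * ln (of_int b / of_int a) \<le> real_of_int (2 * artanh_upper 8 1 (v + 1) ((v + 1) * (v + 1) div scale + 1))"
proof -
  define x where "x = real_of_int b / real_of_int a"
  define y where "y = (x - 1) / (x + 1)"
  have x: "x > 1" using ab by (simp add: x_def)
  have y_eq: "y = real_of_int (b - a) / real_of_int (b + a)"
    using ab by (simp add: y_def x_def divide_simps)
  have y: "0 \<le> y" "y \<le> 1 / 3" using ab by (auto simp: y_eq divide_simps)
  define A where "A = (\<Sum>j<8. y ^ (1 + 2 * j) / real (1 + 2 * j))"
  have A2: "(\<Sum>k<8. 2 * y ^ (2 * k + 1) / of_nat (2 * k + 1)) = 2 * A"
    by (simp add: A_def sum_distrib_left)
  have lnb: "2 * A \<le> ln x" "ln x \<le> 2 * A + 2 * (y ^ 17 / (1 - y\<^sup>2) / 17)"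
    using ln_approx_bounds[OF x, of 8] unfolding y_def [symmetric] A2 by auto
  have v0: "0 \<le> v" unfolding v_def using ab by (simp add: pos_imp_zdiv_nonneg_iff)
  have v_le: "real_of_int v \<le> of_int scale * y"
    unfolding v_def y_eq using of_int_div_le[of "b + a" "scale * (b - a)"] ab by simp
  have v_ge: "of_int scale * y \<le> real_of_int (v + 1)"
    unfolding v_def y_eq using of_int_div_ge[of "b + a" "scale * (b - a)"] ab by simp
  have "real_of_int (v * v div scale) \<le> real_of_int (v * v) / of_int scale" by (rule of_int_div_le) simp
  also have "\<dots> \<le> (of_int scale * y) * (of_int scale * y) / of_int scale"
    unfolding of_int_mult using v0 v_le y by (intro divide_right_mono mult_mono) auto
  also have "\<dots> = of_int scale * y\<^sup>2" by (simp add: power2_eq_square)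
  finally have "real_of_int (artanh_lower 8 (int 1) v (v * v div scale)) \<le> of_int scale * A"
    unfolding A_def using v0 v_le y by (intro artanh_lower_le) (auto simp: pos_imp_zdiv_nonneg_iff)
  then show "real_of_int (2 * artanh_lower 8 1 v (v * v div scale)) \<le> of_int scale * ln (of_int b / of_int a)"
    using lnb unfolding x_def by simp
  have "of_int scale * y\<^sup>2 = (of_int scale * y) * (of_int scale * y) / of_int scale" by (simp add: power2_eq_square)
  also have "\<dots> \<le> real_of_int ((v + 1) * (v + 1)) / of_int scale"
    unfolding of_int_mult using v0 v_ge y by (intro divide_right_mono mult_mono) auto
  also have "\<dots> \<le> real_of_int ((v + 1) * (v + 1) div scale + 1)" by (rule of_int_div_ge) simp
  finally have "of_int scale * (A + y ^ (1 + 2 * 8)) \<le> real_of_int (artanh_upper 8 (int 1) (v + 1) ((v + 1) * (v + 1) div scale + 1))"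
    unfolding A_def using v0 v_ge y by (intro artanh_upper_ge) (auto simp: pos_imp_zdiv_nonneg_iff intro!: add_nonneg_nonneg)
  moreover have "y ^ 17 / (1 - y\<^sup>2) / 17 \<le> y ^ 17"
  proof -
    have "y\<^sup>2 \<le> (1 / 3)\<^sup>2" using y by (intro power_mono) auto
    then have "1 \<le> (1 - y\<^sup>2) * 17" by (simp add: power2_eq_square)
    then have "y ^ 17 / ((1 - y\<^sup>2) * 17) \<le> y ^ 17 / 1" using y by (intro divide_left_mono) auto
    then show ?thesis by simp
  qed
  ultimately show "of_int scale * ln (of_int b / of_int a) \<le> real_of_int (2 * artanh_upper 8 1 (v + 1) ((v + 1) * (v + 1) div scale + 1))"
    using lnb unfolding x_def by simp
qed

text \<open>
  Every positive \<open>k\<close> gives the valid bound \<open>sqrt n \<le> (n + k\<^sup>2) / (2 * k)\<close>.  With it and \<open>pi \<ge> 3.1\<close> the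
  fraction \<open>P / R\<close> below is at most \<open>3 * pi / (4 * n powr (5 / 2))\<close>.
\<close>
definition sqrt_guess :: "int \<Rightarrow> int" where
  "sqrt_guess n = (if n < 4 then 1 else if n < 16 then 3 else if n < 64 then 6 else if n < 128 then 10 else 13)"

text \<open>The inequality with \<open>ln (1 + y)\<close> replaced by \<open>y - y^2\<close> for
  \<open>y = P / R\<close>, cleared of all denominators; \<open>P \<le> R\<close> gives the
  \<open>y \<le> 1\<close> which that bound requires. The constants 186 and 40 come from
  \<open>3 * 3.1 * 2 * k / 4\<close>, scaled by 10.\<close>

definition log_check :: "int \<Rightarrow> int \<Rightarrow> int \<Rightarrow> int \<Rightarrow> bool" where
  "log_check n u0 l u1 =
     (let k = sqrt_guess n; P = 186 * k; R = 40 * n * n * (n + k * k)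
      in P \<le> R \<and>
         (u0 * n * (n + 1) + u1 * n * (n - 1) - 2 * l * (n * n - 1)) * (R * R) < scale * (P * R - P * P) * n * (n * n - 1))"

lemma sqrt_guess_pos: "sqrt_guess n > 0"
  by (simp add: sqrt_guess_def)

lemma log_check_sound:
  fixes n :: nat and f0 f f1 :: real
  assumes check: "log_check (int n) u0 l u1" and n: "n \<ge> 2"
    and f0: "of_int scale * f0 \<le> of_int u0" and f: "of_int l \<le> of_int scale * f"
    and f1: "of_int scale * f1 \<le> of_int u1"
  shows "f1 / real (n + 1) + f0 / real (n - 1) - 2 * f / real n < ln (1 + 3 * pi / (4 * real n powr (5 / 2)))"
proof -
  define k where "k = real_of_int (sqrt_guess (int n))"
  define P where "P = 186 * k"
  define a where "a = real n"
  define R where "R = 40 * a * a * (a + k * k)"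
  define y where "y = P / R"
  define N where "N = a * (a * a - 1)"
  have k: "k > 0" using sqrt_guess_pos by (simp add: k_def)
  have a: "a \<ge> 2" using n by (simp add: a_def)
  have R0: "R > 0" and P0: "P > 0" using a k by (auto simp: R_def P_def intro!: mult_pos_pos add_pos_pos)
  have "a * a \<ge> 2 * 2" using a by (intro mult_mono) auto
  then have N0: "N > 0" using a by (simp add: N_def)
  define c where "c = real_of_int scale"
  have c0: "c > 0" by (simp add: c_def)
  have PR: "P \<le> R"
    and num: "(u0 * a * (a + 1) + u1 * a * (a - 1) - 2 * l * (a * a - 1)) * (R * R) < c * (P * R - P * P) * a * (a * a - 1)"
  proof -
    define k' where "k' = sqrt_guess (int n)"
    have R': "R = real_of_int (40 * int n * int n * (int n + k' * k'))" by (simp add: R_def a_def k_def k'_def)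
    have P': "P = real_of_int (186 * k')" by (simp add: P_def k_def k'_def)
    show "P \<le> R" using check unfolding log_check_def Let_def k'_def [symmetric] R' P' of_int_le_iff by simp
    have "real_of_int ((u0 * int n * (int n + 1) + u1 * int n * (int n - 1) - 2 * l * (int n * int n - 1)) *
       ((40 * int n * int n * (int n + k' * k')) * (40 * int n * int n * (int n + k' * k')))) <
       real_of_int (scale * ((186 * k') * (40 * int n * int n * (int n + k' * k')) - (186 * k') * (186 * k')) * int n * (int n * int n - 1))"
      using check unfolding log_check_def Let_def k'_def [symmetric] of_int_less_iff by blast
    then show "(u0 * a * (a + 1) + u1 * a * (a - 1) - 2 * l * (a * a - 1)) * (R * R) < c * (P * R - P * P) * a * (a * a - 1)"
      unfolding R' P' c_def a_def by (simp only: of_int_mult of_int_diff of_int_add of_int_1 of_int_of_nat_eq of_int_numeral)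
  qed
  define G where "G = f1 / (a + 1) + f0 / (a - 1) - 2 * f / a"
  have GN: "G * N = f0 * a * (a + 1) + f1 * a * (a - 1) - 2 * f * (a * a - 1)"
    using a by (simp add: G_def N_def divide_simps) (simp add: algebra_simps)
  have "c * (G * N) \<le> u0 * a * (a + 1) + u1 * a * (a - 1) - 2 * l * (a * a - 1)"
  proof -
    have "c * f0 * (a * (a + 1)) \<le> u0 * (a * (a + 1))" using f0 a unfolding c_def by (intro mult_right_mono) auto
    moreover have "c * f1 * (a * (a - 1)) \<le> u1 * (a * (a - 1))" using f1 a unfolding c_def by (intro mult_right_mono) auto
    moreover have "l * (2 * (a * a - 1)) \<le> c * f * (2 * (a * a - 1))" using f N0 a unfolding c_def N_def
      by (intro mult_right_mono) (auto simp: zero_less_mult_iff)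
    ultimately show ?thesis unfolding GN by (simp add: algebra_simps)
  qed
  then have "c * (G * N) * (R * R) \<le> (u0 * a * (a + 1) + u1 * a * (a - 1) - 2 * l * (a * a - 1)) * (R * R)"
    by (intro mult_right_mono) auto
  also have "\<dots> < c * (P * R - P * P) * N" using num by (simp add: N_def mult_ac)
  finally have "(c * N) * (G * (R * R)) < (c * N) * (P * R - P * P)" by (simp add: mult_ac)
  then have "G * (R * R) < P * R - P * P" using c0 N0 by (subst (asm) mult_less_cancel_left_pos) auto
  then have "G < (P * R - P * P) / (R * R)" using R0 by (subst pos_less_divide_eq) auto
  also have "\<dots> = y - y\<^sup>2" using R0 by (simp add: y_def power2_eq_square diff_divide_distrib)
  also have "\<dots> \<le> ln (1 + y)"
    using PR P0 R0 by (intro ln_one_plus_pos_lower_bound) (auto simp: y_def)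
  also have "\<dots> \<le> ln (1 + 3 * pi / (4 * real n powr (5 / 2)))"
  proof -
    have s: "sqrt a * sqrt a = a" "sqrt a > 0" using a by auto
    have "0 \<le> (sqrt a - k) * (sqrt a - k)" by (rule zero_le_square)
    then have am: "sqrt a * (2 * k) \<le> a + k * k" using s by (simp add: algebra_simps)
    have "y = 9.3 * (2 * k) / (4 * a\<^sup>2 * (a + k * k))" by (simp add: y_def P_def R_def power2_eq_square)
    also have "\<dots> \<le> 9.3 * (2 * k) / (4 * a\<^sup>2 * (sqrt a * (2 * k)))"
      using am k a by (intro divide_left_mono mult_left_mono mult_pos_pos) (auto intro!: add_pos_pos)
    also have "\<dots> = 9.3 / (4 * (a\<^sup>2 * sqrt a))" using k by simp
    also have "a\<^sup>2 * sqrt a = a powr (5 / 2)"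
    proof -
      have "a powr (5 / 2) = a powr 2 * a powr (1 / 2)" by (simp flip: powr_add)
      then show ?thesis using a by (simp add: powr_half_sqrt)
    qed
    also have "9.3 / (4 * a powr (5 / 2)) \<le> 3 * pi / (4 * a powr (5 / 2))"
      using pi_approx by (intro divide_right_mono) auto
    finally have "y \<le> 3 * pi / (4 * real n powr (5 / 2))" by (simp add: a_def)
    moreover have "y > 0" using P0 R0 by (simp add: y_def)
    ultimately show ?thesis by simp
  qed
  finally show ?thesis using n by (simp add: G_def a_def of_nat_diff add.commute)
qed

text \<open>
  Invariant: \<open>xs\<close> lists \<open>pbar n, \<dots>, pbar 0\<close>, the scaled \<open>ln (pbar n)\<close> lies in \<open>{l..u}\<close>, and \<open>u0\<close> is an
  upper bound for the scaled \<open>ln (pbar (n - 1))\<close>.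
\<close>
primrec verify :: "nat \<Rightarrow> int \<Rightarrow> int list \<Rightarrow> int \<Rightarrow> int \<Rightarrow> int \<Rightarrow> bool" where
  "verify 0 n xs u0 l u = True"
| "verify (Suc m) n xs u0 l u =
     (let a = hd xs; b = 2 * alt_sum 2 xs; v = scale * (b - a) div (b + a);
          l' = l + 2 * artanh_lower 8 1 v (v * v div scale);
          u' = u + 2 * artanh_upper 8 1 (v + 1) ((v + 1) * (v + 1) div scale + 1)
      in a < b \<and> b \<le> 2 * a \<and> (n < 2 \<or> log_check n u0 l u') \<and> verify m (n + 1) (b # xs) u l' u')"

text \<open>Logarithms are accumulated from the ratios of consecutive values, starting with
  \<open>ln 1 = 0\<close>, so the series is only ever evaluated for ratios between 1 and 2.\<close>

lemma verify_sound:
  assumes "verify m (int n) xs u0 l u"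
    and "xs = map (\<lambda>i. int (pbar i)) (rev [0..<Suc n])"
    and "of_int l \<le> of_int scale * ln (real (pbar n))" "of_int scale * ln (real (pbar n)) \<le> of_int u"
    and "n \<ge> 1 \<Longrightarrow> of_int scale * ln (real (pbar (n - 1))) \<le> of_int u0"
    and "pbar n > 0" "n \<le> i" "i < n + m" "i \<ge> 2"
  shows "ln (real (pbar (i + 1))) / real (i + 1) + ln (real (pbar (i - 1))) / real (i - 1) - 2 * ln (real (pbar i)) / real i
     < ln (1 + 3 * pi / (4 * real i powr (5 / 2)))"
  using assms
proof (induction m arbitrary: n xs u0 l u)
  case (Suc m)
  define a where "a = int (pbar n)"
  define b where "b = int (pbar (Suc n))"
  define v where "v = scale * (b - a) div (b + a)"
  define l' where "l' = l + 2 * artanh_lower 8 1 v (v * v div scale)"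
  define u' where "u' = u + 2 * artanh_upper 8 1 (v + 1) ((v + 1) * (v + 1) div scale + 1)"
  have hd: "hd xs = a" using Suc.prems(2) by (simp add: a_def)
  have b_eq: "2 * alt_sum 2 xs = b" using pbar_recurrence[of "Suc n"] unfolding b_def Suc.prems(2) by simp
  have ver: "a < b" "b \<le> 2 * a" "int n < 2 \<or> log_check (int n) u0 l u'" "verify m (int n + 1) (b # xs) u l' u'"
    using Suc.prems(1) unfolding verify.simps Let_def hd b_eq v_def [symmetric] l'_def [symmetric] u'_def [symmetric] by blast+
  have a0: "a > 0" using Suc.prems(6) by (simp add: a_def)
  have ln_b: "ln (real (pbar (Suc n))) = ln (real (pbar n)) + ln (of_int b / of_int a)"
    using a0 ver(1) by (simp add: ln_div a_def b_def)
  note R = ln_ratio_bounds[OF a0 ver(1,2), folded v_def]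
  have l': "of_int l' \<le> of_int scale * ln (real (pbar (Suc n)))"
    using R(1) Suc.prems(3) unfolding l'_def ln_b of_int_add distrib_left by linarith
  have u': "of_int scale * ln (real (pbar (Suc n))) \<le> of_int u'"
    using R(2) Suc.prems(4) unfolding u'_def ln_b of_int_add distrib_left by linarith
  show ?case
  proof (cases "i = n")
    case True
    then have "log_check (int n) u0 l u'" using ver(3) Suc.prems(9) by auto
    from log_check_sound[OF this _ Suc.prems(5) Suc.prems(3) u'] show ?thesis
      using True Suc.prems(9) by simp
  next
    case False
    show ?thesis
    proof (rule Suc.IH)
      show "verify m (int (Suc n)) (b # xs) u l' u'" using ver(4) by (simp add: add.commute)
      show "b # xs = map (\<lambda>i. int (pbar i)) (rev [0..<Suc (Suc n)])" using Suc.prems(2) by (simp add: b_def)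
      show "0 < pbar (Suc n)" using ver(1) a0 by (simp add: b_def)
      show "real_of_int l' \<le> of_int scale * ln (real (pbar (Suc n)))" by (rule l')
      show "of_int scale * ln (real (pbar (Suc n))) \<le> real_of_int u'" by (rule u')
      show "of_int scale * ln (real (pbar (Suc n - 1))) \<le> real_of_int u" using Suc.prems(4) by simp
      show "Suc n \<le> i" using Suc.prems(7) False by simp
      show "i < Suc n + m" using Suc.prems(8) by simp
      show "2 \<le> i" by (rule Suc.prems(9))
    qed
  qed
qed simp

text \<open>The steps treat \<open>n = 0\<close> to \<open>n = 196\<close>, testing the inequality
  from \<open>n = 2\<close> on. At \<open>n = 0\<close> there is no predecessor, and its bound 0 is
  a placeholder.\<close>

lemma verify_197: "verify 197 0 [1] 0 0 0"
  by code_simp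

lemma pbar_log_inequality_small:
  assumes "2 \<le> n" "n \<le> 196"
  shows "ln (real (pbar (n + 1))) / real (n + 1) + ln (real (pbar (n - 1))) / real (n - 1) - 2 * ln (real (pbar n)) / real n
     < ln (1 + 3 * pi / (4 * real n powr (5 / 2)))"
proof (rule verify_sound)
  show "verify 197 (int 0) [1] 0 0 0" using verify_197 by (simp only: of_nat_0)
  show "[1] = map (\<lambda>i. int (pbar i)) (rev [0..<Suc 0])" by (simp add: pbar_0)
qed (use assms in \<open>simp_all add: pbar_0\<close>)

section \<open>From logarithms back to roots\<close>

lemma pbar_pos: "pbar n > 0"
proof -
  have "replicate n (1, False) \<in> overpartitions n"
    by (auto simp: overpartitions_def sorted_wrt_iff_nth_less sum_list_replicate)
  then show ?thesis
    unfolding pbar_def using finite_overpartitions card_gt_0_iff by blast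
qed

lemma root_eq_exp_ln: "n > 0 \<Longrightarrow> x > 0 \<Longrightarrow> root n x = exp (ln x / real n)"
  by (simp add: root_powr_inverse powr_def field_simps)

theorem corollary1p4:
  fixes n :: nat
  assumes "n \<ge> 2"
  shows "root n (real (pbar n)) / root (n + 1) (real (pbar (n + 1)))
           * (1 + 3 * pi / (4 * real n powr (5 / 2)))
         > root (n - 1) (real (pbar (n - 1))) / root n (real (pbar n))"
proof -
  define f where "f k = ln (real (pbar k)) / real k" for k
  define Y where "Y = 1 + 3 * pi / (4 * real n powr (5 / 2))"
  have Y: "Y > 0" by (simp add: Y_def add_pos_nonneg)
  have rt: "root k (real (pbar k)) = exp (f k)" if "k > 0" for k
    unfolding f_def using that pbar_pos by (intro root_eq_exp_ln) auto
  have "f (n + 1) + f (n - 1) - 2 * f n < ln Y"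
    using pbar_log_inequality_small[of n] pbar_log_inequality_large[of n] assms
    unfolding f_def Y_def by (cases "n \<le> 196") auto
  then have "f (n - 1) - f n < f n - f (n + 1) + ln Y" by simp
  then have "exp (f (n - 1) - f n) < exp (f n - f (n + 1) + ln Y)" by simp
  also have "\<dots> = exp (f n) / exp (f (n + 1)) * Y" using Y by (simp add: exp_add exp_diff)
  finally have "exp (f (n - 1)) / exp (f n) < exp (f n) / exp (f (n + 1)) * Y"
    by (simp add: exp_diff)
  \<comment> \<open>The exponential form of the roots holds for positive indices only;
    \<open>n \<ge> 2\<close> secures this for \<open>n - 1\<close>.\<close>
  moreover have "n > 0" "n + 1 > 0" "n - 1 > 0" using assms by auto
  ultimately show ?thesis unfolding Y_def using rt by metis
qed

end
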